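(* In the setting and notation given in the context, suppose that the following five hypotheses hold. (i) (Conditional dependency graph.) $\mathcal{G}$ is a graph with vertex set $\mathcal{A}$ such that, for all $t\ge 1$, if $\alpha\in\mathcal{A}$ is not connected by any edge to any vertex in $\mathcal{A}'\subset\mathcal{A}\setminus\{\alpha\}$, then $O_{\alpha,t}$ is conditionally independent of $(O_{\alpha',t})_{\alpha'\in\mathcal{A}'}$ given $F_{t-1}$ and $\bar Z_t$. (ii) The element $\theta^\star\in\Theta$ minimizes over $\Theta$ all the risks $\theta\mapsto \mathbb{E}[\ell(\theta)(O_{\alpha,t},Z_{\alpha,t})\mid Z_{\alpha,t},F_{t-1}]$, for all $\alpha\in\mathcal{A}$ and $t\ge1$. Moreover, for every $\theta\in\Theta$ and every sequence $(\theta_t)_{t\ge1}$ of elements of $\Theta$ adapted to $(F_t)_{t\ge1}$, for all $t\ge2$ and all non-negative integers $\varepsilon_1,\varepsilon_2$ with $\varepsilon_1+\varepsilon_2=2$, $$\mathbb{E}\Big[\sum_{\alpha\in\mathcal{A}}(\ell(\theta_{t-1})(O_{\alpha,t},Z_{\alpha,t}))^{\varepsilon_1}(\ell(\theta)(O_{\alpha,t},Z_{\alpha,t}))^{\varepsilon_2}\,\Big|\,\bar Z_t,F_{t-1}\Big]=\sum_{\alpha\in\mathcal{A}}\mathbb{E}\Big[(\ell(\theta_{t-1})(O_{\alpha,t},Z_{\alpha,t}))^{\varepsilon_1}(\ell(\theta)(O_{\alpha,t},Z_{\alpha,t}))^{\varepsilon_2}\,\Big|\,Z_{\alpha,t},F_{t-1}\Big].$$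 (iii) There exists $b_1>0$ such that $\sup_{\theta\in\Theta}\|\Delta^\circ\ell(\theta)\|_\infty\le b_1$, and there exists $b_2\in(0,2b_1]$ such that, almost surely, for all $\alpha\in\mathcal{A}$, $t\ge1$, $\theta\in\Theta$, $$\big|\Delta^\circ\ell(\theta)(O_{\alpha,t},Z_{\alpha,t})-\mathbb{E}[\Delta^\circ\ell(\theta)(O_{\alpha,t},Z_{\alpha,t})\mid Z_{\alpha,t},F_{t-1}]\big|\le b_2.$$ (iv) There exist $\beta\in(0,1]$ and $\gamma>0$ such that, almost surely, for all $\alpha\in\mathcal{A}$, $t\ge1$, $\theta\in\Theta$, $$\mathbb{E}\big[(\Delta^\circ\ell(\theta)(O_{\alpha,t},Z_{\alpha,t}))^2\mid Z_{\alpha,t},F_{t-1}\big]\le\gamma\big(\mathbb{E}[\Delta^\circ\ell(\theta)(O_{\alpha,t},Z_{\alpha,t})\mid Z_{\alpha,t},F_{t-1}]\big)^\beta.$$ (v) There exists $v_1>0$ such that, almost surely, for all $\alpha\in\mathcal{A}$, $t\ge1$, $\theta\in\Theta$, $\mathrm{Var}[\Delta^\circ\ell(\theta)(O_{\alpha,t},Z_{\alpha,t})\mid Z_{\alpha,t},F_{t-1}]\le v_1$. Define $$v_2:=\frac{3\pi}{2}\left[\left(\frac{15b_2}{|\mathcal{A}|/\deg(\mathcal{G})}\right)^2+\frac{64v_1}{|\mathcal{A}|/\deg(\mathcal{G})}\right].$$ Fix arbitrarily two integers $N,N'\ge2$ and a real number $a>0$, and set $\underline{x}(a,N):=a[2^{-N}v_2/\gamma]^{1/\beta}$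 and $\underline{x}'(a,N'):=a\,b_1 2^{-N'}$. Then, for all $t\ge1$ and $x\ge\underline{x}(a,N)$, $$\mathbb{P}\left[\widetilde R_{\widehat j_t,t}-\widetilde R_t(\theta^\circ)\ge(1+2a)\left(\widetilde R_{\widetilde j_t,t}-\widetilde R_t(\theta^\circ)\right)+x\right]\le 2JN\left[\exp\left(-\frac{t\,x^{2-\beta}}{C_1(a)}\right)+\exp\left(-\frac{t\,x}{C_2(a)}\right)\right],$$ where $C_1(a):=2^{5-\beta}(1+a)^2\gamma/a^\beta$ and $C_2(a):=8(1+a)b_2/3$. Moreover, for all $t\ge1$ and $x\ge\underline{x}'(a,N')$, $$\mathbb{P}\left[\widetilde R_{\widehat j_t,t}-\widetilde R_t(\theta^\circ)\ge(1+2a)\left(\widetilde R_{\widetilde j_t,t}-\widetilde R_t(\theta^\circ)\right)+x\right]\le 2e^2JN'\left[\exp\left(-\frac{[|\mathcal{A}|/(t^\beta\deg(\mathcal{G}))]\,x^{2-\beta}}{C_1'(a)}\right)+\exp\left(-\frac{[|\mathcal{A}|/\deg(\mathcal{G})]\,x}{C_2'(a)}\right)\right],$$ where $C_1'(a):=2^{6+2\beta}e^2(1+a)^2\gamma/a^\beta$ and $C_2'(a):=60e(1+a)b_2$.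
   Context: Data. $\mathcal{A}$ is a finite nonempty index set with cardinality $|\mathcal{A}|$; $\mathcal{O}$ and $\mathcal{Z}$ are measurable spaces. $(\bar O_t)_{t\ge1}$ is a random sequence with law $\mathbb{P}$, where each $\bar O_t=(O_{\alpha,t})_{\alpha\in\mathcal{A}}$ is a collection of $\mathcal{O}$-valued random elements. $F_t:=\sigma(O_{\alpha,\tau}:\alpha\in\mathcal{A},1\le\tau\le t)$ for $t\ge1$, and $F_0$ is trivial. $\bar Z_t=(Z_{\alpha,t})_{\alpha\in\mathcal{A}}\in\mathcal{Z}^{\mathcal{A}}$ is a summary of $\bar O_t$: $\bar Z_t=\mathrm{Summ}(\bar O_t)$ for a known fixed function $\mathrm{Summ}$ not depending on $t$ (the summary may be empty, i.e. uninformative). For a graph $\mathcal{G}$ with vertex set $\mathcal{A}$, $\deg(\mathcal{G})$ denotes $1$ plus the maximum degree of $\mathcal{G}$. Loss. $\Theta$ is a parameter space and $\ell:\Theta\to\mathbb{R}^{\mathcal{O}\times\mathcal{Z}}$ is a loss function. For $\theta\in\Theta$ and $\tau\ge1$, $\bar\ell(\theta)(\bar O_\tau,\bar Z_\tau):=\frac{1}{|\mathcal{A}|}\sum_{\alpha\in\mathcal{A}}\ell(\theta)(O_{\alpha,\tau},Z_{\alpha,\tau})$. A sequence $(\theta_t)_{t\ge1}$ is adapted to $(F_t)_{t\ge1}$ if each $\theta_t$ is $F_t$-measurable. Algorithms. $J\ge1$ is an integer. For each $j\in\{1,\dots,J\}$, the algorithm $\widehat\theta_j$ maps, for every $t\ge1$,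 $\bar O_1,\dots,\bar O_t$ to an element $\theta_{j,t}$ of a subset $\Theta_j\subset\Theta$; $\theta_{j,0}$ is a fixed pre-specified element of $\Theta_j$. Risks. For $j\in\{1,\dots,J\}$, $t\ge1$, $\theta\in\Theta$, $$\widetilde R_{j,t}:=\frac1t\sum_{\tau=1}^t\mathbb{E}[\bar\ell(\theta_{j,\tau-1})(\bar O_\tau,\bar Z_\tau)\mid\bar Z_\tau,F_{\tau-1}],\quad \widehat R_{j,t}:=\frac1t\sum_{\tau=1}^t\bar\ell(\theta_{j,\tau-1})(\bar O_\tau,\bar Z_\tau),$$ $$\widetilde R_t(\theta):=\frac1t\sum_{\tau=1}^t\mathbb{E}[\bar\ell(\theta)(\bar O_\tau,\bar Z_\tau)\mid\bar Z_\tau,F_{\tau-1}].$$ In conditional expectations involving $\theta_{j,\tau-1}$, the latter is $F_{\tau-1}$-measurable. Let $\widehat j_t\in\arg\min_{1\le j\le J}\widehat R_{j,t}$ (one-step ahead sequential Super Learner) and $\widetilde j_t\in\arg\min_{1\le j\le J}\widetilde R_{j,t}$ (oracle), ties being broken arbitrarily. Reference element. $\theta^\circ\in\Theta$ is a fixed element such that $\widetilde R_t(\theta^\circ)\le\min_{1\le j\le J}\min_{\theta\in\Theta_j}\widetilde R_t(\theta)$ (almost surely, for every $t\ge1$). For $\theta\in\Theta$, $\Delta^\circ\ell(\theta):=\ell(\theta)-\ell(\theta^\circ)$; $\|\cdot\|_\infty$ is the supremum norm on $\mathcal{O}\times\mathcal{Z}$.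
   Formalization: The identity in (ii) is also assumed at t=1 (fixed parameters) and for ε1+ε2=1 at all t≥1, as the claim fails otherwise; "almost surely, for all θ" in (iii)-(v) is read as for every F_{t-1}-measurable choice of θ; losses are jointly measurable and square integrable. *)

theory Defs
  imports "HOL-Probability.Probability" "Graph_Theory.Graph_Theory"
begin

text \<open>
  The family \<open>Obs\<close> is indexed by \<open>\<alpha> \<in> A\<close> and by the times \<open>1, 2, \<dots>\<close>; the value at time \<open>0\<close> is never
  used. In particular \<open>history M A MO Obs 0\<close> is generated by the empty family, hence trivial.
\<close>
definition history ::
    "'w measure \<Rightarrow> 'i set \<Rightarrow> 'o measure \<Rightarrow> ('i \<Rightarrow> nat \<Rightarrow> 'w \<Rightarrow> 'o) \<Rightarrow> nat \<Rightarrow> 'w measure" where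
  "history M A MO Obs t =
     sigma (space M)
       {Obs \<alpha> \<tau> -` B \<inter> space M | \<alpha> \<tau> B. \<alpha> \<in> A \<and> \<tau> \<in> {1..t} \<and> B \<in> sets MO}"

text \<open>The \<open>\<sigma>\<close>-algebra generated by \<open>F\<close> and by the random element \<open>X\<close> of \<open>N\<close>.\<close>
definition adjoin :: "'w measure \<Rightarrow> 'b measure \<Rightarrow> ('w \<Rightarrow> 'b) \<Rightarrow> 'w measure" where
  "adjoin F N X = sigma (space F) (sets F \<union> {X -` B \<inter> space F | B. B \<in> sets N})"

definition cond_indep_var ::
    "'w measure \<Rightarrow> 'w measure \<Rightarrow> 'b measure \<Rightarrow> ('w \<Rightarrow> 'b) \<Rightarrow> 'c measure \<Rightarrow> ('w \<Rightarrow> 'c) \<Rightarrow> bool" where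
  "cond_indep_var M G MX X MY Y \<longleftrightarrow>
     (\<forall>B\<in>sets MX. \<forall>C\<in>sets MY. AE \<omega> in M.
        real_cond_exp M G (indicator (X -` B \<inter> Y -` C \<inter> space M)) \<omega> =
        real_cond_exp M G (indicator (X -` B \<inter> space M)) \<omega> *
        real_cond_exp M G (indicator (Y -` C \<inter> space M)) \<omega>)"

definition cond_var :: "'w measure \<Rightarrow> 'w measure \<Rightarrow> ('w \<Rightarrow> real) \<Rightarrow> 'w \<Rightarrow> real" where
  "cond_var M G X = real_cond_exp M G (\<lambda>\<omega>. (X \<omega> - real_cond_exp M G X \<omega>)\<^sup>2)"

text \<open>
  One plus the maximum degree. An undirected edge is a pair of opposite arcs, so that in a
  \<^const>\<open>pair_graph\<close> the out-degree of a vertex is its number of neighbours.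
\<close>
definition deg :: "'i pair_pre_digraph \<Rightarrow> nat" where
  "deg G = 1 + Max (out_degree (with_proj G) ` pverts G)"

text \<open>
  The identity expressing that \<open>X \<alpha>\<close> may be predicted from \<open>G \<alpha>\<close>, generated by the summary at \<open>\<alpha>\<close> and
  the past, instead of \<open>Gbar\<close>, generated by the summaries at all vertices and the past. It is only
  required for the sum over \<open>A\<close>. It is meant for products of two losses and for the losses themselves,
  from the first time step on: the former case does not imply the latter, and the latter is what turns
  a bound on conditional means given \<open>G \<alpha>\<close> into a bound on the risk, which is defined with \<open>Gbar\<close>.
\<close>
definition sum_cond_exp_local ::
    "'w measure \<Rightarrow> 'w measure \<Rightarrow> ('i \<Rightarrow> 'w measure) \<Rightarrow> 'i set \<Rightarrow> ('i \<Rightarrow> 'w \<Rightarrow> real) \<Rightarrow> bool" where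
  "sum_cond_exp_local M Gbar G A X \<longleftrightarrow>
     (AE \<omega> in M. real_cond_exp M Gbar (\<lambda>\<omega>'. \<Sum>\<alpha>\<in>A. X \<alpha> \<omega>') \<omega> =
                 (\<Sum>\<alpha>\<in>A. real_cond_exp M (G \<alpha>) (X \<alpha>) \<omega>))"

text \<open>
  ``Almost surely, for all \<open>\<theta>\<close>'', for a property \<open>P\<close> expressed through conditional expectations.
  Those are determined only up to a null set that depends on \<open>\<theta>\<close>, so that a quantifier over a possibly
  uncountable \<open>\<Theta>\<close> inside \<open>AE\<close> would depend on the versions that \<^const>\<open>real_cond_exp\<close> happens to pick.
  The version-free content of the phrase is that the null set may not spoil any
  choice \<open>\<eta>\<close> of the parameter that is measurable with respect to the past \<open>F\<close>; constant \<open>\<eta>\<close> are included.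
\<close>
definition as_for_all_params ::
    "'w measure \<Rightarrow> 'w measure \<Rightarrow> 'p measure \<Rightarrow> (('w \<Rightarrow> 'p) \<Rightarrow> 'w \<Rightarrow> bool) \<Rightarrow> bool" where
  "as_for_all_params M F \<Theta> P \<longleftrightarrow> (\<forall>\<eta> \<in> F \<rightarrow>\<^sub>M \<Theta>. AE \<omega> in M. P \<eta> \<omega>)"

end

theory Submission
  imports Defs
begin

text \<open>
  Let \<open>e j \<tau>\<close> be the average over \<open>A\<close> of the excess losses of algorithm \<open>j\<close> at time \<open>\<tau>\<close>, relative to
  \<open>\<theta>0\<close>, and \<open>m j \<tau> \<ge> 0\<close> its conditional mean given the past and the summaries. The sums over \<open>\<tau>\<close> of
  \<open>e j \<tau>\<close> and of \<open>m j \<tau>\<close> are, up to the factor \<open>1 / t\<close>, the excess empirical risk and the excess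
  conditional risk. Since \<open>jhat\<close> minimises the former, its conditional excess risk can only exceed
  \<open>1 + 2 * a\<close> times that of \<open>jtilde\<close> by \<open>x\<close> if, for one of the two indices, the martingale with
  increments \<open>e j \<tau> - m j \<tau>\<close> deviates from \<open>0\<close> by more than a multiple of the sum over \<open>\<tau>\<close> of
  \<open>x + a * m j \<tau>\<close>. A union bound over \<open>j\<close> and the two signs leaves \<open>2 * J\<close> tail probabilities
  (\<open>oracle_deviation\<close>).

  Each of them is bounded by an exponential supermartingale (\<open>chernoff_adapted_sum\<close>), whose
  increments are controlled by a conditional Bernstein inequality (\<open>cond_bernstein\<close>). The variance
  entering there is bounded, through the Bernstein condition, by a constant times \<open>m powr \<beta>\<close>. A
  concave power lies below an affine function, \<open>m powr \<beta> \<le> h powr (\<beta> - 1) * (h + m)\<close>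
  (\<open>powr_le_linear\<close>), and for \<open>h = x / a\<close> the right-hand side is proportional to \<open>x + a * m\<close>, the very
  quantity that the deviation has to exceed. The variance is therefore absorbed by part of the
  deviation, and the two restrictions on the free parameter of the exponential, that it be small
  against the variance factor and against the bound on the increments, produce the two exponentials
  of the theorem.

  For the first bound, the increment is a single variable bounded by \<open>b2\<close> (\<open>avg_moment\<close>). For the
  second one, the dependency graph is coloured greedily with \<open>deg G\<close> colours
  (\<open>pair_graph_colouring\<close>). Vertices of one colour are conditionally independent, so that their
  exponential moments multiply (\<open>cond_bernstein_independent\<close>), and the convexity of the exponential
  combines the colours (\<open>cond_bernstein_coloured\<close>); this replaces the variance by
  \<open>deg G / card A\<close> times the average variance (\<open>avg_moment_coloured\<close>). The step from the conditional
  independence of events to that of functions of an observation, its summary and the past is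
  \<open>real_cond_exp_cond_indep\<close>. The exponents obtained in this way grow like \<open>t * card A / deg G\<close>, at
  least as fast as those of the second bound.
\<close>

section \<open>Two elementary inequalities\<close>

text \<open>
  The range reaches \<open>3 / 2\<close>, where the quadratic still has a little room to spare
  (\<open>e\<^sup>3 < (19 / 4)\<^sup>2\<close>); this endpoint is what yields the constant \<open>8 / 3\<close> in the final bound.
\<close>
lemma exp_le_quadratic:
  fixes y :: real
  assumes "y \<le> 3 / 2"
  shows "exp y \<le> 1 + y + y\<^sup>2"
proof -
  \<comment> \<open>\<open>\<phi>\<close> decreases up to \<open>0\<close>, increases up to \<open>1\<close> and decreases again, so its minimum is
    attained at \<open>0\<close> or at the right end.\<close>
  define \<phi> :: "real \<Rightarrow> real" where "\<phi> = (\<lambda>z. (1 + z + z\<^sup>2) * exp (- z))"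
  have deriv: "(\<phi> has_real_derivative z * (1 - z) * exp (- z)) (at z)" for z
    unfolding \<phi>_def
    by (rule derivative_eq_intros refl | simp)+ (simp add: algebra_simps power2_eq_square)
  have "1 \<le> \<phi> y"
  proof -
    consider "y \<le> 0" | "0 \<le> y" "y \<le> 1" | "1 \<le> y" by linarith
    then show ?thesis
    proof cases
      case 1
      then have "\<phi> 0 \<le> \<phi> y"
        by (intro DERIV_nonpos_imp_nonincreasing[of y 0 \<phi>])
          (use deriv in \<open>auto intro!: exI simp: mult_nonpos_nonneg\<close>)
      then show ?thesis by (simp add: \<phi>_def)
    next
      case 2
      then have "\<phi> 0 \<le> \<phi> y"
        by (intro DERIV_nonneg_imp_nondecreasing[of 0 y \<phi>]) (use deriv in \<open>force intro!: exI\<close>)+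
      then show ?thesis by (simp add: \<phi>_def)
    next
      case 3
      have "\<phi> (3 / 2) \<le> \<phi> y"
      proof (rule DERIV_nonpos_imp_nonincreasing[of y "3/2" \<phi>])
        show "y \<le> 3 / 2" by fact
        fix z assume "y \<le> z" "z \<le> 3 / 2"
        then have "z * (1 - z) * exp (- z) \<le> 0"
          using 3 by (intro mult_nonpos_nonneg mult_nonneg_nonpos) auto
        then show "\<exists>w. (\<phi> has_real_derivative w) (at z) \<and> w \<le> 0"
          using deriv by blast
      qed
      moreover have "1 \<le> \<phi> (3 / 2)"
      proof -
        have "(exp (3 / 2 :: real))\<^sup>2 = exp 1 ^ 3"
          by (simp flip: exp_of_nat_mult exp_double)
        also have "\<dots> \<le> (272 / 100) ^ 3"
          using e_less_272 by (intro power_mono) auto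
        also have "\<dots> \<le> (19 / 4)\<^sup>2" by (simp add: power2_eq_square power3_eq_cube)
        finally have "exp (3 / 2 :: real) \<le> 19 / 4"
          by (rule power2_le_imp_le) simp
        then show ?thesis
          by (simp add: \<phi>_def exp_minus field_simps power2_eq_square)
      qed
      ultimately show ?thesis by simp
    qed
  qed
  then show ?thesis by (simp add: \<phi>_def exp_minus field_simps)
qed

text \<open>
  For \<open>m \<le> h\<close> the power is at most \<open>h powr \<beta>\<close>, and beyond \<open>h\<close> the quotient
  \<open>m powr \<beta> / m\<close> only decreases.
\<close>
lemma powr_le_linear:
  fixes m h \<beta> :: real
  assumes "0 \<le> m" "0 < h" "0 < \<beta>" "\<beta> \<le> 1"
  shows "m powr \<beta> \<le> h powr (\<beta> - 1) * (h + m)"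
proof (cases "m \<le> h")
  case True
  then have "m powr \<beta> \<le> h powr \<beta>"
    using assms by (intro powr_mono2) auto
  also have "\<dots> = h powr (\<beta> - 1) * h"
    using assms by (simp add: powr_mult_base mult.commute)
  also have "\<dots> \<le> h powr (\<beta> - 1) * (h + m)"
    using assms by (intro mult_left_mono) auto
  finally show ?thesis .
next
  case False
  then have "m powr \<beta> = m powr (\<beta> - 1) * m"
    using assms by (simp add: powr_mult_base mult.commute)
  also have "\<dots> \<le> h powr (\<beta> - 1) * (h + m)"
    using assms False by (intro mult_mono powr_mono2') auto
  finally show ?thesis .
qed

section \<open>Conditional expectations and adjoined random elements\<close>

lemma space_adjoin [simp]: "space (adjoin F N X) = space F"
  by (simp add: adjoin_def space_measure_of_conv)

lemma sets_adjoin: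
  "sets (adjoin F N X) = sigma_sets (space F) (sets F \<union> {X -` B \<inter> space F | B. B \<in> sets N})"
  unfolding adjoin_def by (rule sets_measure_of) (use sets.space_closed[of F] in auto)

lemma subalgebra_adjoin: "subalgebra (adjoin F N X) F"
  unfolding subalgebra_def sets_adjoin by auto

lemma measurable_adjoin:
  assumes "X \<in> space F \<rightarrow> space N"
  shows "X \<in> adjoin F N X \<rightarrow>\<^sub>M N"
  using assms unfolding measurable_def sets_adjoin by auto

lemma subalgebra_adjoin_least:
  assumes "subalgebra M F" "X \<in> M \<rightarrow>\<^sub>M N"
  shows "subalgebra M (adjoin F N X)"
proof -
  have "sets (adjoin F N X) \<subseteq> sets M"
    unfolding sets_adjoin using assms
    by (intro sets.sigma_sets_subset') (auto simp: subalgebra_def measurable_sets)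
  with assms(1) show ?thesis by (simp add: subalgebra_def)
qed

lemma subalgebra_trans: "subalgebra M G \<Longrightarrow> subalgebra G F \<Longrightarrow> subalgebra M F"
  by (auto simp: subalgebra_def)

lemma measurable_subalgebra: "f \<in> F \<rightarrow>\<^sub>M N \<Longrightarrow> subalgebra M F \<Longrightarrow> f \<in> M \<rightarrow>\<^sub>M N"
  by (rule measurable_from_subalg)

text \<open>
  The sets \<open>g \<inter> X -` B\<close> form an intersection-stable generator of the adjoined
  \<open>\<sigma>\<close>-algebra, and the sets on which two integrals agree form a Dynkin system.
\<close>
lemma set_integral_eq_adjoin:
  fixes u v :: "'a \<Rightarrow> real"
  assumes sub: "subalgebra M G" and X: "X \<in> M \<rightarrow>\<^sub>M N"
    and u: "integrable M u" and v: "integrable M v"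
    and eq: "\<And>g B. g \<in> sets G \<Longrightarrow> B \<in> sets N \<Longrightarrow>
      (LINT \<omega>:g \<inter> X -` B|M. u \<omega>) = (LINT \<omega>:g \<inter> X -` B|M. v \<omega>)"
    and C: "C \<in> sets (adjoin G N X)"
  shows "(LINT \<omega>:C|M. u \<omega>) = (LINT \<omega>:C|M. v \<omega>)"
proof -
  let ?E = "{g \<inter> X -` B | g B. g \<in> sets G \<and> B \<in> sets N}"
  have sp: "space G = space M" using sub by (simp add: subalgebra_def)
  have E_sub: "?E \<subseteq> Pow (space M)"
    using sets.sets_into_space[of _ G] sp by blast
  have Int: "Int_stable ?E"
  proof (rule Int_stableI)
    fix a b assume "a \<in> ?E" "b \<in> ?E"
    then obtain g B g' B' where *: "a = g \<inter> X -` B" "g \<in> sets G" "B \<in> sets N"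
        "b = g' \<inter> X -` B'" "g' \<in> sets G" "B' \<in> sets N" by blast
    then have "a \<inter> b = (g \<inter> g') \<inter> X -` (B \<inter> B')" by auto
    with * show "a \<inter> b \<in> ?E" by blast
  qed
  have "sets (adjoin G N X) \<subseteq> sigma_sets (space M) ?E"
    unfolding sets_adjoin sp
  proof (rule sigma_sets_mono, safe)
    fix g assume g: "g \<in> sets G"
    then have "g = g \<inter> X -` space N"
      using sets.sets_into_space[OF g] sp measurable_space[OF X] by auto
    with g have "g \<in> ?E" by blast
    then show "g \<in> sigma_sets (space M) ?E" ..
  next
    fix B assume "B \<in> sets N"
    then have "X -` B \<inter> space M \<in> ?E"
      using sets.top[of G] sp by (auto simp: Int_commute)
    then show "X -` B \<inter> space M \<in> sigma_sets (space M) ?E" ..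
  qed
  with C have C': "C \<in> sigma_sets (space M) ?E" by auto
  have sig: "D \<in> sets M" if "D \<in> sigma_sets (space M) ?E" for D
  proof -
    have "?E \<subseteq> sets M"
    proof safe
      fix g B assume *: "g \<in> sets G" "B \<in> sets N"
      then have "g \<in> sets M" using sub by (auto simp: subalgebra_def)
      moreover have "g \<inter> X -` B = g \<inter> (X -` B \<inter> space M)"
        using sets.sets_into_space[OF \<open>g \<in> sets M\<close>] by auto
      ultimately show "g \<inter> X -` B \<in> sets M"
        using measurable_sets[OF X *(2)] by auto
    qed
    then show ?thesis using sets.sigma_sets_subset that by blast
  qed
  have si: "set_integrable M D w" if "D \<in> sets M" "integrable M w" for D and w :: "'a \<Rightarrow> real"
    using integrable_mult_indicator[OF that] by (simp add: set_integrable_def)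
  have whole: "(LINT \<omega>:space M|M. u \<omega>) = (LINT \<omega>:space M|M. v \<omega>)"
  proof -
    have "space M = space M \<inter> X -` space N" using measurable_space[OF X] by auto
    then show ?thesis using eq[of "space M" "space N"] sp sets.top[of G] by auto
  qed
  from Int E_sub C' show ?thesis
  proof (induction rule: sigma_sets_induct_disjoint)
    case (basic D)
    then show ?case using eq by auto
  next
    case empty
    show ?case by (simp add: set_lebesgue_integral_def)
  next
    case (compl D)
    have D: "D \<in> sets M" using sig compl by auto
    have "(LINT \<omega>:space M|M. w \<omega>) = (LINT \<omega>:D|M. w \<omega>) + (LINT \<omega>:space M - D|M. w \<omega>)"
      if w: "integrable M w" for w :: "'a \<Rightarrow> real"
    proof -
      have "D \<union> (space M - D) = space M" using sets.sets_into_space[OF D] by auto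
      then show ?thesis
        using set_integral_Un[of D "space M - D" M w] si[OF D w] si[OF _ w, of "space M - D"] D by auto
    qed
    from this[OF u] this[OF v] whole compl show ?case by simp
  next
    case (union D)
    then have D: "D i \<in> sets M" for i using sig by (auto simp: subset_eq)
    have "(LINT \<omega>:(\<Union>i. D i)|M. w \<omega>) = (\<Sum>i. (LINT \<omega>:(D i)|M. w \<omega>))"
      if w: "integrable M w" for w :: "'a \<Rightarrow> real"
      using union(1) D
      by (intro lebesgue_integral_countable_add si w) (auto simp: disjoint_family_on_def)
    from this[OF u] this[OF v] union show ?case by simp
  qed
qed

context prob_space
begin

lemma finite_measure_subalgebraI: "subalgebra M G \<Longrightarrow> finite_measure_subalgebra M G"
  by unfold_locales

lemma real_cond_exp_sum_finite:
  fixes f :: "'i \<Rightarrow> 'a \<Rightarrow> real"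
  assumes sub: "subalgebra M G" and f: "\<And>i. i \<in> I \<Longrightarrow> integrable M (f i)"
  shows "AE \<omega> in M. real_cond_exp M G (\<lambda>\<omega>. \<Sum>i\<in>I. f i \<omega>) \<omega> = (\<Sum>i\<in>I. real_cond_exp M G (f i) \<omega>)"
proof -
  interpret finite_measure_subalgebra M G by (rule finite_measure_subalgebraI[OF sub])
  let ?f = "\<lambda>i \<omega>. if i \<in> I then f i \<omega> else 0"
  have "integrable M (?f i)" for i
    using f by (cases "i \<in> I") auto
  then have "AE \<omega> in M. real_cond_exp M G (\<lambda>\<omega>. \<Sum>i\<in>I. ?f i \<omega>) \<omega> = (\<Sum>i\<in>I. real_cond_exp M G (?f i) \<omega>)"
    by (rule real_cond_exp_sum)
  moreover have "(\<lambda>\<omega>. \<Sum>i\<in>I. ?f i \<omega>) = (\<lambda>\<omega>. \<Sum>i\<in>I. f i \<omega>)" by auto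
  moreover have "(\<Sum>i\<in>I. real_cond_exp M G (?f i) \<omega>) = (\<Sum>i\<in>I. real_cond_exp M G (f i) \<omega>)" for \<omega>
    by (intro sum.cong refl) simp
  ultimately show ?thesis by simp
qed

lemma real_cond_exp_abs_bound:
  assumes sub: "subalgebra M G" and f: "f \<in> borel_measurable M" "AE \<omega> in M. \<bar>f \<omega>\<bar> \<le> b"
  shows "AE \<omega> in M. \<bar>real_cond_exp M G f \<omega>\<bar> \<le> b"
proof -
  interpret finite_measure_subalgebra M G by (rule finite_measure_subalgebraI[OF sub])
  have int: "integrable M f"
    using f by (intro integrable_const_bound[of _ b]) auto
  have 1: "AE \<omega> in M. real_cond_exp M G f \<omega> \<le> b"
    by (rule real_cond_exp_le_c[OF int]) (use f in auto)
  have 2: "AE \<omega> in M. real_cond_exp M G f \<omega> \<ge> - b"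
    by (rule real_cond_exp_ge_c[OF int]) (use f(2) in eventually_elim, auto)
  from 1 2 show ?thesis by eventually_elim auto
qed

text \<open>
  Conditional independence is assumed for events only. By duality, replacing \<open>f\<close> by its conditional
  expectation may be tested on the events of the \<open>\<sigma>\<close>-algebra of \<open>Y\<close>; it is enough to take
  \<open>g \<inter> Y -` C\<close>, and the indicator of \<open>Y -` C\<close> can in turn be replaced by its conditional
  expectation given \<open>G\<close> when it is integrated against anything measurable in terms of \<open>X\<close> and \<open>G\<close>.
\<close>
lemma real_cond_exp_cond_indep:
  fixes f :: "'a \<Rightarrow> real"
  assumes sub: "subalgebra M G" and X: "X \<in> M \<rightarrow>\<^sub>M MX" and Y: "Y \<in> M \<rightarrow>\<^sub>M MY"
    and indep: "cond_indep_var M G MX X MY Y"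
    and f: "f \<in> borel_measurable (adjoin G MX X)" "integrable M f"
  shows "AE \<omega> in M. real_cond_exp M (adjoin G MY Y) f \<omega> = real_cond_exp M G f \<omega>"
proof -
  let ?K = "adjoin G MX X" and ?H = "adjoin G MY Y"
  have subK: "subalgebra M ?K" and subH: "subalgebra M ?H"
    using subalgebra_adjoin_least sub X Y by blast+
  interpret G: finite_measure_subalgebra M G by (rule finite_measure_subalgebraI[OF sub])
  interpret K: finite_measure_subalgebra M ?K by (rule finite_measure_subalgebraI[OF subK])
  interpret H: finite_measure_subalgebra M ?H by (rule finite_measure_subalgebraI[OF subH])
  have sp: "space G = space M" using sub by (simp add: subalgebra_def)
  have GM: "g \<in> sets M" if "g \<in> sets G" for g using sub that by (auto simp: subalgebra_def)
  have ind_int: "integrable M (indicator S :: 'a \<Rightarrow> real)" if "S \<in> sets M" for S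
    using that by (simp add: emeasure_eq_measure)
  \<comment> \<open>Once \<open>G\<close> is known, \<open>X\<close> does not help to predict the events of \<open>Y\<close>.\<close>
  have toK: "AE \<omega> in M. real_cond_exp M ?K (indicator (Y -` C \<inter> space M)) \<omega> =
      real_cond_exp M G (indicator (Y -` C \<inter> space M)) \<omega>" if C: "C \<in> sets MY" for C
  proof -
    let ?IC = "indicator (Y -` C \<inter> space M) :: 'a \<Rightarrow> real"
    have YC: "Y -` C \<inter> space M \<in> sets M" using Y C by (rule measurable_sets)
    show ?thesis
    proof (rule K.real_cond_exp_charact)
      fix D assume D: "D \<in> sets ?K"
      show "(LINT \<omega>:D|M. ?IC \<omega>) = (LINT \<omega>:D|M. real_cond_exp M G ?IC \<omega>)"
      proof (rule set_integral_eq_adjoin[OF sub X _ _ _ D])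
        fix g B assume g: "g \<in> sets G" and B: "B \<in> sets MX"
        let ?IB = "indicator (X -` B \<inter> space M) :: 'a \<Rightarrow> real"
        have XB: "X -` B \<inter> space M \<in> sets M" using X B by (rule measurable_sets)
        let ?IBC = "indicator (X -` B \<inter> Y -` C \<inter> space M) :: 'a \<Rightarrow> real"
        have XBYC: "X -` B \<inter> Y -` C \<inter> space M \<in> sets M"
        proof -
          have "X -` B \<inter> Y -` C \<inter> space M = (X -` B \<inter> space M) \<inter> (Y -` C \<inter> space M)" by auto
          with XB YC show ?thesis by auto
        qed
        have gs: "g \<subseteq> space M" using sets.sets_into_space[OF GM[OF g]] .
        have mg[measurable]: "indicator g \<in> borel_measurable G" using g by simp
        have mg'[measurable]: "indicator g \<in> borel_measurable M" using GM[OF g] by simp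
        have [measurable]: "?IC \<in> borel_measurable M" "?IB \<in> borel_measurable M" "?IBC \<in> borel_measurable M"
          using XB YC XBYC by auto
        let ?EC = "real_cond_exp M G ?IC" and ?EB = "real_cond_exp M G ?IB"
        have E1: "AE \<omega> in M. \<bar>?EC \<omega>\<bar> \<le> 1"
          by (rule real_cond_exp_abs_bound[OF sub]) auto
        have "(LINT \<omega>:g \<inter> X -` B|M. ?IC \<omega>) = (LINT \<omega>|M. indicator g \<omega> * ?IBC \<omega>)"
          unfolding set_lebesgue_integral_def using gs
          by (intro Bochner_Integration.integral_cong) (auto simp: indicator_def)
        also have "\<dots> = (LINT \<omega>|M. indicator g \<omega> * real_cond_exp M G ?IBC \<omega>)"
        proof (rule G.real_cond_exp_intg(2)[symmetric])
          show "integrable M (\<lambda>\<omega>. indicator g \<omega> * ?IBC \<omega>)"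
          proof (rule integrable_const_bound[of _ 1])
            show "AE \<omega> in M. norm (indicator g \<omega> * ?IBC \<omega>) \<le> 1"
              by (simp add: indicator_def)
          qed measurable
        qed measurable
        also have "\<dots> = (LINT \<omega>|M. (indicator g \<omega> * ?EC \<omega>) * ?EB \<omega>)"
        proof (rule integral_cong_AE)
          show "AE \<omega> in M. indicator g \<omega> * real_cond_exp M G ?IBC \<omega> = (indicator g \<omega> * ?EC \<omega>) * ?EB \<omega>"
            using indep B C unfolding cond_indep_var_def
            by (auto elim!: allE ballE)
        qed measurable
        also have "\<dots> = (LINT \<omega>|M. (indicator g \<omega> * ?EC \<omega>) * ?IB \<omega>)"
        proof (rule G.real_cond_exp_intg(2))
          show "integrable M (\<lambda>\<omega>. (indicator g \<omega> * ?EC \<omega>) * ?IB \<omega>)"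
          proof (rule integrable_const_bound[of _ 1])
            show "AE \<omega> in M. norm ((indicator g \<omega> * ?EC \<omega>) * ?IB \<omega>) \<le> 1"
              using E1 by eventually_elim (simp add: indicator_def)
          qed measurable
        qed measurable
        also have "\<dots> = (LINT \<omega>:g \<inter> X -` B|M. ?EC \<omega>)"
          unfolding set_lebesgue_integral_def using gs
          by (intro Bochner_Integration.integral_cong) (auto simp: indicator_def)
        finally show "(LINT \<omega>:g \<inter> X -` B|M. ?IC \<omega>) = (LINT \<omega>:g \<inter> X -` B|M. ?EC \<omega>)" .
      qed (use ind_int[OF YC] in auto)
    qed (use ind_int[OF YC] in \<open>auto intro: measurable_subalgebra[OF _ subalgebra_adjoin]\<close>)
  qed
  show ?thesis
  proof (rule H.real_cond_exp_charact)
    fix D assume D: "D \<in> sets ?H"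
    show "(LINT \<omega>:D|M. f \<omega>) = (LINT \<omega>:D|M. real_cond_exp M G f \<omega>)"
    proof (rule set_integral_eq_adjoin[OF sub Y _ _ _ D])
      fix g C assume g: "g \<in> sets G" and C: "C \<in> sets MY"
      let ?IC = "indicator (Y -` C \<inter> space M) :: 'a \<Rightarrow> real"
      let ?EC = "real_cond_exp M G ?IC"
      have YC: "Y -` C \<inter> space M \<in> sets M" using Y C by (rule measurable_sets)
      have gs: "g \<subseteq> space M" using sets.sets_into_space[OF GM[OF g]] .
      have gK: "g \<in> sets ?K" using g subalgebra_adjoin[of G MX X] by (auto simp: subalgebra_def)
      have mg[measurable]: "indicator g \<in> borel_measurable G" "indicator g \<in> borel_measurable ?K"
        using g gK by auto
      have mg'[measurable]: "indicator g \<in> borel_measurable M" using GM[OF g] by simp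
      have [measurable]: "?IC \<in> borel_measurable M" using YC by auto
      have [measurable]: "f \<in> borel_measurable ?K" "f \<in> borel_measurable M" using f by auto
      have E1: "AE \<omega> in M. \<bar>?EC \<omega>\<bar> \<le> 1"
        by (rule real_cond_exp_abs_bound[OF sub]) auto
      have "(LINT \<omega>:g \<inter> Y -` C|M. f \<omega>) = (LINT \<omega>|M. (indicator g \<omega> * f \<omega>) * ?IC \<omega>)"
        unfolding set_lebesgue_integral_def using gs
        by (intro Bochner_Integration.integral_cong) (auto simp: indicator_def)
      also have "\<dots> = (LINT \<omega>|M. (indicator g \<omega> * f \<omega>) * real_cond_exp M ?K ?IC \<omega>)"
      proof (rule K.real_cond_exp_intg(2)[symmetric])
        show "integrable M (\<lambda>\<omega>. (indicator g \<omega> * f \<omega>) * ?IC \<omega>)"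
        proof (rule Bochner_Integration.integrable_bound[OF f(2)])
          show "AE \<omega> in M. norm ((indicator g \<omega> * f \<omega>) * ?IC \<omega>) \<le> norm (f \<omega>)"
            by (simp add: indicator_def)
        qed measurable
      qed measurable
      also have "\<dots> = (LINT \<omega>|M. (indicator g \<omega> * ?EC \<omega>) * f \<omega>)"
        using toK[OF C] by (intro integral_cong_AE) (measurable, auto)
      also have "\<dots> = (LINT \<omega>|M. (indicator g \<omega> * ?EC \<omega>) * real_cond_exp M G f \<omega>)"
      proof (rule G.real_cond_exp_intg(2)[symmetric])
        show "integrable M (\<lambda>\<omega>. (indicator g \<omega> * ?EC \<omega>) * f \<omega>)"
        proof (rule Bochner_Integration.integrable_bound[OF f(2)])
          show "AE \<omega> in M. norm ((indicator g \<omega> * ?EC \<omega>) * f \<omega>) \<le> norm (f \<omega>)"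
            using E1 by eventually_elim (simp add: indicator_def abs_mult mult_left_le_one_le)
        qed measurable
      qed measurable
      also have "\<dots> = (LINT \<omega>|M. (indicator g \<omega> * real_cond_exp M G f \<omega>) * ?EC \<omega>)"
        by (simp add: ac_simps)
      also have "\<dots> = (LINT \<omega>|M. (indicator g \<omega> * real_cond_exp M G f \<omega>) * ?IC \<omega>)"
      proof (rule G.real_cond_exp_intg(2))
        show "integrable M (\<lambda>\<omega>. (indicator g \<omega> * real_cond_exp M G f \<omega>) * ?IC \<omega>)"
        proof (rule Bochner_Integration.integrable_bound[OF G.real_cond_exp_int(1)[OF f(2)]])
          show "AE \<omega> in M. norm ((indicator g \<omega> * real_cond_exp M G f \<omega>) * ?IC \<omega>)
              \<le> norm (real_cond_exp M G f \<omega>)"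
            by (simp add: indicator_def)
        qed measurable
      qed measurable
      also have "\<dots> = (LINT \<omega>:g \<inter> Y -` C|M. real_cond_exp M G f \<omega>)"
        unfolding set_lebesgue_integral_def using gs
        by (intro Bochner_Integration.integral_cong) (auto simp: indicator_def)
      finally show "(LINT \<omega>:g \<inter> Y -` C|M. f \<omega>) = (LINT \<omega>:g \<inter> Y -` C|M. real_cond_exp M G f \<omega>)" .
    qed (use f in auto)
  qed (use f in \<open>auto intro: measurable_subalgebra[OF _ subalgebra_adjoin]\<close>)
qed

end

section \<open>Conditional exponential moments under a dependency graph\<close>

context prob_space
begin

lemma real_cond_exp_variance_le:
  fixes f :: "'a \<Rightarrow> real"
  assumes sub: "subalgebra M G" and f: "f \<in> borel_measurable M" "AE \<omega> in M. \<bar>f \<omega>\<bar> \<le> B"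
  shows "AE \<omega> in M. real_cond_exp M G (\<lambda>\<omega>. (f \<omega> - real_cond_exp M G f \<omega>)\<^sup>2) \<omega>
    \<le> real_cond_exp M G (\<lambda>\<omega>. (f \<omega>)\<^sup>2) \<omega>"
proof -
  interpret G: finite_measure_subalgebra M G by (rule finite_measure_subalgebraI[OF sub])
  note f(1)[measurable]
  let ?e = "real_cond_exp M G f"
  have e: "AE \<omega> in M. \<bar>?e \<omega>\<bar> \<le> B" by (rule real_cond_exp_abs_bound[OF sub f])
  have i1: "integrable M (\<lambda>\<omega>. (f \<omega>)\<^sup>2)"
  proof (rule integrable_const_bound[of _ "B\<^sup>2"])
    show "AE \<omega> in M. norm ((f \<omega>)\<^sup>2) \<le> B\<^sup>2"
      using f(2) by eventually_elim (auto simp: abs_le_square_iff[symmetric])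
  qed measurable
  have i2: "integrable M (\<lambda>\<omega>. ?e \<omega> * f \<omega>)"
  proof (rule integrable_const_bound[of _ "B * B"])
    show "AE \<omega> in M. norm (?e \<omega> * f \<omega>) \<le> B * B"
      using f(2) e by eventually_elim (auto simp: abs_mult intro!: mult_mono)
  qed measurable
  have i3: "integrable M (\<lambda>\<omega>. (?e \<omega>)\<^sup>2)"
  proof (rule integrable_const_bound[of _ "B\<^sup>2"])
    show "AE \<omega> in M. norm ((?e \<omega>)\<^sup>2) \<le> B\<^sup>2"
      using e by eventually_elim (auto simp: abs_le_square_iff[symmetric])
  qed measurable
  have [measurable]: "(\<lambda>\<omega>. (?e \<omega>)\<^sup>2) \<in> borel_measurable G" by measurable
  have "(\<lambda>\<omega>. (f \<omega> - ?e \<omega>)\<^sup>2) = (\<lambda>\<omega>. ((f \<omega>)\<^sup>2 - 2 * (?e \<omega> * f \<omega>)) + (?e \<omega>)\<^sup>2)"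
    by (auto simp: power2_eq_square algebra_simps)
  moreover have "AE \<omega> in M. real_cond_exp M G (\<lambda>\<omega>. ((f \<omega>)\<^sup>2 - 2 * (?e \<omega> * f \<omega>)) + (?e \<omega>)\<^sup>2) \<omega> =
      real_cond_exp M G (\<lambda>\<omega>. (f \<omega>)\<^sup>2 - 2 * (?e \<omega> * f \<omega>)) \<omega> + real_cond_exp M G (\<lambda>\<omega>. (?e \<omega>)\<^sup>2) \<omega>"
    by (rule G.real_cond_exp_add) (use i1 i2 i3 in auto)
  moreover have "AE \<omega> in M. real_cond_exp M G (\<lambda>\<omega>. (f \<omega>)\<^sup>2 - 2 * (?e \<omega> * f \<omega>)) \<omega> =
      real_cond_exp M G (\<lambda>\<omega>. (f \<omega>)\<^sup>2) \<omega> - real_cond_exp M G (\<lambda>\<omega>. 2 * (?e \<omega> * f \<omega>)) \<omega>"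
    by (rule G.real_cond_exp_diff) (use i1 i2 in auto)
  moreover have "AE \<omega> in M. real_cond_exp M G (\<lambda>\<omega>. 2 * (?e \<omega> * f \<omega>)) \<omega> =
      2 * real_cond_exp M G (\<lambda>\<omega>. ?e \<omega> * f \<omega>) \<omega>"
    by (rule G.real_cond_exp_cmult) (use i2 in auto)
  moreover have "AE \<omega> in M. real_cond_exp M G (\<lambda>\<omega>. ?e \<omega> * f \<omega>) \<omega> = ?e \<omega> * ?e \<omega>"
    by (rule G.real_cond_exp_mult) (use i2 in auto)
  moreover have "AE \<omega> in M. real_cond_exp M G (\<lambda>\<omega>. (?e \<omega>)\<^sup>2) \<omega> = (?e \<omega>)\<^sup>2"
    by (rule G.real_cond_exp_F_meas) (use i3 in auto)
  ultimately show ?thesis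
    by (auto simp: power2_eq_square)
qed

text \<open>
  Bernstein's inequality in conditional form: the quadratic bound on the exponential only sees the
  first two conditional moments.
\<close>
lemma cond_bernstein:
  fixes X s :: "'a \<Rightarrow> real"
  assumes sub: "subalgebra M G" and X: "X \<in> borel_measurable M" "AE \<omega> in M. \<bar>X \<omega>\<bar> \<le> b"
    and mean: "AE \<omega> in M. real_cond_exp M G X \<omega> = 0"
    and var: "AE \<omega> in M. real_cond_exp M G (\<lambda>\<omega>. (X \<omega>)\<^sup>2) \<omega> \<le> s \<omega>"
    and s: "s \<in> borel_measurable G"
    and \<mu>: "\<bar>\<mu>\<bar> * b \<le> 3 / 2"
  shows "AE \<omega> in M. \<bar>exp (\<mu> * X \<omega> - \<mu>\<^sup>2 * s \<omega>)\<bar> \<le> exp (3 / 2)"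
    and "AE \<omega> in M. real_cond_exp M G (\<lambda>\<omega>. exp (\<mu> * X \<omega> - \<mu>\<^sup>2 * s \<omega>)) \<omega> \<le> 1"
proof -
  interpret G: finite_measure_subalgebra M G by (rule finite_measure_subalgebraI[OF sub])
  note X(1)[measurable] s[measurable]
  have [measurable]: "s \<in> borel_measurable M" using s sub by (rule measurable_subalgebra)
  have \<mu>X: "AE \<omega> in M. \<bar>\<mu> * X \<omega>\<bar> \<le> 3 / 2"
    using X(2)
  proof eventually_elim
    case (elim \<omega>)
    have "\<bar>\<mu> * X \<omega>\<bar> \<le> \<bar>\<mu>\<bar> * b"
      using elim by (simp add: abs_mult mult_left_mono)
    with \<mu> show ?case by linarith
  qed
  have "AE \<omega> in M. 0 \<le> real_cond_exp M G (\<lambda>\<omega>. (X \<omega>)\<^sup>2) \<omega>"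
    by (rule G.real_cond_exp_pos) auto
  then have s_nonneg: "AE \<omega> in M. 0 \<le> s \<omega>"
    using var by eventually_elim auto
  show bound: "AE \<omega> in M. \<bar>exp (\<mu> * X \<omega> - \<mu>\<^sup>2 * s \<omega>)\<bar> \<le> exp (3 / 2)"
    using \<mu>X s_nonneg
  proof eventually_elim
    case (elim \<omega>)
    have "0 \<le> \<mu>\<^sup>2 * s \<omega>" using elim by auto
    moreover have "\<mu> * X \<omega> \<le> 3 / 2" using elim(1) by linarith
    ultimately show ?case by simp
  qed
  have int: "integrable M (\<lambda>\<omega>. exp (\<mu> * X \<omega> - \<mu>\<^sup>2 * s \<omega>))"
    using bound by (intro integrable_const_bound[of _ "exp (3 / 2)"]) auto
  have iX: "integrable M X"
    by (rule integrable_const_bound[of _ b]) (use X in auto)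
  have iX2: "integrable M (\<lambda>\<omega>. (X \<omega>)\<^sup>2)"
  proof (rule integrable_const_bound[of _ "b\<^sup>2"])
    show "AE \<omega> in M. norm ((X \<omega>)\<^sup>2) \<le> b\<^sup>2"
      using X(2) by eventually_elim (auto simp: abs_le_square_iff[symmetric])
  qed measurable
  have iexp: "integrable M (\<lambda>\<omega>. exp (\<mu> * X \<omega>))"
  proof (rule integrable_const_bound[of _ "exp (3 / 2)"])
    show "AE \<omega> in M. norm (exp (\<mu> * X \<omega>)) \<le> exp (3 / 2)"
      using \<mu>X by eventually_elim auto
  qed measurable
  have quad: "AE \<omega> in M. real_cond_exp M G (\<lambda>\<omega>. exp (\<mu> * X \<omega>)) \<omega> \<le>
      real_cond_exp M G (\<lambda>\<omega>. (1 + \<mu> * X \<omega>) + \<mu>\<^sup>2 * (X \<omega>)\<^sup>2) \<omega>"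
  proof (rule G.real_cond_exp_mono[OF _ iexp])
    show "AE \<omega> in M. exp (\<mu> * X \<omega>) \<le> (1 + \<mu> * X \<omega>) + \<mu>\<^sup>2 * (X \<omega>)\<^sup>2"
      using \<mu>X
    proof eventually_elim
      case (elim \<omega>)
      then show ?case using exp_le_quadratic[of "\<mu> * X \<omega>"] by (simp add: power_mult_distrib)
    qed
  qed (use iX iX2 in auto)
  have lin1: "AE \<omega> in M. real_cond_exp M G (\<lambda>\<omega>. (1 + \<mu> * X \<omega>) + \<mu>\<^sup>2 * (X \<omega>)\<^sup>2) \<omega> =
      real_cond_exp M G (\<lambda>\<omega>. 1 + \<mu> * X \<omega>) \<omega> + real_cond_exp M G (\<lambda>\<omega>. \<mu>\<^sup>2 * (X \<omega>)\<^sup>2) \<omega>"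
    by (rule G.real_cond_exp_add) (use iX iX2 in auto)
  have lin2: "AE \<omega> in M. real_cond_exp M G (\<lambda>\<omega>. 1 + \<mu> * X \<omega>) \<omega> =
      real_cond_exp M G (\<lambda>\<omega>. 1) \<omega> + real_cond_exp M G (\<lambda>\<omega>. \<mu> * X \<omega>) \<omega>"
    by (rule G.real_cond_exp_add) (use iX in auto)
  have lin3: "AE \<omega> in M. real_cond_exp M G (\<lambda>\<omega>. 1) \<omega> = 1"
    by (rule G.real_cond_exp_F_meas) auto
  have lin4: "AE \<omega> in M. real_cond_exp M G (\<lambda>\<omega>. \<mu> * X \<omega>) \<omega> = \<mu> * real_cond_exp M G X \<omega>"
    by (rule G.real_cond_exp_cmult) (rule iX)
  have lin5: "AE \<omega> in M. real_cond_exp M G (\<lambda>\<omega>. \<mu>\<^sup>2 * (X \<omega>)\<^sup>2) \<omega> =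
      \<mu>\<^sup>2 * real_cond_exp M G (\<lambda>\<omega>. (X \<omega>)\<^sup>2) \<omega>"
    by (rule G.real_cond_exp_cmult) (rule iX2)
  have split: "(\<lambda>\<omega>. exp (\<mu> * X \<omega> - \<mu>\<^sup>2 * s \<omega>)) = (\<lambda>\<omega>. exp (- (\<mu>\<^sup>2 * s \<omega>)) * exp (\<mu> * X \<omega>))"
    by (auto simp flip: exp_add)
  have "AE \<omega> in M. real_cond_exp M G (\<lambda>\<omega>. exp (- (\<mu>\<^sup>2 * s \<omega>)) * exp (\<mu> * X \<omega>)) \<omega> =
      exp (- (\<mu>\<^sup>2 * s \<omega>)) * real_cond_exp M G (\<lambda>\<omega>. exp (\<mu> * X \<omega>)) \<omega>"
    by (rule G.real_cond_exp_mult) (use int in \<open>auto simp: split\<close>)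
  then show "AE \<omega> in M. real_cond_exp M G (\<lambda>\<omega>. exp (\<mu> * X \<omega> - \<mu>\<^sup>2 * s \<omega>)) \<omega> \<le> 1"
    unfolding split using quad lin1 lin2 lin3 lin4 lin5 mean var
  proof eventually_elim
    case (elim \<omega>)
    have "real_cond_exp M G (\<lambda>\<omega>. exp (\<mu> * X \<omega>)) \<omega> \<le> 1 + \<mu>\<^sup>2 * real_cond_exp M G (\<lambda>\<omega>. (X \<omega>)\<^sup>2) \<omega>"
      using elim by simp
    also have "\<dots> \<le> 1 + \<mu>\<^sup>2 * s \<omega>" using elim by (simp add: mult_left_mono)
    also have "\<dots> \<le> exp (\<mu>\<^sup>2 * s \<omega>)" by (rule exp_ge_add_one_self)
    finally have "exp (- (\<mu>\<^sup>2 * s \<omega>)) * real_cond_exp M G (\<lambda>\<omega>. exp (\<mu> * X \<omega>)) \<omega>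
        \<le> exp (- (\<mu>\<^sup>2 * s \<omega>)) * exp (\<mu>\<^sup>2 * s \<omega>)"
      by (rule mult_left_mono) simp
    then show ?case using elim(1) by (simp flip: exp_add)
  qed
qed

lemma subalgebra_adjoin_component:
  assumes X: "\<And>i. i \<in> I \<Longrightarrow> X i \<in> M \<rightarrow>\<^sub>M N" and i: "i \<in> I" and sub: "subalgebra M G"
  shows "subalgebra (adjoin G (\<Pi>\<^sub>M i\<in>I. N) (\<lambda>\<omega>. \<lambda>i\<in>I. X i \<omega>)) (adjoin G N (X i))"
proof (rule subalgebra_adjoin_least)
  let ?H = "adjoin G (\<Pi>\<^sub>M i\<in>I. N) (\<lambda>\<omega>. \<lambda>i\<in>I. X i \<omega>)"
  show "subalgebra ?H G" by (rule subalgebra_adjoin)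
  have sp: "space G = space M" using sub by (simp add: subalgebra_def)
  have "(\<lambda>\<omega>. \<lambda>i\<in>I. X i \<omega>) \<in> ?H \<rightarrow>\<^sub>M (\<Pi>\<^sub>M i\<in>I. N)"
    using X by (intro measurable_adjoin) (auto simp: sp space_PiM PiE_def dest: measurable_space)
  then have "(\<lambda>\<omega>. (\<lambda>i\<in>I. X i \<omega>) i) \<in> ?H \<rightarrow>\<^sub>M N"
    using i by (rule measurable_compose[OF _ measurable_component_singleton])
  then show "X i \<in> ?H \<rightarrow>\<^sub>M N" using i by simp
qed

text \<open>
  Peel off one factor at a time: given \<open>G\<close> and the other elements of \<open>I\<close>, the conditional mean of
  the peeled factor is still at most one.
\<close>
lemma real_cond_exp_prod_le_one:
  fixes f :: "'i \<Rightarrow> 'a \<Rightarrow> real"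
  assumes sub: "subalgebra M G" and fin: "finite I"
    and X: "\<And>i. i \<in> I \<Longrightarrow> X i \<in> M \<rightarrow>\<^sub>M N"
    and f: "\<And>i. i \<in> I \<Longrightarrow> f i \<in> borel_measurable (adjoin G N (X i))"
      "\<And>i \<omega>. i \<in> I \<Longrightarrow> 0 \<le> f i \<omega>"
      "\<And>i. i \<in> I \<Longrightarrow> AE \<omega> in M. \<bar>f i \<omega>\<bar> \<le> B"
    and le: "\<And>i I'. i \<in> I \<Longrightarrow> I' \<subseteq> I - {i} \<Longrightarrow>
      AE \<omega> in M. real_cond_exp M (adjoin G (\<Pi>\<^sub>M i\<in>I'. N) (\<lambda>\<omega>. \<lambda>i\<in>I'. X i \<omega>)) (f i) \<omega> \<le> 1"
  shows "integrable M (\<lambda>\<omega>. \<Prod>i\<in>I. f i \<omega>)"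
    and "AE \<omega> in M. real_cond_exp M G (\<lambda>\<omega>. \<Prod>i\<in>I. f i \<omega>) \<omega> \<le> 1"
proof -
  interpret G: finite_measure_subalgebra M G by (rule finite_measure_subalgebraI[OF sub])
  let ?H = "\<lambda>I'. adjoin G (\<Pi>\<^sub>M i\<in>I'. N) (\<lambda>\<omega>. \<lambda>i\<in>I'. X i \<omega>)"
  have subH: "subalgebra M (?H I')" if "I' \<subseteq> I" for I'
    using that X by (intro subalgebra_adjoin_least sub measurable_restrict) auto
  have f_meas: "f i \<in> borel_measurable (?H I')" if "i \<in> I'" "I' \<subseteq> I" for i I'
    using that X by (intro measurable_subalgebra[OF f(1) subalgebra_adjoin_component] sub) auto
  have f_meas_M: "f i \<in> borel_measurable M" if "i \<in> I" for i
    using f_meas[OF that] subH[of I] by (auto intro: measurable_subalgebra)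
  have f_int: "integrable M (f i)" if "i \<in> I" for i
    using f(3)[OF that] f_meas_M[OF that] by (intro integrable_const_bound[of _ B]) auto
  have "(AE \<omega> in M. \<bar>\<Prod>i\<in>I'. f i \<omega>\<bar> \<le> B ^ card I') \<and>
      (AE \<omega> in M. real_cond_exp M G (\<lambda>\<omega>. \<Prod>i\<in>I'. f i \<omega>) \<omega> \<le> 1)" if "I' \<subseteq> I" for I'
    using finite_subset[OF that fin] that
  proof (induction I' rule: finite_induct)
    case empty
    have "AE \<omega> in M. real_cond_exp M G (\<lambda>\<omega>. 1) \<omega> = 1"
      by (rule G.real_cond_exp_F_meas) auto
    then have "AE \<omega> in M. real_cond_exp M G (\<lambda>\<omega>. 1) \<omega> \<le> 1" by eventually_elim simp
    then show ?case by simp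
  next
    case (insert i I')
    then have i: "i \<in> I" and I': "I' \<subseteq> I - {i}" by auto
    interpret H: finite_measure_subalgebra M "?H I'"
      by (rule finite_measure_subalgebraI, rule subH) (use I' in auto)
    let ?W = "\<lambda>\<omega>. \<Prod>i\<in>I'. f i \<omega>"
    have W_H: "?W \<in> borel_measurable (?H I')"
      using I' by (intro borel_measurable_prod f_meas) auto
    have W_M[measurable]: "?W \<in> borel_measurable M"
      using I' by (intro borel_measurable_prod f_meas_M) auto
    have [measurable]: "f i \<in> borel_measurable M" by (rule f_meas_M[OF i])
    have W_bd: "AE \<omega> in M. \<bar>?W \<omega>\<bar> \<le> B ^ card I'" using insert by auto
    have W_nonneg: "0 \<le> ?W \<omega>" for \<omega> using I' f(2) by (intro prod_nonneg) auto
    have W_int: "integrable M ?W"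
      using W_bd by (intro integrable_const_bound[of _ "B ^ card I'"]) auto
    have Wf_bd: "AE \<omega> in M. \<bar>?W \<omega> * f i \<omega>\<bar> \<le> B ^ Suc (card I')"
      using W_bd f(3)[OF i]
    proof eventually_elim
      case (elim \<omega>)
      have "0 \<le> B ^ card I'" using elim(1) abs_ge_zero[of "?W \<omega>"] by linarith
      with elim have "\<bar>?W \<omega>\<bar> * \<bar>f i \<omega>\<bar> \<le> B ^ card I' * B" by (intro mult_mono) auto
      then show ?case by (simp add: abs_mult mult.commute)
    qed
    have Wf_int: "integrable M (\<lambda>\<omega>. ?W \<omega> * f i \<omega>)"
      by (rule integrable_const_bound[of _ "B ^ Suc (card I')"]) (use Wf_bd in auto)
    have "AE \<omega> in M. real_cond_exp M (?H I') (\<lambda>\<omega>. ?W \<omega> * f i \<omega>) \<omega> = ?W \<omega> * real_cond_exp M (?H I') (f i) \<omega>"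
      by (rule H.real_cond_exp_mult[OF W_H _ Wf_int]) auto
    then have "AE \<omega> in M. real_cond_exp M (?H I') (\<lambda>\<omega>. ?W \<omega> * f i \<omega>) \<omega> \<le> ?W \<omega>"
      using le[OF i I']
    proof eventually_elim
      case (elim \<omega>)
      then show ?case using mult_left_mono[OF elim(2) W_nonneg[of \<omega>]] by simp
    qed
    then have "AE \<omega> in M. real_cond_exp M G (real_cond_exp M (?H I') (\<lambda>\<omega>. ?W \<omega> * f i \<omega>)) \<omega>
        \<le> real_cond_exp M G ?W \<omega>"
      by (rule G.real_cond_exp_mono) (use Wf_int W_int H.real_cond_exp_int in auto)
    moreover have "AE \<omega> in M. real_cond_exp M G (real_cond_exp M (?H I') (\<lambda>\<omega>. ?W \<omega> * f i \<omega>)) \<omega>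
        = real_cond_exp M G (\<lambda>\<omega>. ?W \<omega> * f i \<omega>) \<omega>"
      by (rule G.real_cond_exp_nested_subalg[OF H.subalg subalgebra_adjoin Wf_int])
    moreover have "AE \<omega> in M. real_cond_exp M G ?W \<omega> \<le> 1"
      using insert by auto
    ultimately have "AE \<omega> in M. real_cond_exp M G (\<lambda>\<omega>. ?W \<omega> * f i \<omega>) \<omega> \<le> 1"
      by eventually_elim linarith
    then show ?case using Wf_bd insert by (simp add: mult.commute)
  qed
  from this[of I] have bd: "AE \<omega> in M. \<bar>\<Prod>i\<in>I. f i \<omega>\<bar> \<le> B ^ card I"
    and le1: "AE \<omega> in M. real_cond_exp M G (\<lambda>\<omega>. \<Prod>i\<in>I. f i \<omega>) \<omega> \<le> 1" by auto
  show "integrable M (\<lambda>\<omega>. \<Prod>i\<in>I. f i \<omega>)"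
    using bd f_meas_M by (intro integrable_const_bound[of _ "B ^ card I"]) (auto intro: borel_measurable_prod)
  show "AE \<omega> in M. real_cond_exp M G (\<lambda>\<omega>. \<Prod>i\<in>I. f i \<omega>) \<omega> \<le> 1" by (rule le1)
qed

text \<open>
  The centred variables \<open>Y i\<close> are measurable in terms of \<open>G\<close> and \<open>X i\<close>, so their first two
  conditional moments do not change when the other \<open>X k\<close> are revealed; \<open>cond_bernstein\<close> then
  applies to each factor of the exponential with the enlarged \<open>\<sigma>\<close>-algebra.
\<close>
lemma cond_bernstein_independent:
  fixes f :: "'i \<Rightarrow> 'a \<Rightarrow> real"
  assumes sub: "subalgebra M G" and fin: "finite I"
    and X: "\<And>i. i \<in> I \<Longrightarrow> X i \<in> M \<rightarrow>\<^sub>M N"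
    and indep: "\<And>i I'. i \<in> I \<Longrightarrow> I' \<subseteq> I - {i} \<Longrightarrow>
      cond_indep_var M G N (X i) (\<Pi>\<^sub>M i\<in>I'. N) (\<lambda>\<omega>. \<lambda>i\<in>I'. X i \<omega>)"
    and f: "\<And>i. i \<in> I \<Longrightarrow> f i \<in> borel_measurable (adjoin G N (X i))"
      "\<And>i. i \<in> I \<Longrightarrow> AE \<omega> in M. \<bar>f i \<omega>\<bar> \<le> B"
    and dev: "\<And>i. i \<in> I \<Longrightarrow> AE \<omega> in M. \<bar>f i \<omega> - real_cond_exp M G (f i) \<omega>\<bar> \<le> b"
    and \<mu>: "\<bar>\<mu>\<bar> * b \<le> 3 / 2"
  defines "u \<equiv> \<lambda>\<omega>. \<Sum>i\<in>I. \<mu> * (f i \<omega> - real_cond_exp M G (f i) \<omega>) -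
      \<mu>\<^sup>2 * real_cond_exp M G (\<lambda>\<omega>. (f i \<omega>)\<^sup>2) \<omega>"
  shows "integrable M (\<lambda>\<omega>. exp (u \<omega>))"
    and "AE \<omega> in M. real_cond_exp M G (\<lambda>\<omega>. exp (u \<omega>)) \<omega> \<le> 1"
proof -
  interpret G: finite_measure_subalgebra M G by (rule finite_measure_subalgebraI[OF sub])
  define Y where "Y i \<omega> = f i \<omega> - real_cond_exp M G (f i) \<omega>" for i \<omega>
  define s where "s i = real_cond_exp M G (\<lambda>\<omega>. (f i \<omega>)\<^sup>2)" for i
  let ?H = "\<lambda>I'. adjoin G (\<Pi>\<^sub>M i\<in>I'. N) (\<lambda>\<omega>. \<lambda>i\<in>I'. X i \<omega>)"
  have subX: "subalgebra M (adjoin G N (X i))" if "i \<in> I" for i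
    using that X by (intro subalgebra_adjoin_least sub) auto
  have f_M: "f i \<in> borel_measurable M" if "i \<in> I" for i
    using f(1)[OF that] subX[OF that] by (rule measurable_subalgebra)
  have f_int: "integrable M (f i)" if "i \<in> I" for i
    by (rule integrable_const_bound[of _ B]) (use f f_M that in auto)
  have from_G: "g \<in> borel_measurable (adjoin G N (X i))" if "g \<in> borel_measurable G" for i and g :: "'a \<Rightarrow> real"
    using that subalgebra_adjoin by (rule measurable_subalgebra)
  have Y_X: "Y i \<in> borel_measurable (adjoin G N (X i))" if "i \<in> I" for i
    unfolding Y_def by (intro borel_measurable_diff f(1) that from_G) auto
  have Y_M[measurable]: "Y i \<in> borel_measurable M" if "i \<in> I" for i
    using Y_X[OF that] subX[OF that] by (rule measurable_subalgebra)
  have s_G[measurable]: "s i \<in> borel_measurable G" for i unfolding s_def by simp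
  have Y_bd: "AE \<omega> in M. \<bar>Y i \<omega>\<bar> \<le> b" if "i \<in> I" for i
    using dev[OF that] by (simp add: Y_def)
  have Y_int: "integrable M (Y i)" if "i \<in> I" for i
    by (rule integrable_const_bound[of _ b]) (use Y_bd Y_M that in auto)
  have Y2_int: "integrable M (\<lambda>\<omega>. (Y i \<omega>)\<^sup>2)" if "i \<in> I" for i
  proof (rule integrable_const_bound[of _ "b\<^sup>2"])
    show "AE \<omega> in M. norm ((Y i \<omega>)\<^sup>2) \<le> b\<^sup>2"
      using Y_bd[OF that] by eventually_elim (auto simp: abs_le_square_iff[symmetric])
  qed (use Y_M[OF that] in measurable)
  have Y_mean: "AE \<omega> in M. real_cond_exp M G (Y i) \<omega> = 0" if "i \<in> I" for i
  proof -
    have "AE \<omega> in M. real_cond_exp M G (Y i) \<omega> =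
        real_cond_exp M G (f i) \<omega> - real_cond_exp M G (real_cond_exp M G (f i)) \<omega>"
      unfolding Y_def by (rule G.real_cond_exp_diff) (use f_int[OF that] in auto)
    moreover have "AE \<omega> in M. real_cond_exp M G (real_cond_exp M G (f i)) \<omega> = real_cond_exp M G (f i) \<omega>"
      by (rule G.real_cond_exp_F_meas) (use f_int[OF that] in auto)
    ultimately show ?thesis by auto
  qed
  have Y_var: "AE \<omega> in M. real_cond_exp M G (\<lambda>\<omega>. (Y i \<omega>)\<^sup>2) \<omega> \<le> s i \<omega>" if "i \<in> I" for i
    unfolding Y_def s_def by (rule real_cond_exp_variance_le[OF sub f_M f(2)]) (rule that)+
  define g where "g i \<omega> = exp (\<mu> * Y i \<omega> - \<mu>\<^sup>2 * s i \<omega>)" for i \<omega>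
  have u_eq: "exp (u \<omega>) = (\<Prod>i\<in>I. g i \<omega>)" for \<omega>
    unfolding u_def g_def Y_def s_def by (rule exp_sum[OF fin])
  have H_moment: "AE \<omega> in M. real_cond_exp M (?H I') (g i) \<omega> \<le> 1" if i: "i \<in> I" and I': "I' \<subseteq> I - {i}" for i I'
  proof -
    have Xr: "(\<lambda>\<omega>. \<lambda>i\<in>I'. X i \<omega>) \<in> M \<rightarrow>\<^sub>M (\<Pi>\<^sub>M i\<in>I'. N)"
      using X I' by (intro measurable_restrict) auto
    have subH: "subalgebra M (?H I')" by (rule subalgebra_adjoin_least[OF sub Xr])
    have "AE \<omega> in M. real_cond_exp M (?H I') (Y i) \<omega> = real_cond_exp M G (Y i) \<omega>"
      using i by (intro real_cond_exp_cond_indep[OF sub X Xr indep[OF i I']] Y_X Y_int) auto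
    then have m: "AE \<omega> in M. real_cond_exp M (?H I') (Y i) \<omega> = 0"
      using Y_mean[OF i] by auto
    have "AE \<omega> in M. real_cond_exp M (?H I') (\<lambda>\<omega>. (Y i \<omega>)\<^sup>2) \<omega> = real_cond_exp M G (\<lambda>\<omega>. (Y i \<omega>)\<^sup>2) \<omega>"
      using i by (intro real_cond_exp_cond_indep[OF sub X Xr indep[OF i I']] Y2_int borel_measurable_power Y_X) auto
    then have v: "AE \<omega> in M. real_cond_exp M (?H I') (\<lambda>\<omega>. (Y i \<omega>)\<^sup>2) \<omega> \<le> s i \<omega>"
      using Y_var[OF i] by auto
    show ?thesis
      unfolding g_def
      by (rule cond_bernstein(2)[OF subH Y_M[OF i] Y_bd[OF i] m v _ \<mu>])
        (rule measurable_subalgebra[OF s_G subalgebra_adjoin])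
  qed
  have g_bd: "AE \<omega> in M. \<bar>g i \<omega>\<bar> \<le> exp (3 / 2)" if i: "i \<in> I" for i
    unfolding g_def
    by (rule cond_bernstein(1)[OF sub Y_M[OF i] Y_bd[OF i] Y_mean[OF i] Y_var[OF i] s_G \<mu>])
  have g_X: "g i \<in> borel_measurable (adjoin G N (X i))" if i: "i \<in> I" for i
    using Y_X[OF i] from_G[OF s_G, of i i] unfolding g_def by measurable
  note prod = real_cond_exp_prod_le_one[OF sub fin X g_X _ g_bd H_moment]
  show "integrable M (\<lambda>\<omega>. exp (u \<omega>))"
    unfolding u_eq by (rule prod(1)) (auto simp: g_def)
  show "AE \<omega> in M. real_cond_exp M G (\<lambda>\<omega>. exp (u \<omega>)) \<omega> \<le> 1"
    unfolding u_eq by (rule prod(2)) (auto simp: g_def)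
qed

text \<open>
  A proper colouring with \<open>D\<close> colours splits the sum into \<open>D\<close> sums of conditionally independent
  terms. By convexity, the exponential of the sum is at most the average over the colours of the
  exponentials of the partial sums, each multiplied by \<open>D\<close>: the price is a factor \<open>D\<close> in front of
  the variance and a range of \<open>\<mu>\<close> that is \<open>D\<close> times smaller.
\<close>
lemma cond_bernstein_coloured:
  fixes f :: "'i \<Rightarrow> 'a \<Rightarrow> real" and col :: "'i \<Rightarrow> nat"
  assumes sub: "subalgebra M G" and fin: "finite I"
    and X: "\<And>i. i \<in> I \<Longrightarrow> X i \<in> M \<rightarrow>\<^sub>M N"
    and col: "\<And>i. i \<in> I \<Longrightarrow> col i < D" "0 < D"
    and indep: "\<And>i I'. i \<in> I \<Longrightarrow> I' \<subseteq> I - {i} \<Longrightarrow> (\<forall>k\<in>I'. col k = col i) \<Longrightarrow>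
      cond_indep_var M G N (X i) (\<Pi>\<^sub>M i\<in>I'. N) (\<lambda>\<omega>. \<lambda>i\<in>I'. X i \<omega>)"
    and f: "\<And>i. i \<in> I \<Longrightarrow> f i \<in> borel_measurable (adjoin G N (X i))"
      "\<And>i. i \<in> I \<Longrightarrow> AE \<omega> in M. \<bar>f i \<omega>\<bar> \<le> B"
    and dev: "\<And>i. i \<in> I \<Longrightarrow> AE \<omega> in M. \<bar>f i \<omega> - real_cond_exp M G (f i) \<omega>\<bar> \<le> b"
    and \<mu>: "\<bar>\<mu>\<bar> * D * b \<le> 3 / 2"
  defines "u \<equiv> \<lambda>\<omega>. \<mu> * (\<Sum>i\<in>I. f i \<omega> - real_cond_exp M G (f i) \<omega>) -
      \<mu>\<^sup>2 * D * (\<Sum>i\<in>I. real_cond_exp M G (\<lambda>\<omega>. (f i \<omega>)\<^sup>2) \<omega>)"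
  shows "integrable M (\<lambda>\<omega>. exp (u \<omega>))"
    and "AE \<omega> in M. real_cond_exp M G (\<lambda>\<omega>. exp (u \<omega>)) \<omega> \<le> 1"
proof -
  interpret G: finite_measure_subalgebra M G by (rule finite_measure_subalgebraI[OF sub])
  let ?I = "\<lambda>c. {i \<in> I. col i = c}"
  define w where "w i \<omega> = (\<mu> * D) * (f i \<omega> - real_cond_exp M G (f i) \<omega>) -
      (\<mu> * D)\<^sup>2 * real_cond_exp M G (\<lambda>\<omega>. (f i \<omega>)\<^sup>2) \<omega>" for i \<omega>
  have class1: "integrable M (\<lambda>\<omega>. exp (\<Sum>i\<in>?I c. w i \<omega>))"
    and class2: "AE \<omega> in M. real_cond_exp M G (\<lambda>\<omega>. exp (\<Sum>i\<in>?I c. w i \<omega>)) \<omega> \<le> 1" for c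
  proof -
    have \<mu>': "\<bar>\<mu> * D\<bar> * b \<le> 3 / 2" using \<mu> by (simp add: abs_mult)
    have ind: "cond_indep_var M G N (X i) (\<Pi>\<^sub>M i\<in>I'. N) (\<lambda>\<omega>. \<lambda>i\<in>I'. X i \<omega>)"
      if "i \<in> ?I c" "I' \<subseteq> ?I c - {i}" for i I'
      using that by (intro indep) auto
    show "integrable M (\<lambda>\<omega>. exp (\<Sum>i\<in>?I c. w i \<omega>))"
      unfolding w_def
      by (rule cond_bernstein_independent(1)[where X = X and N = N and B = B and b = b])
        (use sub fin X f dev \<mu>' ind in simp_all)
    show "AE \<omega> in M. real_cond_exp M G (\<lambda>\<omega>. exp (\<Sum>i\<in>?I c. w i \<omega>)) \<omega> \<le> 1"
      unfolding w_def
      by (rule cond_bernstein_independent(2)[where X = X and N = N and B = B and b = b])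
        (use sub fin X f dev \<mu>' ind in simp_all)
  qed
  let ?avg = "\<lambda>\<omega>. \<Sum>c<D. (1 / D) * exp (\<Sum>i\<in>?I c. w i \<omega>)"
  have avg_int: "integrable M ?avg"
    using class1 by (intro Bochner_Integration.integrable_sum integrable_mult_right) auto
  have le: "exp (u \<omega>) \<le> ?avg \<omega>" for \<omega>
  proof -
    have "(\<Sum>c<D. (1 / D) *\<^sub>R (\<Sum>i\<in>?I c. w i \<omega>)) = (1 / D) * (\<Sum>i\<in>I. w i \<omega>)"
    proof -
      have "(\<Sum>c<D. \<Sum>i\<in>?I c. w i \<omega>) = (\<Sum>i\<in>I. w i \<omega>)"
        by (rule sum.group) (use fin col in auto)
      then show ?thesis by (simp flip: sum_divide_distrib)
    qed
    also have "\<dots> = u \<omega>"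
      using col(2) unfolding u_def w_def
      by (simp add: sum_subtractf power2_eq_square right_diff_distrib flip: sum_distrib_left)
    \<comment> \<open>Jensen's inequality with weight \<open>1 / D\<close> on each colour.\<close>
    finally show ?thesis
      using convex_on_sum[OF _ _ exp_convex, of "{..<D}" "\<lambda>c. 1 / D" "\<lambda>c. \<Sum>i\<in>?I c. w i \<omega>"] col(2)
      by auto
  qed
  have f_M[measurable]: "f i \<in> borel_measurable M" if "i \<in> I" for i
    using f(1)[OF that] subalgebra_adjoin_least[OF sub X[OF that]] by (rule measurable_subalgebra)
  have [measurable]: "u \<in> borel_measurable M" unfolding u_def
    using f_M by (intro borel_measurable_diff borel_measurable_times borel_measurable_sum
      borel_measurable_const borel_measurable_cond_exp2) auto
  show int: "integrable M (\<lambda>\<omega>. exp (u \<omega>))"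
  proof (rule Bochner_Integration.integrable_bound[OF avg_int])
    show "AE \<omega> in M. norm (exp (u \<omega>)) \<le> norm (?avg \<omega>)"
    proof (rule AE_I2)
      fix \<omega>
      show "norm (exp (u \<omega>)) \<le> norm (?avg \<omega>)"
        using order_trans[OF le[of \<omega>] abs_ge_self] by (simp only: real_norm_def abs_exp_cancel)
    qed
  qed measurable
  have "AE \<omega> in M. real_cond_exp M G (\<lambda>\<omega>. exp (u \<omega>)) \<omega> \<le> real_cond_exp M G ?avg \<omega>"
    by (rule G.real_cond_exp_mono[OF AE_I2[OF le] int avg_int])
  moreover have "AE \<omega> in M. real_cond_exp M G ?avg \<omega> =
      (\<Sum>c<D. real_cond_exp M G (\<lambda>\<omega>. (1 / D) * exp (\<Sum>i\<in>?I c. w i \<omega>)) \<omega>)"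
    by (rule real_cond_exp_sum_finite[OF sub]) (rule integrable_mult_right[OF class1])
  moreover have "AE \<omega> in M. \<forall>c\<in>{..<D}. real_cond_exp M G (\<lambda>\<omega>. (1 / D) * exp (\<Sum>i\<in>?I c. w i \<omega>)) \<omega> \<le> 1 / D"
  proof (rule AE_finite_allI)
    fix c
    have "AE \<omega> in M. real_cond_exp M G (\<lambda>\<omega>. (1 / D) * exp (\<Sum>i\<in>?I c. w i \<omega>)) \<omega> =
        (1 / D) * real_cond_exp M G (\<lambda>\<omega>. exp (\<Sum>i\<in>?I c. w i \<omega>)) \<omega>"
      by (rule G.real_cond_exp_cmult) (rule class1)
    then show "AE \<omega> in M. real_cond_exp M G (\<lambda>\<omega>. (1 / D) * exp (\<Sum>i\<in>?I c. w i \<omega>)) \<omega> \<le> 1 / D"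
      using class2[of c] by eventually_elim (simp add: divide_right_mono)
  qed simp
  ultimately show "AE \<omega> in M. real_cond_exp M G (\<lambda>\<omega>. exp (u \<omega>)) \<omega> \<le> 1"
  proof eventually_elim
    case (elim \<omega>)
    have "(\<Sum>c<D. real_cond_exp M G (\<lambda>\<omega>. (1 / D) * exp (\<Sum>i\<in>?I c. w i \<omega>)) \<omega>) \<le> (\<Sum>c<D. 1 / D)"
      by (rule sum_mono) (use elim in auto)
    also have "\<dots> = 1" using col(2) by simp
    finally show ?case using elim by simp
  qed
qed

end

section \<open>Greedy colouring\<close>

text \<open>
  The vertices are coloured one after the other: the neighbours of a new vertex occupy fewer than
  \<open>D\<close> colours.
\<close>
lemma greedy_colouring:
  fixes R :: "('i \<times> 'i) set"
  assumes "finite S" and sym: "sym R" and irrefl: "\<And>v. (v, v) \<notin> R"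
    and degree: "\<And>v. v \<in> S \<Longrightarrow> card {w \<in> S. (v, w) \<in> R} < D"
  shows "\<exists>col. (\<forall>v\<in>S. col v < D) \<and> (\<forall>v\<in>S. \<forall>w\<in>S. (v, w) \<in> R \<longrightarrow> col v \<noteq> (col w :: nat))"
  using assms(1,4)
proof (induction S rule: finite_induct)
  case empty
  then show ?case by simp
next
  case (insert v S)
  have "card {w \<in> S. (u, w) \<in> R} < D" if "u \<in> S" for u
  proof -
    have "card {w \<in> S. (u, w) \<in> R} \<le> card {w \<in> insert v S. (u, w) \<in> R}"
      using insert.hyps by (intro card_mono) auto
    also have "\<dots> < D" using insert that by (intro insert.prems) auto
    finally show ?thesis .
  qed
  then obtain col where col: "\<forall>u\<in>S. col u < D" "\<forall>u\<in>S. \<forall>w\<in>S. (u, w) \<in> R \<longrightarrow> col u \<noteq> (col w :: nat)"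
    using insert.IH by auto
  let ?N = "{w \<in> S. (v, w) \<in> R}"
  have "card (col ` ?N) \<le> card ?N" using insert.hyps by (intro card_image_le) auto
  also have "\<dots> \<le> card {w \<in> insert v S. (v, w) \<in> R}"
    using insert.hyps by (intro card_mono) auto
  also have "\<dots> < D" using insert by (intro insert.prems) auto
  finally have "card (col ` ?N) < card {..<D}" by simp
  then have "\<not> {..<D} \<subseteq> col ` ?N"
    using card_mono[of "col ` ?N" "{..<D}"] insert.hyps by auto
  then obtain c where c: "c < D" "c \<notin> col ` ?N" by auto
  have free: "col w \<noteq> c" if "w \<in> S" "(v, w) \<in> R \<or> (w, v) \<in> R" for w
    using that c(2) symD[OF sym] by blast
  have "\<forall>u\<in>insert v S. \<forall>w\<in>insert v S. (u, w) \<in> R \<longrightarrow> (col(v := c)) u \<noteq> (col(v := c)) w"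
  proof (intro ballI impI)
    fix u w assume "u \<in> insert v S" "w \<in> insert v S" "(u, w) \<in> R"
    moreover from this have "u \<noteq> w" using irrefl by metis
    ultimately show "(col(v := c)) u \<noteq> (col(v := c)) w"
      using col(2) free[of u] free[of w] by (cases "u = v"; cases "w = v") auto
  qed
  then show ?case using col(1) c(1) by (intro exI[of _ "col(v := c)"]) auto
qed

lemma pair_graph_colouring:
  assumes G: "pair_graph G"
  shows "\<exists>col. (\<forall>v\<in>pverts G. col v < deg G) \<and> (\<forall>v w. (v, w) \<in> parcs G \<longrightarrow> col v \<noteq> (col w :: nat))"
proof -
  interpret pair_graph G by (rule G)
  have fin: "finite (pverts G)" by (rule pair_finite_verts)
  have "\<exists>col. (\<forall>v\<in>pverts G. col v < deg G) \<and>
      (\<forall>v\<in>pverts G. \<forall>w\<in>pverts G. (v, w) \<in> parcs G \<longrightarrow> col v \<noteq> (col w :: nat))"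
  proof (rule greedy_colouring[OF fin])
    show "sym (parcs G)" using arcs_symmetric by (auto intro: symI)
    show "(v, v) \<notin> parcs G" for v using pair_no_loops by force
    fix v assume v: "v \<in> pverts G"
    have "out_arcs (with_proj G) v = Pair v ` {w \<in> pverts G. (v, w) \<in> parcs G}"
      by (auto simp: out_arcs_def image_iff dest: in_arcsD2)
    then have "card {w \<in> pverts G. (v, w) \<in> parcs G} = out_degree (with_proj G) v"
      unfolding out_degree_def by (simp add: card_image inj_on_def)
    also have "\<dots> \<le> Max (out_degree (with_proj G) ` pverts G)"
      using v fin by (intro Max_ge) auto
    finally show "card {w \<in> pverts G. (v, w) \<in> parcs G} < deg G" by (simp add: deg_def)
  qed
  then show ?thesis using in_arcsD1 in_arcsD2 by metis
qed

section \<open>Uniform deviations of an adaptive empirical risk\<close>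

context prob_space
begin

text \<open>
  Conditioning on \<open>G t\<close> removes the last factor, as the earlier ones are then known.
\<close>
lemma supermartingale_expectation_le_one:
  fixes Y :: "nat \<Rightarrow> 'a \<Rightarrow> real"
  assumes sub: "\<And>\<tau>. 1 \<le> \<tau> \<Longrightarrow> subalgebra M (G \<tau>)"
    and Y: "\<And>\<tau>. 1 \<le> \<tau> \<Longrightarrow> Y \<tau> \<in> borel_measurable M" "\<And>\<tau> \<omega>. 0 \<le> Y \<tau> \<omega>"
      "\<And>\<tau>. 1 \<le> \<tau> \<Longrightarrow> AE \<omega> in M. Y \<tau> \<omega> \<le> B"
    and past: "\<And>\<sigma> \<tau>. 1 \<le> \<sigma> \<Longrightarrow> \<sigma> < \<tau> \<Longrightarrow> Y \<sigma> \<in> borel_measurable (G \<tau>)"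
    and le: "\<And>\<tau>. 1 \<le> \<tau> \<Longrightarrow> AE \<omega> in M. real_cond_exp M (G \<tau>) (Y \<tau>) \<omega> \<le> 1"
  shows "integrable M (\<lambda>\<omega>. \<Prod>\<tau>=1..t. Y \<tau> \<omega>)" "(LINT \<omega>|M. (\<Prod>\<tau>=1..t. Y \<tau> \<omega>)) \<le> 1"
proof -
  have "(AE \<omega> in M. (\<Prod>\<tau>=1..t. Y \<tau> \<omega>) \<le> B ^ t) \<and>
      integrable M (\<lambda>\<omega>. \<Prod>\<tau>=1..t. Y \<tau> \<omega>) \<and> (LINT \<omega>|M. (\<Prod>\<tau>=1..t. Y \<tau> \<omega>)) \<le> 1"
  proof (induction t)
    case 0
    then show ?case by (simp add: prob_space)
  next
    case (Suc t)
    interpret G: finite_measure_subalgebra M "G (Suc t)"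
      by (rule finite_measure_subalgebraI) (rule sub, simp)
    let ?W = "\<lambda>\<omega>. \<Prod>\<tau>=1..t. Y \<tau> \<omega>"
    have W_G: "?W \<in> borel_measurable (G (Suc t))"
      by (intro borel_measurable_prod past) auto
    have W_nonneg: "0 \<le> ?W \<omega>" for \<omega> by (intro prod_nonneg Y) 
    have Y_M[measurable]: "Y (Suc t) \<in> borel_measurable M" by (rule Y) simp
    have W_M[measurable]: "?W \<in> borel_measurable M" by (intro borel_measurable_prod Y) auto
    have Y_bd: "AE \<omega> in M. Y (Suc t) \<omega> \<le> B" by (rule Y) simp
    have bd: "AE \<omega> in M. ?W \<omega> * Y (Suc t) \<omega> \<le> B ^ Suc t"
      using conjunct1[OF Suc.IH] Y_bd
    proof eventually_elim
      case (elim \<omega>)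
      have "0 \<le> B ^ t" using elim(1) W_nonneg[of \<omega>] by linarith
      with elim have "?W \<omega> * Y (Suc t) \<omega> \<le> B ^ t * B"
        using W_nonneg Y(2) by (intro mult_mono) auto
      then show ?case by (simp add: mult.commute)
    qed
    have int: "integrable M (\<lambda>\<omega>. ?W \<omega> * Y (Suc t) \<omega>)"
    proof (rule integrable_const_bound[of _ "B ^ Suc t"])
      show "AE \<omega> in M. norm (?W \<omega> * Y (Suc t) \<omega>) \<le> B ^ Suc t"
        using bd by eventually_elim (use W_nonneg Y(2) in \<open>simp add: abs_mult\<close>)
    qed measurable
    have "(LINT \<omega>|M. ?W \<omega> * Y (Suc t) \<omega>) = (LINT \<omega>|M. ?W \<omega> * real_cond_exp M (G (Suc t)) (Y (Suc t)) \<omega>)"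
      by (rule G.real_cond_exp_intg(2)[OF int W_G Y_M, symmetric])
    also have "\<dots> \<le> (LINT \<omega>|M. ?W \<omega>)"
    proof (rule integral_mono_AE)
      show "integrable M (\<lambda>\<omega>. ?W \<omega> * real_cond_exp M (G (Suc t)) (Y (Suc t)) \<omega>)"
        by (rule G.real_cond_exp_intg(1)[OF int W_G Y_M])
      have "AE \<omega> in M. real_cond_exp M (G (Suc t)) (Y (Suc t)) \<omega> \<le> 1" by (rule le) simp
      then show "AE \<omega> in M. ?W \<omega> * real_cond_exp M (G (Suc t)) (Y (Suc t)) \<omega> \<le> ?W \<omega>"
      proof eventually_elim
        case (elim \<omega>)
        then show ?case using mult_left_mono[OF elim W_nonneg[of \<omega>]] by simp
      qed
    qed (use Suc.IH in auto)
    also have "\<dots> \<le> 1" using Suc.IH by auto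
    finally show ?case using bd int by simp
  qed
  then show "integrable M (\<lambda>\<omega>. \<Prod>\<tau>=1..t. Y \<tau> \<omega>)" "(LINT \<omega>|M. (\<Prod>\<tau>=1..t. Y \<tau> \<omega>)) \<le> 1"
    by auto
qed

lemma chernoff_adapted_sum:
  fixes U :: "nat \<Rightarrow> 'a \<Rightarrow> real"
  assumes sub: "\<And>\<tau>. 1 \<le> \<tau> \<Longrightarrow> subalgebra M (G \<tau>)"
    and U: "\<And>\<tau>. 1 \<le> \<tau> \<Longrightarrow> U \<tau> \<in> borel_measurable M" "\<And>\<tau>. 1 \<le> \<tau> \<Longrightarrow> AE \<omega> in M. U \<tau> \<omega> \<le> B"
    and past: "\<And>\<sigma> \<tau>. 1 \<le> \<sigma> \<Longrightarrow> \<sigma> < \<tau> \<Longrightarrow> U \<sigma> \<in> borel_measurable (G \<tau>)"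
    and le: "\<And>\<tau>. 1 \<le> \<tau> \<Longrightarrow> AE \<omega> in M. real_cond_exp M (G \<tau>) (\<lambda>\<omega>. exp (U \<tau> \<omega>)) \<omega> \<le> 1"
  shows "measure M {\<omega>\<in>space M. u \<le> (\<Sum>\<tau>=1..t. U \<tau> \<omega>)} \<le> exp (- u)"
proof -
  have "AE \<omega> in M. exp (U \<tau> \<omega>) \<le> exp B" if "1 \<le> \<tau>" for \<tau>
    using U(2)[OF that] by simp
  note sm = supermartingale_expectation_le_one[OF sub _ _ this _ le]
  have prod: "(\<Prod>\<tau>=1..t. exp (U \<tau> \<omega>)) = exp (\<Sum>\<tau>=1..t. U \<tau> \<omega>)" for \<omega>
    by (simp add: exp_sum)
  have int: "integrable M (\<lambda>\<omega>. exp (\<Sum>\<tau>=1..t. U \<tau> \<omega>))"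
    unfolding prod[symmetric] by (rule sm(1)) (use U(1) past in auto)
  have one: "(LINT \<omega>|M. exp (\<Sum>\<tau>=1..t. U \<tau> \<omega>)) \<le> 1"
    unfolding prod[symmetric] by (rule sm(2)) (use U(1) past in auto)
  have "measure M {\<omega>\<in>space M. exp u \<le> exp (\<Sum>\<tau>=1..t. U \<tau> \<omega>)} \<le>
      (LINT \<omega>|M. exp (\<Sum>\<tau>=1..t. U \<tau> \<omega>)) / exp u"
    by (rule integral_Markov_inequality_measure[OF int, of "{}"]) auto
  also have "\<dots> \<le> 1 / exp u" using one by (intro divide_right_mono) auto
  finally show ?thesis by (simp add: exp_minus inverse_eq_divide)
qed

text \<open>
  Here \<open>e j \<tau>\<close> is an empirical risk increment and \<open>m j \<tau>\<close> its conditional mean. As the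
  empirical minimiser beats the oracle empirically, an excess of its conditional risk over
  \<open>1 + 2 * a\<close> times that of the oracle forces a large deviation of one of the two sums from its
  compensator. The slack left by the factor \<open>1 + 2 * a\<close> is proportional to the conditional risk; it
  absorbs the part of the variance term that is proportional to \<open>m\<close>, and the bound comes out the
  same whatever the size of the conditional risk.
\<close>
lemma oracle_deviation:
  fixes e m :: "nat \<Rightarrow> nat \<Rightarrow> 'a \<Rightarrow> real" and jhat jtilde :: "'a \<Rightarrow> nat"
  assumes sub: "\<And>\<tau>. 1 \<le> \<tau> \<Longrightarrow> subalgebra M (G \<tau>)"
    and e: "\<And>j \<tau>. j \<in> {1..J} \<Longrightarrow> 1 \<le> \<tau> \<Longrightarrow> e j \<tau> \<in> borel_measurable M"
      "\<And>j \<sigma> \<tau>. j \<in> {1..J} \<Longrightarrow> 1 \<le> \<sigma> \<Longrightarrow> \<sigma> < \<tau> \<Longrightarrow> e j \<sigma> \<in> borel_measurable (G \<tau>)"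
    and m: "\<And>j \<sigma> \<tau>. j \<in> {1..J} \<Longrightarrow> 1 \<le> \<sigma> \<Longrightarrow> \<sigma> \<le> \<tau> \<Longrightarrow> m j \<sigma> \<in> borel_measurable (G \<tau>)"
      "\<And>j \<tau>. j \<in> {1..J} \<Longrightarrow> 1 \<le> \<tau> \<Longrightarrow> AE \<omega> in M. 0 \<le> m j \<tau> \<omega>"
    and bound: "\<And>j \<tau>. j \<in> {1..J} \<Longrightarrow> 1 \<le> \<tau> \<Longrightarrow> AE \<omega> in M. \<bar>e j \<tau> \<omega> - m j \<tau> \<omega>\<bar> \<le> b"
    and moment: "\<And>j \<tau> \<mu>. j \<in> {1..J} \<Longrightarrow> 1 \<le> \<tau> \<Longrightarrow> \<bar>\<mu>\<bar> = \<kappa> \<Longrightarrow>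
      AE \<omega> in M. real_cond_exp M (G \<tau>) (\<lambda>\<omega>. exp (\<mu> * (e j \<tau> \<omega> - m j \<tau> \<omega>)
        - \<mu>\<^sup>2 * V * (x + a * m j \<tau> \<omega>))) \<omega> \<le> 1"
    and j: "AE \<omega> in M. jhat \<omega> \<in> {1..J} \<and> jtilde \<omega> \<in> {1..J} \<and>
      (\<Sum>\<tau>=1..t. e (jhat \<omega>) \<tau> \<omega>) \<le> (\<Sum>\<tau>=1..t. e (jtilde \<omega>) \<tau> \<omega>)"
    and pos: "0 < a" "0 < x" "0 < \<kappa>" "0 \<le> V" and V: "\<kappa> * V \<le> 1 / (4 * (1 + a))"
    and S: "S \<subseteq> space M" "AE \<omega> in M. \<omega> \<in> S \<longrightarrow>
      (\<Sum>\<tau>=1..t. m (jhat \<omega>) \<tau> \<omega>) \<ge> (1 + 2 * a) * (\<Sum>\<tau>=1..t. m (jtilde \<omega>) \<tau> \<omega>) + t * x"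
  shows "measure M S \<le> 2 * real J * exp (- (\<kappa> * t * x / (4 * (1 + a))))"
proof -
  define U where "U \<mu> j \<tau> \<omega> = \<mu> * (e j \<tau> \<omega> - m j \<tau> \<omega>) - \<mu>\<^sup>2 * V * (x + a * m j \<tau> \<omega>)"
    for \<mu> j \<tau> \<omega>
  define u where "u = \<kappa> * t * x / (4 * (1 + a))"
  define E where "E \<mu> j = {\<omega> \<in> space M. u \<le> (\<Sum>\<tau>=1..t. U \<mu> j \<tau> \<omega>)}" for \<mu> j
  have U_G: "U \<mu> j \<sigma> \<in> borel_measurable (G \<tau>)" if "j \<in> {1..J}" "1 \<le> \<sigma>" "\<sigma> < \<tau>" for \<mu> j \<sigma> \<tau>
  proof -
    have [measurable]: "e j \<sigma> \<in> borel_measurable (G \<tau>)" "m j \<sigma> \<in> borel_measurable (G \<tau>)"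
      using that e m by auto
    show ?thesis unfolding U_def by measurable
  qed
  have U_M: "U \<mu> j \<tau> \<in> borel_measurable M" if "j \<in> {1..J}" "1 \<le> \<tau>" for \<mu> j \<tau>
  proof -
    have [measurable]: "e j \<tau> \<in> borel_measurable M" "m j \<tau> \<in> borel_measurable M"
      using that e measurable_subalgebra[OF m(1) sub, of j \<tau> \<tau>] by auto
    show ?thesis unfolding U_def by measurable
  qed
  have E_le: "measure M (E \<mu> j) \<le> exp (- u)" if j: "j \<in> {1..J}" and \<mu>: "\<bar>\<mu>\<bar> = \<kappa>" for \<mu> j
    unfolding E_def
  proof (rule chernoff_adapted_sum[OF sub])
    fix \<tau> :: nat assume \<tau>: "1 \<le> \<tau>"
    show "AE \<omega> in M. U \<mu> j \<tau> \<omega> \<le> \<kappa> * b"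
      using bound[OF j \<tau>] m(2)[OF j \<tau>]
    proof eventually_elim
      case (elim \<omega>)
      have "\<mu> * (e j \<tau> \<omega> - m j \<tau> \<omega>) \<le> \<bar>\<mu>\<bar> * \<bar>e j \<tau> \<omega> - m j \<tau> \<omega>\<bar>"
        using abs_ge_self[of "\<mu> * (e j \<tau> \<omega> - m j \<tau> \<omega>)"] by (simp add: abs_mult)
      also have "\<dots> \<le> \<kappa> * b" using elim pos \<mu> by (intro mult_mono) auto
      moreover have "0 \<le> \<mu>\<^sup>2 * V * (x + a * m j \<tau> \<omega>)" using elim pos by simp
      ultimately show ?case by (simp add: U_def)
    qed
    show "AE \<omega> in M. real_cond_exp M (G \<tau>) (\<lambda>\<omega>. exp (U \<mu> j \<tau> \<omega>)) \<omega> \<le> 1"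
      unfolding U_def by (rule moment[OF j \<tau> \<mu>])
  qed (use U_G U_M j in auto)
  let ?Bad = "\<Union>j\<in>{1..J}. E (- \<kappa>) j \<union> E \<kappa> j"
  have E_sets: "E \<mu> j \<in> sets M" if "j \<in> {1..J}" for \<mu> j
  proof -
    have [measurable]: "(\<lambda>\<omega>. \<Sum>\<tau>=1..t. U \<mu> j \<tau> \<omega>) \<in> borel_measurable M"
      by (intro borel_measurable_sum U_M that) auto
    show ?thesis unfolding E_def by measurable
  qed
  have m_AE: "AE \<omega> in M. \<forall>j\<in>{1..J}. \<forall>\<tau>\<in>{1..t}. 0 \<le> m j \<tau> \<omega>"
    by (intro AE_finite_allI finite_atLeastAtMost m(2)) auto
  have "measure M S \<le> measure M ?Bad"
  proof (rule finite_measure_mono_AE)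
    show "?Bad \<in> sets M" using E_sets by auto
    show "AE \<omega> in M. \<omega> \<in> S \<longrightarrow> \<omega> \<in> ?Bad"
      using j m_AE S(2)
    proof eventually_elim
      case (elim \<omega>)
      show ?case
      proof (intro impI)
        assume "\<omega> \<in> S"
        then have \<omega>: "\<omega> \<in> space M" and excess: "(\<Sum>\<tau>=1..t. m (jhat \<omega>) \<tau> \<omega>) \<ge>
          (1 + 2 * a) * (\<Sum>\<tau>=1..t. m (jtilde \<omega>) \<tau> \<omega>) + t * x"
          using elim S(1) by auto
        define C where "C j = (\<Sum>\<tau>=1..t. m j \<tau> \<omega>)" for j
        define R where "R j = (\<Sum>\<tau>=1..t. e j \<tau> \<omega>)" for j
        have C_nonneg: "0 \<le> C j" if "j \<in> {1..J}" for j
          unfolding C_def using elim that by (intro sum_nonneg) auto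
        have U_sum: "(\<Sum>\<tau>=1..t. U \<mu> j \<tau> \<omega>) = \<mu> * (R j - C j) - \<mu>\<^sup>2 * V * (t * x + a * C j)" for \<mu> j
          unfolding U_def R_def C_def
          by (simp add: sum_subtractf sum.distrib flip: sum_distrib_left)
        \<comment> \<open>Outside the bad event, the bound on \<open>\<kappa> * V\<close> turns the variance term
          into a multiple of \<open>t * x + a * C j\<close>.\<close>
        have small: "4 * (1 + a) * (sgn \<mu> * (R j - C j)) < 2 * t * x + a * C j"
          if j: "j \<in> {1..J}" and \<mu>: "\<bar>\<mu>\<bar> = \<kappa>" and nE: "\<omega> \<notin> E \<mu> j" for \<mu> j
        proof -
          have \<mu>': "\<mu> = \<kappa> * sgn \<mu>" using \<mu> by (metis mult.commute sgn_mult_abs)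
          have "\<mu> * (R j - C j) < u + \<mu>\<^sup>2 * V * (t * x + a * C j)"
            using nE \<omega> U_sum by (auto simp: E_def)
          also have "\<mu>\<^sup>2 * V * (t * x + a * C j) = \<kappa> * (\<kappa> * V) * (t * x + a * C j)"
            using \<mu> by (metis power2_abs power2_eq_square mult.assoc)
          also have "\<dots> \<le> \<kappa> * (1 / (4 * (1 + a))) * (t * x + a * C j)"
            using V pos C_nonneg[OF j] by (intro mult_right_mono mult_left_mono) auto
          also have "u + \<dots> = \<kappa> * ((2 * t * x + a * C j) / (4 * (1 + a)))"
            by (simp add: u_def add_divide_distrib[symmetric] algebra_simps)
          finally have "\<kappa> * (sgn \<mu> * (R j - C j)) < \<kappa> * ((2 * t * x + a * C j) / (4 * (1 + a)))"
            using \<mu>' by (metis mult.assoc add_left_mono)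
          then have "sgn \<mu> * (R j - C j) < (2 * t * x + a * C j) / (4 * (1 + a))"
            using pos(3) by (simp only: mult_less_cancel_left_pos)
          then show ?thesis using pos by (simp add: pos_less_divide_eq mult.commute)
        qed
        show "\<omega> \<in> ?Bad"
        proof (rule ccontr)
          assume not: "\<omega> \<notin> ?Bad"
          let ?i = "jhat \<omega>" and ?k = "jtilde \<omega>"
          have ik: "?i \<in> {1..J}" "?k \<in> {1..J}" and R: "R ?i \<le> R ?k"
            using elim by (auto simp: R_def)
          have 1: "4 * (1 + a) * (C ?i - R ?i) < 2 * t * x + a * C ?i"
            using small[of ?i "- \<kappa>"] not ik pos by auto
          have 2: "4 * (1 + a) * (R ?k - C ?k) < 2 * t * x + a * C ?k"
            using small[of ?k \<kappa>] not ik pos by auto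
          have "4 * (1 + a) * R ?i \<le> 4 * (1 + a) * R ?k"
            using R pos by simp
          with 1 2 have 3: "4 * (1 + a) * C ?i - 4 * (1 + a) * C ?k < 4 * t * x + a * C ?i + a * C ?k"
            by (simp only: right_diff_distrib)
          have "(4 + 3 * a) * ((1 + 2 * a) * C ?k + t * x) \<le> (4 + 3 * a) * C ?i"
            using excess pos by (intro mult_left_mono) (auto simp: C_def)
          moreover have "0 \<le> a * C ?k" "0 \<le> a * (a * C ?k)" "0 \<le> a * (t * x)"
            using C_nonneg[OF ik(2)] pos by auto
          ultimately show False using 3 by (simp add: algebra_simps)
        qed
      qed
    qed
  qed
  also have "\<dots> \<le> (\<Sum>j\<in>{1..J}. measure M (E (- \<kappa>) j \<union> E \<kappa> j))"
    by (rule finite_measure_subadditive_finite) (use E_sets in auto)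
  also have "\<dots> \<le> (\<Sum>j\<in>{1..J}. 2 * exp (- u))"
  proof (rule sum_mono)
    fix j assume j: "j \<in> {1..J}"
    have "measure M (E (- \<kappa>) j \<union> E \<kappa> j) \<le> measure M (E (- \<kappa>) j) + measure M (E \<kappa> j)"
      using E_sets[OF j] by (intro measure_Un_le) auto
    also have "\<dots> \<le> exp (- u) + exp (- u)"
      using E_le[OF j] pos by (intro add_mono) auto
    finally show "measure M (E (- \<kappa>) j \<union> E \<kappa> j) \<le> 2 * exp (- u)" by simp
  qed
  also have "\<dots> = 2 * real J * exp (- u)" by simp
  finally show ?thesis by (simp add: u_def)
qed

end

section \<open>One time step\<close>

text \<open>
  One time step: \<open>G\<close> is generated by the past and all the summaries, \<open>L i\<close> by the past and the
  summary at \<open>i\<close>, and \<open>f i\<close> is the excess loss at \<open>i\<close>. The Bernstein condition bounds second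
  moments by a power of the means given \<open>L i\<close>, vertex by vertex, but only the sums over the
  vertices are known to be unaffected when \<open>L i\<close> is replaced by \<open>G\<close>. So the power is first
  replaced by an affine function of the mean, which commutes with sums.
\<close>
locale bernstein_step = prob_space M for M :: "'a measure" +
  fixes G :: "'a measure" and L :: "'i \<Rightarrow> 'a measure" and I :: "'i set" and f :: "'i \<Rightarrow> 'a \<Rightarrow> real"
    and B b \<beta> \<gamma> h :: real
  assumes G: "subalgebra M G" and L: "\<And>i. i \<in> I \<Longrightarrow> subalgebra G (L i)"
    and I: "finite I" "I \<noteq> {}"
    and f: "\<And>i. i \<in> I \<Longrightarrow> f i \<in> borel_measurable M"
      "\<And>i. i \<in> I \<Longrightarrow> AE \<omega> in M. \<bar>f i \<omega>\<bar> \<le> B"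
    and first_local: "sum_cond_exp_local M G L I f"
    and second_local: "sum_cond_exp_local M G L I (\<lambda>i \<omega>. (f i \<omega>)\<^sup>2)"
    and dev: "\<And>i. i \<in> I \<Longrightarrow> AE \<omega> in M. \<bar>f i \<omega> - real_cond_exp M (L i) (f i) \<omega>\<bar> \<le> b"
    and bernstein: "\<And>i. i \<in> I \<Longrightarrow> AE \<omega> in M. 0 \<le> real_cond_exp M (L i) (f i) \<omega> \<and>
      real_cond_exp M (L i) (\<lambda>\<omega>. (f i \<omega>)\<^sup>2) \<omega> \<le> \<gamma> * real_cond_exp M (L i) (f i) \<omega> powr \<beta>"
    and params: "0 < \<beta>" "\<beta> \<le> 1" "0 < \<gamma>" "0 < h"
begin

definition avg :: "'a \<Rightarrow> real" where "avg \<omega> = 1 / card I * (\<Sum>i\<in>I. f i \<omega>)"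

text \<open>Up to \<open>\<gamma>\<close>, the factor of \<open>h + m\<close> in \<open>powr_le_linear\<close>.\<close>
definition q :: real where "q = \<gamma> * h powr (\<beta> - 1)"

lemma card_pos: "0 < card I"
  using I by (simp add: card_gt_0_iff)

lemma subL: "i \<in> I \<Longrightarrow> subalgebra M (L i)"
  using G L subalgebra_trans by blast

sublocale G: finite_measure_subalgebra M G
  by (rule finite_measure_subalgebraI[OF G])

lemma f_int: "i \<in> I \<Longrightarrow> integrable M (f i)"
  using f by (intro integrable_const_bound[of _ B]) auto

lemma f_sq_int:
  assumes i: "i \<in> I"
  shows "integrable M (\<lambda>\<omega>. (f i \<omega>)\<^sup>2)"
proof (rule integrable_const_bound[of _ "B\<^sup>2"])
  show "AE \<omega> in M. norm ((f i \<omega>)\<^sup>2) \<le> B\<^sup>2"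
    using f(2)[OF i] by eventually_elim (auto simp: abs_le_square_iff[symmetric])
qed (use f(1)[OF i] in measurable)

lemma mean_sum:
  "AE \<omega> in M. real_cond_exp M G (\<lambda>\<omega>. \<Sum>i\<in>I. f i \<omega>) \<omega> = (\<Sum>i\<in>I. real_cond_exp M G (f i) \<omega>)"
  by (rule real_cond_exp_sum_finite[OF G f_int])

lemma mean_sum_sq:
  "AE \<omega> in M. real_cond_exp M G (\<lambda>\<omega>. \<Sum>i\<in>I. (f i \<omega>)\<^sup>2) \<omega> =
    (\<Sum>i\<in>I. real_cond_exp M G (\<lambda>\<omega>. (f i \<omega>)\<^sup>2) \<omega>)"
  by (rule real_cond_exp_sum_finite[OF G f_sq_int])

lemma avg_measurable [measurable]: "avg \<in> borel_measurable M"
  unfolding avg_def using f(1) by (intro borel_measurable_times borel_measurable_sum) auto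

lemma avg_int: "integrable M avg"
  unfolding avg_def using f_int by (intro integrable_mult_right Bochner_Integration.integrable_sum) auto

lemma mean_avg:
  "AE \<omega> in M. real_cond_exp M G avg \<omega> = 1 / card I * (\<Sum>i\<in>I. real_cond_exp M (L i) (f i) \<omega>)"
proof -
  have "AE \<omega> in M. real_cond_exp M G avg \<omega> = 1 / card I * real_cond_exp M G (\<lambda>\<omega>. \<Sum>i\<in>I. f i \<omega>) \<omega>"
    unfolding avg_def
    by (rule G.real_cond_exp_cmult) (use f_int in \<open>auto intro: Bochner_Integration.integrable_sum\<close>)
  with first_local show ?thesis unfolding sum_cond_exp_local_def by auto
qed

lemma mean_avg_global:
  "AE \<omega> in M. real_cond_exp M G avg \<omega> = 1 / card I * (\<Sum>i\<in>I. real_cond_exp M G (f i) \<omega>)"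
proof -
  have "AE \<omega> in M. real_cond_exp M G avg \<omega> = 1 / card I * real_cond_exp M G (\<lambda>\<omega>. \<Sum>i\<in>I. f i \<omega>) \<omega>"
    unfolding avg_def
    by (rule G.real_cond_exp_cmult) (use f_int in \<open>auto intro: Bochner_Integration.integrable_sum\<close>)
  with mean_sum show ?thesis by auto
qed

lemma mean_nonneg: "AE \<omega> in M. 0 \<le> real_cond_exp M G avg \<omega>"
proof -
  have "AE \<omega> in M. \<forall>i\<in>I. 0 \<le> real_cond_exp M (L i) (f i) \<omega>"
    by (intro AE_finite_allI I(1)) (use bernstein in auto)
  with mean_avg show ?thesis
    by eventually_elim (auto intro!: divide_nonneg_nonneg sum_nonneg)
qed

lemma second_moment_sum:
  "AE \<omega> in M. (\<Sum>i\<in>I. real_cond_exp M G (\<lambda>\<omega>. (f i \<omega>)\<^sup>2) \<omega>) \<le> card I * q * (h + real_cond_exp M G avg \<omega>)"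
proof -
  have "AE \<omega> in M. \<forall>i\<in>I. 0 \<le> real_cond_exp M (L i) (f i) \<omega> \<and>
      real_cond_exp M (L i) (\<lambda>\<omega>. (f i \<omega>)\<^sup>2) \<omega> \<le> \<gamma> * real_cond_exp M (L i) (f i) \<omega> powr \<beta>"
    by (intro AE_finite_allI I(1)) (use bernstein in auto)
  moreover note mean_sum_sq
  moreover note second_local[unfolded sum_cond_exp_local_def]
  moreover note mean_avg
  ultimately show ?thesis
  proof eventually_elim
    case (elim \<omega>)
    have "(\<Sum>i\<in>I. real_cond_exp M G (\<lambda>\<omega>. (f i \<omega>)\<^sup>2) \<omega>) = (\<Sum>i\<in>I. real_cond_exp M (L i) (\<lambda>\<omega>. (f i \<omega>)\<^sup>2) \<omega>)"
      using elim by simp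
    also have "\<dots> \<le> (\<Sum>i\<in>I. q * (h + real_cond_exp M (L i) (f i) \<omega>))"
    proof (rule sum_mono)
      fix i assume i: "i \<in> I"
      have "real_cond_exp M (L i) (\<lambda>\<omega>. (f i \<omega>)\<^sup>2) \<omega> \<le> \<gamma> * real_cond_exp M (L i) (f i) \<omega> powr \<beta>"
        using elim i by auto
      also have "\<dots> \<le> \<gamma> * (h powr (\<beta> - 1) * (h + real_cond_exp M (L i) (f i) \<omega>))"
        using elim i params by (intro mult_left_mono powr_le_linear) auto
      finally show "real_cond_exp M (L i) (\<lambda>\<omega>. (f i \<omega>)\<^sup>2) \<omega> \<le> q * (h + real_cond_exp M (L i) (f i) \<omega>)"
        by (simp add: q_def)
    qed
    also have "\<dots> = card I * q * (h + real_cond_exp M G avg \<omega>)"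
      using elim card_pos by (simp add: sum_distrib_left[symmetric] sum.distrib field_simps)
    finally show ?case .
  qed
qed

lemma avg_deviation: "AE \<omega> in M. \<bar>avg \<omega> - real_cond_exp M G avg \<omega>\<bar> \<le> b"
proof -
  have "AE \<omega> in M. \<forall>i\<in>I. \<bar>f i \<omega> - real_cond_exp M (L i) (f i) \<omega>\<bar> \<le> b"
    by (intro AE_finite_allI I(1)) (use dev in auto)
  with mean_avg show ?thesis
  proof eventually_elim
    case (elim \<omega>)
    have "avg \<omega> - real_cond_exp M G avg \<omega> = 1 / card I * (\<Sum>i\<in>I. f i \<omega> - real_cond_exp M (L i) (f i) \<omega>)"
      using elim by (simp add: avg_def sum_subtractf diff_divide_distrib)
    then have "\<bar>avg \<omega> - real_cond_exp M G avg \<omega>\<bar> = 1 / card I * \<bar>\<Sum>i\<in>I. f i \<omega> - real_cond_exp M (L i) (f i) \<omega>\<bar>"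
      by (simp add: abs_mult)
    also have "\<dots> \<le> 1 / card I * (\<Sum>i\<in>I. b)"
      using elim by (intro mult_left_mono order_trans[OF sum_abs] sum_mono) auto
    also have "\<dots> = b" using card_pos by simp
    finally show ?case .
  qed
qed

text \<open>
  The mean given \<open>G\<close> differs from the mean given \<open>L i\<close> by the conditional expectation of a
  deviation that is bounded by \<open>b\<close>.
\<close>
lemma deviation_global:
  assumes i: "i \<in> I"
  shows "AE \<omega> in M. \<bar>f i \<omega> - real_cond_exp M G (f i) \<omega>\<bar> \<le> 2 * b"
proof -
  let ?m = "real_cond_exp M (L i) (f i)"
  interpret Li: finite_measure_subalgebra M "L i"
    by (rule finite_measure_subalgebraI[OF subL[OF i]])
  have m_G: "?m \<in> borel_measurable G"
    by (rule measurable_subalgebra[OF _ L[OF i]]) simp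
  have m_int: "integrable M ?m" by (rule Li.real_cond_exp_int(1)[OF f_int[OF i]])
  have "AE \<omega> in M. \<bar>real_cond_exp M G (\<lambda>\<omega>. f i \<omega> - ?m \<omega>) \<omega>\<bar> \<le> b"
    using f(1)[OF i] by (intro real_cond_exp_abs_bound[OF G _ dev[OF i]]) auto
  moreover have "AE \<omega> in M. real_cond_exp M G (\<lambda>\<omega>. f i \<omega> - ?m \<omega>) \<omega> =
      real_cond_exp M G (f i) \<omega> - real_cond_exp M G ?m \<omega>"
    by (rule G.real_cond_exp_diff[OF f_int[OF i] m_int])
  moreover have "AE \<omega> in M. real_cond_exp M G ?m \<omega> = ?m \<omega>"
    by (rule G.real_cond_exp_F_meas[OF m_int m_G])
  ultimately show ?thesis using dev[OF i] by eventually_elim linarith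
qed

text \<open>
  The average is treated as a single bounded variable; by the Cauchy-Schwarz inequality its second
  moment is at most the average of the second moments.
\<close>
lemma avg_moment:
  assumes \<mu>: "\<bar>\<mu>\<bar> * b \<le> 3 / 2"
  shows "AE \<omega> in M. real_cond_exp M G (\<lambda>\<omega>. exp (\<mu> * (avg \<omega> - real_cond_exp M G avg \<omega>)
    - \<mu>\<^sup>2 * (q * (h + real_cond_exp M G avg \<omega>)))) \<omega> \<le> 1"
proof -
  let ?m = "real_cond_exp M G avg"
  have mean0: "AE \<omega> in M. real_cond_exp M G (\<lambda>\<omega>. avg \<omega> - ?m \<omega>) \<omega> = 0"
  proof -
    have "AE \<omega> in M. real_cond_exp M G (\<lambda>\<omega>. avg \<omega> - ?m \<omega>) \<omega> = ?m \<omega> - real_cond_exp M G ?m \<omega>"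
      by (rule G.real_cond_exp_diff[OF avg_int G.real_cond_exp_int(1)[OF avg_int]])
    moreover have "AE \<omega> in M. real_cond_exp M G ?m \<omega> = ?m \<omega>"
      by (rule G.real_cond_exp_F_meas[OF G.real_cond_exp_int(1)[OF avg_int]]) simp
    ultimately show ?thesis by auto
  qed
  have avg_bd: "AE \<omega> in M. \<bar>avg \<omega>\<bar> \<le> B"
  proof -
    have "AE \<omega> in M. \<forall>i\<in>I. \<bar>f i \<omega>\<bar> \<le> B"
      by (intro AE_finite_allI I(1)) (use f in auto)
    then show ?thesis
    proof eventually_elim
      case (elim \<omega>)
      have "\<bar>avg \<omega>\<bar> = 1 / card I * \<bar>\<Sum>i\<in>I. f i \<omega>\<bar>" by (simp add: avg_def abs_mult)
      also have "\<dots> \<le> 1 / card I * (\<Sum>i\<in>I. B)"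
        using elim by (intro mult_left_mono order_trans[OF sum_abs] sum_mono) auto
      also have "\<dots> = B" using card_pos by simp
      finally show ?case .
    qed
  qed
  have sq_le: "(avg \<omega>)\<^sup>2 \<le> 1 / card I * (\<Sum>i\<in>I. (f i \<omega>)\<^sup>2)" for \<omega>
  proof -
    have "(avg \<omega>)\<^sup>2 = (1 / card I)\<^sup>2 * (\<Sum>i\<in>I. f i \<omega>)\<^sup>2" by (simp add: avg_def power_mult_distrib power_divide)
    also have "\<dots> \<le> (1 / card I)\<^sup>2 * ((\<Sum>i\<in>I. (f i \<omega>)\<^sup>2) * card I)"
      by (intro mult_left_mono sum_squared_le_sum_of_squares) simp
    also have "\<dots> = 1 / card I * (\<Sum>i\<in>I. (f i \<omega>)\<^sup>2)"
      using card_pos by (simp add: power2_eq_square)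
    finally show ?thesis .
  qed
  have sum_sq_int: "integrable M (\<lambda>\<omega>. \<Sum>i\<in>I. (f i \<omega>)\<^sup>2)"
    using f_sq_int by (intro Bochner_Integration.integrable_sum) auto
  have avg_sq_int: "integrable M (\<lambda>\<omega>. (avg \<omega>)\<^sup>2)"
  proof (rule integrable_const_bound[of _ "B\<^sup>2"])
    show "AE \<omega> in M. norm ((avg \<omega>)\<^sup>2) \<le> B\<^sup>2"
      using avg_bd by eventually_elim (auto simp: abs_le_square_iff[symmetric])
  qed measurable
  have "AE \<omega> in M. real_cond_exp M G (\<lambda>\<omega>. (avg \<omega>)\<^sup>2) \<omega> \<le>
      real_cond_exp M G (\<lambda>\<omega>. 1 / card I * (\<Sum>i\<in>I. (f i \<omega>)\<^sup>2)) \<omega>"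
    by (rule G.real_cond_exp_mono[OF AE_I2[OF sq_le] avg_sq_int integrable_mult_right[OF sum_sq_int]])
  moreover have "AE \<omega> in M. real_cond_exp M G (\<lambda>\<omega>. 1 / card I * (\<Sum>i\<in>I. (f i \<omega>)\<^sup>2)) \<omega> =
      1 / card I * real_cond_exp M G (\<lambda>\<omega>. \<Sum>i\<in>I. (f i \<omega>)\<^sup>2) \<omega>"
    by (rule G.real_cond_exp_cmult[OF sum_sq_int])
  moreover note mean_sum_sq second_moment_sum
    real_cond_exp_variance_le[OF G avg_measurable avg_bd]
  ultimately have var: "AE \<omega> in M. real_cond_exp M G (\<lambda>\<omega>. (avg \<omega> - ?m \<omega>)\<^sup>2) \<omega> \<le> q * (h + ?m \<omega>)"
  proof eventually_elim
    case (elim \<omega>)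
    note elim(5)
    also note elim(1)
    also note elim(2)
    also note elim(3)
    also have "1 / card I * (\<Sum>i\<in>I. real_cond_exp M G (\<lambda>\<omega>. (f i \<omega>)\<^sup>2) \<omega>) \<le> 1 / card I * (card I * q * (h + ?m \<omega>))"
      using elim by (intro mult_left_mono) auto
    also have "\<dots> = q * (h + ?m \<omega>)" using card_pos by simp
    finally show ?case .
  qed
  show ?thesis
    by (rule cond_bernstein(2)[OF G _ avg_deviation mean0 var _ \<mu>]) measurable
qed

text \<open>
  Compared with \<open>avg_moment\<close>, the variance is multiplied by \<open>D / card I\<close>, and the range of \<open>\<mu>\<close> by
  half the inverse of that factor: to exploit the conditional independence given \<open>G\<close>, each term is
  centred at its mean given \<open>G\<close>, which doubles the bound on the deviations.
\<close>
lemma avg_moment_coloured: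
  fixes col :: "'i \<Rightarrow> nat"
  assumes X: "\<And>i. i \<in> I \<Longrightarrow> X i \<in> M \<rightarrow>\<^sub>M N"
    and fX: "\<And>i. i \<in> I \<Longrightarrow> f i \<in> borel_measurable (adjoin G N (X i))"
    and col: "\<And>i. i \<in> I \<Longrightarrow> col i < D" "0 < D"
    and indep: "\<And>i I'. i \<in> I \<Longrightarrow> I' \<subseteq> I - {i} \<Longrightarrow> (\<forall>k\<in>I'. col k = col i) \<Longrightarrow>
      cond_indep_var M G N (X i) (\<Pi>\<^sub>M i\<in>I'. N) (\<lambda>\<omega>. \<lambda>i\<in>I'. X i \<omega>)"
    and \<mu>: "\<bar>\<mu>\<bar> * (2 * b) * (D / card I) \<le> 3 / 2"
  shows "AE \<omega> in M. real_cond_exp M G (\<lambda>\<omega>. exp (\<mu> * (avg \<omega> - real_cond_exp M G avg \<omega>)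
    - \<mu>\<^sup>2 * (D / card I * q * (h + real_cond_exp M G avg \<omega>)))) \<omega> \<le> 1"
proof -
  let ?m = "real_cond_exp M G avg"
  define v where "v \<omega> = \<mu> / card I * (\<Sum>i\<in>I. f i \<omega> - real_cond_exp M G (f i) \<omega>) -
      (\<mu> / card I)\<^sup>2 * D * (\<Sum>i\<in>I. real_cond_exp M G (\<lambda>\<omega>. (f i \<omega>)\<^sup>2) \<omega>)" for \<omega>
  define u where "u \<omega> = \<mu> * (avg \<omega> - ?m \<omega>) - \<mu>\<^sup>2 * (D / card I * q * (h + ?m \<omega>))" for \<omega>
  have \<mu>': "\<bar>\<mu> / card I\<bar> * D * (2 * b) \<le> 3 / 2"
    using \<mu> by (simp add: abs_divide mult_ac)
  have v_int: "integrable M (\<lambda>\<omega>. exp (v \<omega>))"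
    unfolding v_def
    by (rule cond_bernstein_coloured(1)[OF G I(1) X col indep fX f(2) deviation_global \<mu>'])
  have v_le: "AE \<omega> in M. real_cond_exp M G (\<lambda>\<omega>. exp (v \<omega>)) \<omega> \<le> 1"
    unfolding v_def
    by (rule cond_bernstein_coloured(2)[OF G I(1) X col indep fX f(2) deviation_global \<mu>'])
  have u_v: "AE \<omega> in M. exp (u \<omega>) \<le> exp (v \<omega>)"
    using mean_avg_global second_moment_sum
  proof eventually_elim
    case (elim \<omega>)
    have "\<mu> / card I * (\<Sum>i\<in>I. f i \<omega> - real_cond_exp M G (f i) \<omega>) = \<mu> * (avg \<omega> - ?m \<omega>)"
      using elim by (simp add: avg_def sum_subtractf diff_divide_distrib right_diff_distrib)
    moreover have "(\<mu> / card I)\<^sup>2 * D * (\<Sum>i\<in>I. real_cond_exp M G (\<lambda>\<omega>. (f i \<omega>)\<^sup>2) \<omega>)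
        \<le> (\<mu> / card I)\<^sup>2 * D * (card I * q * (h + ?m \<omega>))"
      using elim by (intro mult_left_mono) auto
    moreover have "(\<mu> / card I)\<^sup>2 * D * (card I * q * (h + ?m \<omega>)) = \<mu>\<^sup>2 * (D / card I * q * (h + ?m \<omega>))"
      using card_pos by (simp add: power_divide power2_eq_square)
    ultimately show ?case by (simp add: u_def v_def)
  qed
  have [measurable]: "u \<in> borel_measurable M" unfolding u_def by measurable
  have u_int: "integrable M (\<lambda>\<omega>. exp (u \<omega>))"
  proof (rule Bochner_Integration.integrable_bound[OF v_int])
    show "AE \<omega> in M. norm (exp (u \<omega>)) \<le> norm (exp (v \<omega>))"
      using u_v by simp
  qed measurable
  have "AE \<omega> in M. real_cond_exp M G (\<lambda>\<omega>. exp (u \<omega>)) \<omega> \<le> real_cond_exp M G (\<lambda>\<omega>. exp (v \<omega>)) \<omega>"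
    by (rule G.real_cond_exp_mono[OF u_v u_int v_int])
  with v_le show ?thesis unfolding u_def by eventually_elim linarith
qed

end

section \<open>Histories, local prediction and integrability\<close>

lemma space_history [simp]: "space (history M A N Obs t) = space M"
  by (simp add: history_def space_measure_of_conv)

lemma sets_history:
  "sets (history M A N Obs t) = sigma_sets (space M)
    {Obs \<alpha> \<tau> -` B \<inter> space M | \<alpha> \<tau> B. \<alpha> \<in> A \<and> \<tau> \<in> {1..t} \<and> B \<in> sets N}"
  unfolding history_def by (rule sets_measure_of) auto

lemma subalgebra_history:
  assumes "\<And>\<alpha> t. \<alpha> \<in> A \<Longrightarrow> 1 \<le> t \<Longrightarrow> Obs \<alpha> t \<in> M \<rightarrow>\<^sub>M N"
  shows "subalgebra M (history M A N Obs t)"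
proof -
  have "sets (history M A N Obs t) \<subseteq> sets M"
    unfolding sets_history using assms
    by (intro sets.sigma_sets_subset) (auto intro: measurable_sets)
  then show ?thesis by (simp add: subalgebra_def)
qed

lemma history_mono:
  assumes "s \<le> t"
  shows "subalgebra (history M A N Obs t) (history M A N Obs s)"
proof -
  have "sets (history M A N Obs s) \<subseteq> sets (history M A N Obs t)"
    unfolding sets_history using assms by (intro sigma_sets_mono') force
  then show ?thesis by (simp add: subalgebra_def)
qed

lemma measurable_history:
  assumes "Obs \<alpha> \<tau> \<in> M \<rightarrow>\<^sub>M N" "\<alpha> \<in> A" "1 \<le> \<tau>" "\<tau> \<le> t"
  shows "Obs \<alpha> \<tau> \<in> history M A N Obs t \<rightarrow>\<^sub>M N"
proof (rule measurableI)
  show "Obs \<alpha> \<tau> \<omega> \<in> space N" if "\<omega> \<in> space (history M A N Obs t)" for \<omega>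
    using that measurable_space[OF assms(1)] by simp
  show "Obs \<alpha> \<tau> -` B \<inter> space (history M A N Obs t) \<in> sets (history M A N Obs t)" if "B \<in> sets N" for B
    unfolding space_history sets_history using assms(2-4) that by (intro sigma_sets.Basic) auto
qed

lemma (in prob_space) sum_cond_exp_local_linear:
  assumes G: "subalgebra M G" and L: "\<And>i. i \<in> I \<Longrightarrow> subalgebra M (L i)" and I: "finite I"
    and X: "\<And>i. i \<in> I \<Longrightarrow> integrable M (X i)" "sum_cond_exp_local M G L I X"
    and Y: "\<And>i. i \<in> I \<Longrightarrow> integrable M (Y i)" "sum_cond_exp_local M G L I Y"
  shows "sum_cond_exp_local M G L I (\<lambda>i \<omega>. X i \<omega> + c * Y i \<omega>)"
proof -
  have lin: "AE \<omega> in M. real_cond_exp M H (\<lambda>\<omega>. U \<omega> + c * V \<omega>) \<omega> =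
      real_cond_exp M H U \<omega> + c * real_cond_exp M H V \<omega>"
    if H: "subalgebra M H" and U: "integrable M U" and V: "integrable M V" for H U V
  proof -
    interpret H: finite_measure_subalgebra M H by (rule finite_measure_subalgebraI[OF H])
    show ?thesis
      using H.real_cond_exp_add[OF U integrable_mult_right[OF V, of c]] H.real_cond_exp_cmult[OF V, of c]
      by auto
  qed
  have loc: "AE \<omega> in M. \<forall>i\<in>I. real_cond_exp M (L i) (\<lambda>\<omega>. X i \<omega> + c * Y i \<omega>) \<omega> =
      real_cond_exp M (L i) (X i) \<omega> + c * real_cond_exp M (L i) (Y i) \<omega>"
    by (intro AE_finite_allI I lin L X Y)
  have "(\<lambda>\<omega>. \<Sum>i\<in>I. X i \<omega> + c * Y i \<omega>) = (\<lambda>\<omega>. (\<Sum>i\<in>I. X i \<omega>) + c * (\<Sum>i\<in>I. Y i \<omega>))"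
    by (simp add: sum.distrib sum_distrib_left)
  then have glob: "AE \<omega> in M. real_cond_exp M G (\<lambda>\<omega>. \<Sum>i\<in>I. X i \<omega> + c * Y i \<omega>) \<omega> =
      real_cond_exp M G (\<lambda>\<omega>. \<Sum>i\<in>I. X i \<omega>) \<omega> + c * real_cond_exp M G (\<lambda>\<omega>. \<Sum>i\<in>I. Y i \<omega>) \<omega>"
    using X Y by (simp only:) (intro lin G Bochner_Integration.integrable_sum)
  show ?thesis
    using loc glob X(2) Y(2) unfolding sum_cond_exp_local_def
    by eventually_elim (simp add: sum.distrib sum_distrib_left)
qed

lemma (in finite_measure) square_integrable_bounded_diff:
  fixes u v :: "'a \<Rightarrow> real"
  assumes [measurable]: "u \<in> borel_measurable M" "v \<in> borel_measurable M"
    and v: "integrable M (\<lambda>\<omega>. (v \<omega>)\<^sup>2)"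
    and diff: "\<And>\<omega>. \<omega> \<in> space M \<Longrightarrow> \<bar>u \<omega> - v \<omega>\<bar> \<le> b"
  shows "integrable M u" "integrable M (\<lambda>\<omega>. (u \<omega>)\<^sup>2)" "integrable M (\<lambda>\<omega>. u \<omega> * v \<omega>)"
proof -
  have sq: "(u \<omega>)\<^sup>2 \<le> 2 * b\<^sup>2 + 2 * (v \<omega>)\<^sup>2" if "\<omega> \<in> space M" for \<omega>
  proof -
    have "0 \<le> b" using diff[OF that] by linarith
    then have "(u \<omega> - v \<omega>)\<^sup>2 \<le> b\<^sup>2" using diff[OF that] by (simp add: abs_le_square_iff[symmetric])
    moreover have "0 \<le> (u \<omega> - 2 * v \<omega>)\<^sup>2" by simp
    ultimately show ?thesis by (simp add: power2_eq_square algebra_simps)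
  qed
  show u2: "integrable M (\<lambda>\<omega>. (u \<omega>)\<^sup>2)"
  proof (rule Bochner_Integration.integrable_bound)
    show "integrable M (\<lambda>\<omega>. 2 * b\<^sup>2 + 2 * (v \<omega>)\<^sup>2)" using v by auto
    show "AE \<omega> in M. norm ((u \<omega>)\<^sup>2) \<le> norm (2 * b\<^sup>2 + 2 * (v \<omega>)\<^sup>2)"
      using sq by (intro AE_I2) simp
  qed measurable
  show "integrable M u" by (rule square_integrable_imp_integrable[OF _ u2]) measurable
  show "integrable M (\<lambda>\<omega>. u \<omega> * v \<omega>)"
  proof (rule Bochner_Integration.integrable_bound)
    show "integrable M (\<lambda>\<omega>. (u \<omega>)\<^sup>2 + (v \<omega>)\<^sup>2)" using u2 v by auto
    have "\<bar>x * y\<bar> \<le> x\<^sup>2 + y\<^sup>2" for x y :: real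
    proof -
      have "2 * \<bar>x * y\<bar> \<le> x\<^sup>2 + y\<^sup>2"
        using sum_squares_bound[of "\<bar>x\<bar>" "\<bar>y\<bar>"] by (simp add: abs_mult)
      then show ?thesis using zero_le_power2[of x] zero_le_power2[of y] by linarith
    qed
    then show "AE \<omega> in M. norm (u \<omega> * v \<omega>) \<le> norm ((u \<omega>)\<^sup>2 + (v \<omega>)\<^sup>2)"
      by (intro AE_I2) simp
  qed measurable
qed

section \<open>The oracle inequality\<close>

theorem theorem1:
  fixes M :: "'w measure"
    and A :: "'i set"
    and MO :: "'o measure" and MZ :: "'z measure"
    and Obs :: "'i \<Rightarrow> nat \<Rightarrow> 'w \<Rightarrow> 'o"
    and Summ :: "('i \<Rightarrow> 'o) \<Rightarrow> 'i \<Rightarrow> 'z"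
    and Z :: "'i \<Rightarrow> nat \<Rightarrow> 'w \<Rightarrow> 'z"
    and F :: "nat \<Rightarrow> 'w measure"
    and FZ :: "'i \<Rightarrow> nat \<Rightarrow> 'w measure" and FZbar :: "nat \<Rightarrow> 'w measure"
    and \<Theta> :: "'p measure"
    and loss :: "'p \<Rightarrow> 'o \<times> 'z \<Rightarrow> real"
    and lossbar :: "'p \<Rightarrow> nat \<Rightarrow> 'w \<Rightarrow> real"
    and J :: nat
    and \<Theta>sub :: "nat \<Rightarrow> 'p set"
    and alg :: "nat \<Rightarrow> nat \<Rightarrow> (nat \<Rightarrow> 'i \<Rightarrow> 'o) \<Rightarrow> 'p"
    and \<theta>alg :: "nat \<Rightarrow> nat \<Rightarrow> 'w \<Rightarrow> 'p"
    and Rtilde Rhat :: "nat \<Rightarrow> nat \<Rightarrow> 'w \<Rightarrow> real"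
    and Rtilde_at :: "'p \<Rightarrow> nat \<Rightarrow> 'w \<Rightarrow> real"
    and jhat jtilde :: "nat \<Rightarrow> 'w \<Rightarrow> nat"
    and \<theta>0 \<theta>star :: 'p
    and \<Delta> :: "'p \<Rightarrow> 'o \<times> 'z \<Rightarrow> real"
    and G :: "'i pair_pre_digraph"
    and b1 b2 \<beta> \<gamma> v1 v2 a :: real
    and N N' :: nat
  assumes prob: "prob_space M"
    and A: "finite A" "A \<noteq> {}"
    and Obs: "\<And>\<alpha> t. \<alpha> \<in> A \<Longrightarrow> t \<ge> 1 \<Longrightarrow> Obs \<alpha> t \<in> M \<rightarrow>\<^sub>M MO"
    and Summ: "Summ \<in> (\<Pi>\<^sub>M \<alpha>\<in>A. MO) \<rightarrow>\<^sub>M (\<Pi>\<^sub>M \<alpha>\<in>A. MZ)"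
    and Z_eq: "Z = (\<lambda>\<alpha> t \<omega>. Summ (\<lambda>\<alpha>'\<in>A. Obs \<alpha>' t \<omega>) \<alpha>)"
    and F_eq: "F = history M A MO Obs"
    and FZ_eq: "FZ = (\<lambda>\<alpha> t. adjoin (F (t - 1)) MZ (Z \<alpha> t))"
    and FZbar_eq:
      "FZbar = (\<lambda>t. adjoin (F (t - 1)) (\<Pi>\<^sub>M \<alpha>\<in>A. MZ) (\<lambda>\<omega>. \<lambda>\<alpha>\<in>A. Z \<alpha> t \<omega>))"
    and loss_measurable:
      "(\<lambda>(\<theta>, oz). loss \<theta> oz) \<in> borel_measurable (\<Theta> \<Otimes>\<^sub>M (MO \<Otimes>\<^sub>M MZ))"
    and loss_square_integrable:
      "\<And>\<theta> \<alpha> t. \<theta> \<in> space \<Theta> \<Longrightarrow> \<alpha> \<in> A \<Longrightarrow> t \<ge> 1 \<Longrightarrow>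
         integrable M (\<lambda>\<omega>. (loss \<theta> (Obs \<alpha> t \<omega>, Z \<alpha> t \<omega>))\<^sup>2)"
    and lossbar_eq:
      "lossbar = (\<lambda>\<theta> \<tau> \<omega>. 1 / card A * (\<Sum>\<alpha>\<in>A. loss \<theta> (Obs \<alpha> \<tau> \<omega>, Z \<alpha> \<tau> \<omega>)))"
    and J: "J \<ge> 1"
    and \<Theta>sub: "\<And>j. j \<in> {1..J} \<Longrightarrow> \<Theta>sub j \<subseteq> space \<Theta>"
    and alg_measurable:
      "\<And>j t. j \<in> {1..J} \<Longrightarrow> alg j t \<in> (\<Pi>\<^sub>M \<tau>\<in>{1..t}. \<Pi>\<^sub>M \<alpha>\<in>A. MO) \<rightarrow>\<^sub>M \<Theta>"
    and alg_range:
      "\<And>j t h. j \<in> {1..J} \<Longrightarrow> h \<in> space (\<Pi>\<^sub>M \<tau>\<in>{1..t}. \<Pi>\<^sub>M \<alpha>\<in>A. MO) \<Longrightarrow> alg j t h \<in> \<Theta>sub j"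
    and \<theta>alg_eq: "\<theta>alg = (\<lambda>j t \<omega>. alg j t (\<lambda>\<tau>\<in>{1..t}. \<lambda>\<alpha>\<in>A. Obs \<alpha> \<tau> \<omega>))"
    and Rtilde_eq:
      "Rtilde = (\<lambda>j t \<omega>. 1 / t * (\<Sum>\<tau>=1..t.
         real_cond_exp M (FZbar \<tau>) (\<lambda>\<omega>'. lossbar (\<theta>alg j (\<tau> - 1) \<omega>') \<tau> \<omega>') \<omega>))"
    and Rhat_eq:
      "Rhat = (\<lambda>j t \<omega>. 1 / t * (\<Sum>\<tau>=1..t. lossbar (\<theta>alg j (\<tau> - 1) \<omega>) \<tau> \<omega>))"
    and Rtilde_at_eq:
      "Rtilde_at = (\<lambda>\<theta> t \<omega>. 1 / t * (\<Sum>\<tau>=1..t.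
         real_cond_exp M (FZbar \<tau>) (lossbar \<theta> \<tau>) \<omega>))"
    and jhat_measurable: "\<And>t. t \<ge> 1 \<Longrightarrow> jhat t \<in> M \<rightarrow>\<^sub>M count_space {1..J}"
    and jhat: "\<And>t. t \<ge> 1 \<Longrightarrow>
      AE \<omega> in M. is_arg_min (\<lambda>j. Rhat j t \<omega>) (\<lambda>j. j \<in> {1..J}) (jhat t \<omega>)"
    and jtilde_measurable: "\<And>t. t \<ge> 1 \<Longrightarrow> jtilde t \<in> M \<rightarrow>\<^sub>M count_space {1..J}"
    and jtilde: "\<And>t. t \<ge> 1 \<Longrightarrow>
      AE \<omega> in M. is_arg_min (\<lambda>j. Rtilde j t \<omega>) (\<lambda>j. j \<in> {1..J}) (jtilde t \<omega>)"
    and \<theta>0: "\<theta>0 \<in> space \<Theta>"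
      "\<And>t j \<theta>. t \<ge> 1 \<Longrightarrow> j \<in> {1..J} \<Longrightarrow> \<theta> \<in> \<Theta>sub j \<Longrightarrow>
         AE \<omega> in M. Rtilde_at \<theta>0 t \<omega> \<le> Rtilde_at \<theta> t \<omega>"
    and \<Delta>_eq: "\<Delta> = (\<lambda>\<theta> oz. loss \<theta> oz - loss \<theta>0 oz)"
    and i_graph: "pair_graph G" "pverts G = A"
    and i_indep:
      "\<And>t \<alpha> A'. t \<ge> 1 \<Longrightarrow> \<alpha> \<in> A \<Longrightarrow> A' \<subseteq> A - {\<alpha>} \<Longrightarrow> (\<forall>\<alpha>'\<in>A'. (\<alpha>, \<alpha>') \<notin> parcs G) \<Longrightarrow>
         cond_indep_var M (FZbar t) MO (Obs \<alpha> t)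
           (\<Pi>\<^sub>M \<alpha>'\<in>A'. MO) (\<lambda>\<omega>. \<lambda>\<alpha>'\<in>A'. Obs \<alpha>' t \<omega>)"
    and ii_min: "\<theta>star \<in> space \<Theta>"
      "\<And>\<alpha> t \<theta>. \<alpha> \<in> A \<Longrightarrow> t \<ge> 1 \<Longrightarrow> \<theta> \<in> space \<Theta> \<Longrightarrow>
         AE \<omega> in M.
           real_cond_exp M (FZ \<alpha> t) (\<lambda>\<omega>'. loss \<theta>star (Obs \<alpha> t \<omega>', Z \<alpha> t \<omega>')) \<omega>
           \<le> real_cond_exp M (FZ \<alpha> t) (\<lambda>\<omega>'. loss \<theta> (Obs \<alpha> t \<omega>', Z \<alpha> t \<omega>')) \<omega>"
    and ii_moments:
      "\<And>\<theta> \<eta> t \<epsilon>1 \<epsilon>2.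
         \<theta> \<in> space \<Theta> \<Longrightarrow> (\<And>s. s \<ge> 1 \<Longrightarrow> \<eta> s \<in> F s \<rightarrow>\<^sub>M \<Theta>) \<Longrightarrow> t \<ge> 2 \<Longrightarrow> \<epsilon>1 + \<epsilon>2 = 2 \<Longrightarrow>
         sum_cond_exp_local M (FZbar t) (\<lambda>\<alpha>. FZ \<alpha> t) A
           (\<lambda>\<alpha> \<omega>. loss (\<eta> (t - 1) \<omega>) (Obs \<alpha> t \<omega>, Z \<alpha> t \<omega>) ^ \<epsilon>1 *
                   loss \<theta> (Obs \<alpha> t \<omega>, Z \<alpha> t \<omega>) ^ \<epsilon>2)"
    and ii_moments_initial:
      "\<And>\<theta> \<theta>' \<epsilon>1 \<epsilon>2.
         \<theta> \<in> space \<Theta> \<Longrightarrow> \<theta>' \<in> space \<Theta> \<Longrightarrow> \<epsilon>1 + \<epsilon>2 = 2 \<Longrightarrow>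
         sum_cond_exp_local M (FZbar 1) (\<lambda>\<alpha>. FZ \<alpha> 1) A
           (\<lambda>\<alpha> \<omega>. loss \<theta>' (Obs \<alpha> 1 \<omega>, Z \<alpha> 1 \<omega>) ^ \<epsilon>1 *
                   loss \<theta> (Obs \<alpha> 1 \<omega>, Z \<alpha> 1 \<omega>) ^ \<epsilon>2)"
    and ii_moments_first_order:
      "\<And>\<eta> t. t \<ge> 1 \<Longrightarrow> \<eta> \<in> F (t - 1) \<rightarrow>\<^sub>M \<Theta> \<Longrightarrow>
         sum_cond_exp_local M (FZbar t) (\<lambda>\<alpha>. FZ \<alpha> t) A
           (\<lambda>\<alpha> \<omega>. loss (\<eta> \<omega>) (Obs \<alpha> t \<omega>, Z \<alpha> t \<omega>))"
    and iii_b1: "b1 > 0"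
      "\<And>\<theta> oz. \<theta> \<in> space \<Theta> \<Longrightarrow> oz \<in> space (MO \<Otimes>\<^sub>M MZ) \<Longrightarrow> \<bar>\<Delta> \<theta> oz\<bar> \<le> b1"
    and iii_b2: "b2 \<in> {0<..2 * b1}"
      "\<And>\<alpha> t. \<alpha> \<in> A \<Longrightarrow> t \<ge> 1 \<Longrightarrow> as_for_all_params M (F (t - 1)) \<Theta> (\<lambda>\<eta> \<omega>.
         \<bar>\<Delta> (\<eta> \<omega>) (Obs \<alpha> t \<omega>, Z \<alpha> t \<omega>) -
          real_cond_exp M (FZ \<alpha> t) (\<lambda>\<omega>'. \<Delta> (\<eta> \<omega>') (Obs \<alpha> t \<omega>', Z \<alpha> t \<omega>')) \<omega>\<bar> \<le> b2)"
    and iv: "\<beta> \<in> {0<..1}" "\<gamma> > 0"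
      "\<And>\<alpha> t. \<alpha> \<in> A \<Longrightarrow> t \<ge> 1 \<Longrightarrow> as_for_all_params M (F (t - 1)) \<Theta> (\<lambda>\<eta> \<omega>.
         0 \<le> real_cond_exp M (FZ \<alpha> t) (\<lambda>\<omega>'. \<Delta> (\<eta> \<omega>') (Obs \<alpha> t \<omega>', Z \<alpha> t \<omega>')) \<omega> \<and>
         real_cond_exp M (FZ \<alpha> t) (\<lambda>\<omega>'. (\<Delta> (\<eta> \<omega>') (Obs \<alpha> t \<omega>', Z \<alpha> t \<omega>'))\<^sup>2) \<omega>
         \<le> \<gamma> * (real_cond_exp M (FZ \<alpha> t) (\<lambda>\<omega>'. \<Delta> (\<eta> \<omega>') (Obs \<alpha> t \<omega>', Z \<alpha> t \<omega>')) \<omega>) powr \<beta>)"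
    and v: "v1 > 0"
      "\<And>\<alpha> t. \<alpha> \<in> A \<Longrightarrow> t \<ge> 1 \<Longrightarrow> as_for_all_params M (F (t - 1)) \<Theta> (\<lambda>\<eta> \<omega>.
         cond_var M (FZ \<alpha> t) (\<lambda>\<omega>'. \<Delta> (\<eta> \<omega>') (Obs \<alpha> t \<omega>', Z \<alpha> t \<omega>')) \<omega> \<le> v1)"
    and v2_eq:
      "v2 = 3 * pi / 2 * ((15 * b2 / (card A / deg G))\<^sup>2 + 64 * v1 / (card A / deg G))"
    and N: "N \<ge> 2" "N' \<ge> 2" and a: "a > 0"
  shows "(\<forall>(t::nat) (x::real). t \<ge> 1 \<longrightarrow> x \<ge> a * (2 powr (- real N) * v2 / \<gamma>) powr (1 / \<beta>) \<longrightarrow>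
           measure M {\<omega> \<in> space M.
             Rtilde (jhat t \<omega>) t \<omega> - Rtilde_at \<theta>0 t \<omega>
             \<ge> (1 + 2 * a) * (Rtilde (jtilde t \<omega>) t \<omega> - Rtilde_at \<theta>0 t \<omega>) + x}
           \<le> 2 * J * N *
             (exp (- (t * x powr (2 - \<beta>) / (2 powr (5 - \<beta>) * (1 + a)\<^sup>2 * \<gamma> / a powr \<beta>))) +
              exp (- (t * x / (8 * (1 + a) * b2 / 3))))) \<and>
         (\<forall>(t::nat) (x::real). t \<ge> 1 \<longrightarrow> x \<ge> a * b1 * 2 powr (- real N') \<longrightarrow>
           measure M {\<omega> \<in> space M.
             Rtilde (jhat t \<omega>) t \<omega> - Rtilde_at \<theta>0 t \<omega>
             \<ge> (1 + 2 * a) * (Rtilde (jtilde t \<omega>) t \<omega> - Rtilde_at \<theta>0 t \<omega>) + x}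
           \<le> 2 * (exp 1)\<^sup>2 * J * N' *
             (exp (- (card A / (t powr \<beta> * deg G) * x powr (2 - \<beta>) /
                      (2 powr (6 + 2 * \<beta>) * (exp 1)\<^sup>2 * (1 + a)\<^sup>2 * \<gamma> / a powr \<beta>))) +
              exp (- (card A / deg G * x / (60 * exp 1 * (1 + a) * b2)))))"
proof -
  interpret prob_space M by (rule prob)
  let ?Zbar = "\<lambda>t \<omega>. \<lambda>\<alpha>\<in>A. Z \<alpha> t \<omega>"
  have card_A: "0 < card A" using A by (simp add: card_gt_0_iff)
  have deg_pos: "0 < deg G" by (simp add: deg_def)

  have subF: "subalgebra M (F t)" for t
    unfolding F_eq by (rule subalgebra_history[OF Obs])
  have spF: "space (F t) = space M" for t
    by (simp add: F_eq)
  have Obs_F: "Obs \<alpha> \<tau> \<in> F t \<rightarrow>\<^sub>M MO" if "\<alpha> \<in> A" "1 \<le> \<tau>" "\<tau> \<le> t" for \<alpha> \<tau> t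
    unfolding F_eq by (rule measurable_history[OF Obs]) (use that in auto)
  have Z_from_Obs: "Z \<alpha> t \<in> N \<rightarrow>\<^sub>M MZ" if \<alpha>: "\<alpha> \<in> A" and O: "\<And>\<alpha>. \<alpha> \<in> A \<Longrightarrow> Obs \<alpha> t \<in> N \<rightarrow>\<^sub>M MO" for \<alpha> t N
  proof -
    have "(\<lambda>\<omega>. Summ (\<lambda>\<alpha>'\<in>A. Obs \<alpha>' t \<omega>)) \<in> N \<rightarrow>\<^sub>M (\<Pi>\<^sub>M \<alpha>\<in>A. MZ)"
      by (rule measurable_compose[OF measurable_restrict[OF O] Summ])
    then show ?thesis
      unfolding Z_eq by (rule measurable_compose[OF _ measurable_component_singleton[OF \<alpha>]])
  qed
  have Z_M: "Z \<alpha> t \<in> M \<rightarrow>\<^sub>M MZ" if "\<alpha> \<in> A" "1 \<le> t" for \<alpha> t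
    using that Obs by (intro Z_from_Obs) auto
  have Z_F: "Z \<alpha> t \<in> F t \<rightarrow>\<^sub>M MZ" if "\<alpha> \<in> A" "1 \<le> t" for \<alpha> t
    using that Obs_F by (intro Z_from_Obs) auto
  have subFZbar: "subalgebra M (FZbar t)" if "1 \<le> t" for t
    unfolding FZbar_eq using Z_M that
    by (intro subalgebra_adjoin_least[OF subF] measurable_restrict) auto
  have F_FZbar: "subalgebra (FZbar t) (F (t - 1))" for t
    unfolding FZbar_eq by (rule subalgebra_adjoin)
  have FZbar_F: "subalgebra (F t) (FZbar t)" if "1 \<le> t" for t
  proof -
    have "subalgebra (F t) (F (t - 1))" unfolding F_eq by (rule history_mono) simp
    then show ?thesis
      unfolding FZbar_eq using Z_F that
      by (intro subalgebra_adjoin_least measurable_restrict) auto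
  qed
  have F_past: "subalgebra (FZbar t) (F s)" if "s < t" for s t
  proof -
    have "subalgebra (F (t - 1)) (F s)" unfolding F_eq by (rule history_mono) (use that in simp)
    with F_FZbar show ?thesis by (rule subalgebra_trans)
  qed
  have FZ_FZbar: "subalgebra (FZbar t) (FZ \<alpha> t)" if "\<alpha> \<in> A" "1 \<le> t" for \<alpha> t
    unfolding FZbar_eq FZ_eq
    by (rule subalgebra_adjoin_component[OF Z_M _ subF]) (use that in auto)
  have Z_FZbar: "Z \<alpha> t \<in> FZbar t \<rightarrow>\<^sub>M MZ" if "\<alpha> \<in> A" "1 \<le> t" for \<alpha> t
  proof -
    have "Z \<alpha> t \<in> FZ \<alpha> t \<rightarrow>\<^sub>M MZ"
      unfolding FZ_eq using measurable_space[OF Z_M[OF that]] by (intro measurable_adjoin) (auto simp: spF)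
    then show ?thesis using FZ_FZbar[OF that] by (rule measurable_subalgebra)
  qed
  have loss_comp: "(\<lambda>\<omega>. loss (\<eta> \<omega>) (Obs \<alpha> t \<omega>, Z \<alpha> t \<omega>)) \<in> borel_measurable N"
    if "\<eta> \<in> N \<rightarrow>\<^sub>M \<Theta>" "Obs \<alpha> t \<in> N \<rightarrow>\<^sub>M MO" "Z \<alpha> t \<in> N \<rightarrow>\<^sub>M MZ" for \<eta> \<alpha> t N
    using measurable_compose[OF measurable_Pair[OF that(1) measurable_Pair[OF that(2,3)]] loss_measurable]
    by simp
  have \<Delta>_comp: "(\<lambda>\<omega>. \<Delta> (\<eta> \<omega>) (Obs \<alpha> t \<omega>, Z \<alpha> t \<omega>)) \<in> borel_measurable N"
    if "\<eta> \<in> N \<rightarrow>\<^sub>M \<Theta>" "Obs \<alpha> t \<in> N \<rightarrow>\<^sub>M MO" "Z \<alpha> t \<in> N \<rightarrow>\<^sub>M MZ" for \<eta> \<alpha> t N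
    unfolding \<Delta>_eq using that \<theta>0(1)
    by (intro borel_measurable_diff loss_comp[of \<eta>] loss_comp[of "\<lambda>_. \<theta>0"]) auto

  have \<theta>alg_F: "\<theta>alg j t \<in> F t \<rightarrow>\<^sub>M \<Theta>" if j: "j \<in> {1..J}" for j t
  proof -
    have "(\<lambda>\<omega>. \<lambda>\<tau>\<in>{1..t}. \<lambda>\<alpha>\<in>A. Obs \<alpha> \<tau> \<omega>) \<in> F t \<rightarrow>\<^sub>M (\<Pi>\<^sub>M \<tau>\<in>{1..t}. \<Pi>\<^sub>M \<alpha>\<in>A. MO)"
      by (intro measurable_restrict Obs_F) auto
    then show ?thesis unfolding \<theta>alg_eq by (rule measurable_compose[OF _ alg_measurable[OF j]])
  qed
  have \<theta>alg_0: "\<theta>alg j 0 = (\<lambda>\<omega>. alg j 0 (\<lambda>_. undefined))" for j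
    unfolding \<theta>alg_eq by (intro ext arg_cong[where f = "alg j 0"]) auto

  have L0_sq_int: "integrable M (\<lambda>\<omega>. (loss \<theta>0 (Obs \<alpha> t \<omega>, Z \<alpha> t \<omega>))\<^sup>2)" if "\<alpha> \<in> A" "1 \<le> t" for \<alpha> t
    by (rule loss_square_integrable[OF \<theta>0(1) that])
  have L0_M: "(\<lambda>\<omega>. loss \<theta>0 (Obs \<alpha> t \<omega>, Z \<alpha> t \<omega>)) \<in> borel_measurable M" if "\<alpha> \<in> A" "1 \<le> t" for \<alpha> t
    using that \<theta>0(1) Obs Z_M by (intro loss_comp[of "\<lambda>_. \<theta>0"]) auto
  have L0_int: "integrable M (\<lambda>\<omega>. loss \<theta>0 (Obs \<alpha> t \<omega>, Z \<alpha> t \<omega>))" if "\<alpha> \<in> A" "1 \<le> t" for \<alpha> t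
    by (rule square_integrable_imp_integrable[OF L0_M[OF that] L0_sq_int[OF that]])
  have \<Delta>_bound: "\<bar>\<Delta> (\<eta> \<omega>) (Obs \<alpha> t \<omega>, Z \<alpha> t \<omega>)\<bar> \<le> b1"
    if "\<eta> \<in> M \<rightarrow>\<^sub>M \<Theta>" "\<alpha> \<in> A" "1 \<le> t" "\<omega> \<in> space M" for \<eta> \<alpha> t \<omega>
    using that by (intro iii_b1(2))
      (auto simp: space_pair_measure dest: measurable_space[OF Obs] measurable_space[OF Z_M] measurable_space)
  have L_int: "integrable M (\<lambda>\<omega>. loss (\<eta> \<omega>) (Obs \<alpha> t \<omega>, Z \<alpha> t \<omega>))"
    and L_sq_int: "integrable M (\<lambda>\<omega>. (loss (\<eta> \<omega>) (Obs \<alpha> t \<omega>, Z \<alpha> t \<omega>))\<^sup>2)"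
    and LL0_int: "integrable M (\<lambda>\<omega>. loss (\<eta> \<omega>) (Obs \<alpha> t \<omega>, Z \<alpha> t \<omega>) * loss \<theta>0 (Obs \<alpha> t \<omega>, Z \<alpha> t \<omega>))"
    if \<eta>: "\<eta> \<in> M \<rightarrow>\<^sub>M \<Theta>" and \<alpha>: "\<alpha> \<in> A" and t: "1 \<le> t" for \<eta> \<alpha> t
  proof -
    let ?L = "\<lambda>\<omega>. loss (\<eta> \<omega>) (Obs \<alpha> t \<omega>, Z \<alpha> t \<omega>)" and ?ref = "\<lambda>\<omega>. loss \<theta>0 (Obs \<alpha> t \<omega>, Z \<alpha> t \<omega>)"
    have L_M: "?L \<in> borel_measurable M"
      by (rule loss_comp[OF \<eta> Obs[OF \<alpha> t] Z_M[OF \<alpha> t]])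
    have diff: "\<bar>?L \<omega> - ?ref \<omega>\<bar> \<le> b1" if "\<omega> \<in> space M" for \<omega>
      using \<Delta>_bound[OF \<eta> \<alpha> t that] by (simp add: \<Delta>_eq)
    note ints = square_integrable_bounded_diff[OF L_M L0_M[OF \<alpha> t] L0_sq_int[OF \<alpha> t] diff]
    show "integrable M ?L" by (rule ints)
    show "integrable M (\<lambda>\<omega>. (?L \<omega>)\<^sup>2)" by (rule ints)
    show "integrable M (\<lambda>\<omega>. ?L \<omega> * ?ref \<omega>)" by (rule ints)
  qed

  \<comment> \<open>Second moments at time \<open>1\<close> are only known to be local for fixed parameters. As the history is then
    empty, an algorithm is still at a constant, which \<open>initial\<close> records.\<close>
  have step: "bernstein_step M (FZbar t) (\<lambda>\<alpha>. FZ \<alpha> t) A (\<lambda>\<alpha> \<omega>. \<Delta> (\<eta> \<omega>) (Obs \<alpha> t \<omega>, Z \<alpha> t \<omega>)) b1 b2 \<beta> \<gamma> h"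
    if t: "1 \<le> t" and \<eta>: "\<eta> \<in> F (t - 1) \<rightarrow>\<^sub>M \<Theta>" and initial: "t = 1 \<Longrightarrow> \<exists>\<theta>\<in>space \<Theta>. \<eta> = (\<lambda>_. \<theta>)" and h: "0 < h"
    for t \<eta> h
  proof -
    let ?L = "\<lambda>\<alpha> \<omega>. loss (\<eta> \<omega>) (Obs \<alpha> t \<omega>, Z \<alpha> t \<omega>)" and ?ref = "\<lambda>\<alpha> \<omega>. loss \<theta>0 (Obs \<alpha> t \<omega>, Z \<alpha> t \<omega>)"
    let ?local = "sum_cond_exp_local M (FZbar t) (\<lambda>\<alpha>. FZ \<alpha> t) A"
    have \<eta>_M: "\<eta> \<in> M \<rightarrow>\<^sub>M \<Theta>" using \<eta> subF by (rule measurable_subalgebra)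
    have subFZ: "subalgebra M (FZ \<alpha> t)" if "\<alpha> \<in> A" for \<alpha>
      by (rule subalgebra_trans[OF subFZbar[OF t] FZ_FZbar[OF that t]])
    note lin = sum_cond_exp_local_linear[OF subFZbar[OF t] subFZ A(1)]
    have second: "?local (\<lambda>\<alpha> \<omega>. ?L \<alpha> \<omega> ^ \<epsilon>1 * ?ref \<alpha> \<omega> ^ \<epsilon>2)" if \<epsilon>: "\<epsilon>1 + \<epsilon>2 = 2" for \<epsilon>1 \<epsilon>2
    proof (cases "t = 1")
      case True
      then obtain \<theta> where \<theta>: "\<theta> \<in> space \<Theta>" "\<eta> = (\<lambda>_. \<theta>)" using initial by blast
      show ?thesis using ii_moments_initial[OF \<theta>0(1) \<theta>(1) \<epsilon>] unfolding \<theta>(2) True .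
    next
      case False
      then have t2: "2 \<le> t" using t by simp
      have "(\<lambda>s. if s = t - 1 then \<eta> else (\<lambda>_. \<theta>0)) s \<in> F s \<rightarrow>\<^sub>M \<Theta>" for s
        using \<eta> \<theta>0(1) by simp
      from ii_moments[OF \<theta>0(1) this t2 \<epsilon>] show ?thesis by simp
    qed
    \<comment> \<open>Locality is given for the losses and their products; the excess loss and its
      square are linear combinations of these.\<close>
    have "?local (\<lambda>\<alpha> \<omega>. ?L \<alpha> \<omega> + (- 1) * ?ref \<alpha> \<omega>)"
    proof (rule lin)
      show "?local ?L" by (rule ii_moments_first_order[OF t \<eta>])
      show "?local ?ref" using \<theta>0(1) by (intro ii_moments_first_order[OF t, of "\<lambda>_. \<theta>0"]) simp
    qed (use L_int[OF \<eta>_M _ t] L0_int[OF _ t] in auto)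
    then have first: "?local (\<lambda>\<alpha> \<omega>. \<Delta> (\<eta> \<omega>) (Obs \<alpha> t \<omega>, Z \<alpha> t \<omega>))" by (simp add: \<Delta>_eq)
    have cross: "?local (\<lambda>\<alpha> \<omega>. (?L \<alpha> \<omega>)\<^sup>2 + (- 2) * (?L \<alpha> \<omega> * ?ref \<alpha> \<omega>))"
    proof (rule lin)
      show "?local (\<lambda>\<alpha> \<omega>. (?L \<alpha> \<omega>)\<^sup>2)" using second[of 2 0] by simp
      show "?local (\<lambda>\<alpha> \<omega>. ?L \<alpha> \<omega> * ?ref \<alpha> \<omega>)" using second[of 1 1] by simp
    qed (use L_sq_int[OF \<eta>_M _ t] LL0_int[OF \<eta>_M _ t] in auto)
    have "?local (\<lambda>\<alpha> \<omega>. ((?L \<alpha> \<omega>)\<^sup>2 + (- 2) * (?L \<alpha> \<omega> * ?ref \<alpha> \<omega>)) + 1 * (?ref \<alpha> \<omega>)\<^sup>2)"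
    proof (rule lin)
      show "?local (\<lambda>\<alpha> \<omega>. (?ref \<alpha> \<omega>)\<^sup>2)" using second[of 0 2] by simp
    qed (use cross L_sq_int[OF \<eta>_M _ t] LL0_int[OF \<eta>_M _ t] L0_sq_int[OF _ t] in auto)
    moreover have "((?L \<alpha> \<omega>)\<^sup>2 + (- 2) * (?L \<alpha> \<omega> * ?ref \<alpha> \<omega>)) + 1 * (?ref \<alpha> \<omega>)\<^sup>2 =
        (\<Delta> (\<eta> \<omega>) (Obs \<alpha> t \<omega>, Z \<alpha> t \<omega>))\<^sup>2" for \<alpha> \<omega>
      by (simp add: \<Delta>_eq power2_diff)
    ultimately have sq: "?local (\<lambda>\<alpha> \<omega>. (\<Delta> (\<eta> \<omega>) (Obs \<alpha> t \<omega>, Z \<alpha> t \<omega>))\<^sup>2)" by (simp only:)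
    show ?thesis
    proof unfold_locales
      fix \<alpha> assume \<alpha>: "\<alpha> \<in> A"
      show "(\<lambda>\<omega>. \<Delta> (\<eta> \<omega>) (Obs \<alpha> t \<omega>, Z \<alpha> t \<omega>)) \<in> borel_measurable M"
        by (rule \<Delta>_comp[OF \<eta>_M Obs[OF \<alpha> t] Z_M[OF \<alpha> t]])
      show "AE \<omega> in M. \<bar>\<Delta> (\<eta> \<omega>) (Obs \<alpha> t \<omega>, Z \<alpha> t \<omega>)\<bar> \<le> b1"
        by (rule AE_I2) (rule \<Delta>_bound[OF \<eta>_M \<alpha> t])
      show "AE \<omega> in M. \<bar>\<Delta> (\<eta> \<omega>) (Obs \<alpha> t \<omega>, Z \<alpha> t \<omega>) -
          real_cond_exp M (FZ \<alpha> t) (\<lambda>\<omega>. \<Delta> (\<eta> \<omega>) (Obs \<alpha> t \<omega>, Z \<alpha> t \<omega>)) \<omega>\<bar> \<le> b2"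
        using iii_b2(2)[OF \<alpha> t] \<eta> unfolding as_for_all_params_def by blast
      show "AE \<omega> in M. 0 \<le> real_cond_exp M (FZ \<alpha> t) (\<lambda>\<omega>. \<Delta> (\<eta> \<omega>) (Obs \<alpha> t \<omega>, Z \<alpha> t \<omega>)) \<omega> \<and>
          real_cond_exp M (FZ \<alpha> t) (\<lambda>\<omega>. (\<Delta> (\<eta> \<omega>) (Obs \<alpha> t \<omega>, Z \<alpha> t \<omega>))\<^sup>2) \<omega> \<le>
          \<gamma> * real_cond_exp M (FZ \<alpha> t) (\<lambda>\<omega>. \<Delta> (\<eta> \<omega>) (Obs \<alpha> t \<omega>, Z \<alpha> t \<omega>)) \<omega> powr \<beta>"
        using iv(3)[OF \<alpha> t] \<eta> unfolding as_for_all_params_def by blast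
    qed (use A subFZbar[OF t] FZ_FZbar[OF _ t] first sq iv(1,2) h in auto)
  qed

  define e where "e j \<tau> \<omega> = 1 / card A * (\<Sum>\<alpha>\<in>A. \<Delta> (\<theta>alg j (\<tau> - 1) \<omega>) (Obs \<alpha> \<tau> \<omega>, Z \<alpha> \<tau> \<omega>))"
    for j \<tau> \<omega>
  define m where "m j \<tau> = real_cond_exp M (FZbar \<tau>) (e j \<tau>)" for j \<tau>
  let ?f = "\<lambda>j \<tau> \<alpha> \<omega>. \<Delta> (\<theta>alg j (\<tau> - 1) \<omega>) (Obs \<alpha> \<tau> \<omega>, Z \<alpha> \<tau> \<omega>)"
  have alg_step: "bernstein_step M (FZbar \<tau>) (\<lambda>\<alpha>. FZ \<alpha> \<tau>) A (?f j \<tau>) b1 b2 \<beta> \<gamma> h"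
    if j: "j \<in> {1..J}" and \<tau>: "1 \<le> \<tau>" and h: "0 < h" for j \<tau> h
  proof (rule step[OF \<tau> \<theta>alg_F[OF j] _ h])
    assume "\<tau> = 1"
    moreover have "alg j 0 (\<lambda>_. undefined) \<in> space \<Theta>"
      using not_empty measurable_space[OF \<theta>alg_F[OF j, of 0]] by (auto simp: \<theta>alg_0 spF)
    ultimately show "\<exists>\<theta>\<in>space \<Theta>. \<theta>alg j (\<tau> - 1) = (\<lambda>_. \<theta>)" by (auto simp: \<theta>alg_0)
  qed
  have avg_e: "bernstein_step.avg A (?f j \<tau>) = e j \<tau>" if "j \<in> {1..J}" "1 \<le> \<tau>" for j \<tau>
  proof -
    interpret bernstein_step M "FZbar \<tau>" "\<lambda>\<alpha>. FZ \<alpha> \<tau>" A "?f j \<tau>" b1 b2 \<beta> \<gamma> 1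
      by (rule alg_step[OF that]) simp
    show ?thesis by (rule ext) (simp only: avg_def e_def)
  qed
  have e_F: "e j \<tau> \<in> borel_measurable (F \<tau>)" if j: "j \<in> {1..J}" and \<tau>: "1 \<le> \<tau>" for j \<tau>
  proof -
    have "\<theta>alg j (\<tau> - 1) \<in> F \<tau> \<rightarrow>\<^sub>M \<Theta>"
      by (rule measurable_subalgebra[OF \<theta>alg_F[OF j] subalgebra_trans[OF FZbar_F[OF \<tau>] F_FZbar]])
    then show ?thesis
      unfolding e_def using \<tau> Obs_F Z_F
      by (intro borel_measurable_times borel_measurable_sum \<Delta>_comp borel_measurable_const) auto
  qed
  have e_M: "e j \<tau> \<in> borel_measurable M" if "j \<in> {1..J}" "1 \<le> \<tau>" for j \<tau>
    by (rule measurable_subalgebra[OF e_F[OF that] subF])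
  have e_past: "e j \<sigma> \<in> borel_measurable (FZbar \<tau>)" if "j \<in> {1..J}" "1 \<le> \<sigma>" "\<sigma> < \<tau>" for j \<sigma> \<tau>
    by (rule measurable_subalgebra[OF e_F[OF that(1,2)] F_past[OF that(3)]])
  have m_past: "m j \<sigma> \<in> borel_measurable (FZbar \<tau>)" if "1 \<le> \<sigma>" "\<sigma> \<le> \<tau>" for j \<sigma> \<tau>
  proof (cases "\<sigma> = \<tau>")
    case True
    then show ?thesis by (simp add: m_def)
  next
    case False
    then have "subalgebra (FZbar \<tau>) (FZbar \<sigma>)"
      using that by (intro subalgebra_trans[OF F_past FZbar_F, of \<sigma>]) auto
    then show ?thesis unfolding m_def by (rule measurable_subalgebra[rotated]) simp
  qed
  have m_nonneg: "AE \<omega> in M. 0 \<le> m j \<tau> \<omega>"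
    and e_bound: "AE \<omega> in M. \<bar>e j \<tau> \<omega> - m j \<tau> \<omega>\<bar> \<le> b2" if "j \<in> {1..J}" "1 \<le> \<tau>" for j \<tau>
  proof -
    interpret bernstein_step M "FZbar \<tau>" "\<lambda>\<alpha>. FZ \<alpha> \<tau>" A "?f j \<tau>" b1 b2 \<beta> \<gamma> 1
      by (rule alg_step[OF that]) simp
    show "AE \<omega> in M. 0 \<le> m j \<tau> \<omega>" using mean_nonneg by (simp only: m_def avg_e[OF that])
    show "AE \<omega> in M. \<bar>e j \<tau> \<omega> - m j \<tau> \<omega>\<bar> \<le> b2" using avg_deviation by (simp only: m_def avg_e[OF that])
  qed

  obtain col :: "'i \<Rightarrow> nat" where col: "\<And>v. v \<in> A \<Longrightarrow> col v < deg G"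
    "\<And>v w. (v, w) \<in> parcs G \<Longrightarrow> col v \<noteq> col w"
    using pair_graph_colouring[OF i_graph(1)] i_graph(2) by blast
  have moment: "AE \<omega> in M. real_cond_exp M (FZbar \<tau>) (\<lambda>\<omega>. exp (\<mu> * (e j \<tau> \<omega> - m j \<tau> \<omega>)
      - \<mu>\<^sup>2 * (\<gamma> * h powr (\<beta> - 1) * (h + m j \<tau> \<omega>)))) \<omega> \<le> 1"
    if "j \<in> {1..J}" "1 \<le> \<tau>" "0 < h" and \<mu>: "\<bar>\<mu>\<bar> * b2 \<le> 3 / 2" for j \<tau> h \<mu>
  proof -
    interpret bernstein_step M "FZbar \<tau>" "\<lambda>\<alpha>. FZ \<alpha> \<tau>" A "?f j \<tau>" b1 b2 \<beta> \<gamma> h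
      by (rule alg_step[OF that(1-3)])
    show ?thesis using avg_moment[OF \<mu>] by (simp only: m_def avg_e[OF that(1,2)] q_def)
  qed
  have moment_graph: "AE \<omega> in M. real_cond_exp M (FZbar \<tau>) (\<lambda>\<omega>. exp (\<mu> * (e j \<tau> \<omega> - m j \<tau> \<omega>)
      - \<mu>\<^sup>2 * (deg G / card A * (\<gamma> * h powr (\<beta> - 1)) * (h + m j \<tau> \<omega>)))) \<omega> \<le> 1"
    if j: "j \<in> {1..J}" and \<tau>: "1 \<le> \<tau>" and h: "0 < h" and \<mu>: "\<bar>\<mu>\<bar> * (2 * b2) * (deg G / card A) \<le> 3 / 2"
    for j \<tau> h \<mu>
  proof -
    interpret bernstein_step M "FZbar \<tau>" "\<lambda>\<alpha>. FZ \<alpha> \<tau>" A "?f j \<tau>" b1 b2 \<beta> \<gamma> h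
      by (rule alg_step[OF j \<tau> h])
    have "AE \<omega> in M. real_cond_exp M (FZbar \<tau>) (\<lambda>\<omega>. exp (\<mu> * (avg \<omega> - real_cond_exp M (FZbar \<tau>) avg \<omega>)
        - \<mu>\<^sup>2 * (deg G / card A * q * (h + real_cond_exp M (FZbar \<tau>) avg \<omega>)))) \<omega> \<le> 1"
    proof (rule avg_moment_coloured[where X = "\<lambda>\<alpha>. Obs \<alpha> \<tau>" and N = MO, OF _ _ col(1) deg_pos _ \<mu>])
      fix \<alpha> assume \<alpha>: "\<alpha> \<in> A"
      let ?K = "adjoin (FZbar \<tau>) MO (Obs \<alpha> \<tau>)"
      have sub: "subalgebra ?K (FZbar \<tau>)" by (rule subalgebra_adjoin)
      show O: "Obs \<alpha> \<tau> \<in> M \<rightarrow>\<^sub>M MO" by (rule Obs[OF \<alpha> \<tau>])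
      have sp: "space (FZbar \<tau>) = space M" using subFZbar[OF \<tau>] by (simp add: subalgebra_def)
      show "?f j \<tau> \<alpha> \<in> borel_measurable ?K"
      proof (rule \<Delta>_comp)
        show "\<theta>alg j (\<tau> - 1) \<in> ?K \<rightarrow>\<^sub>M \<Theta>"
          by (rule measurable_subalgebra[OF \<theta>alg_F[OF j] subalgebra_trans[OF sub F_FZbar]])
        show "Obs \<alpha> \<tau> \<in> ?K \<rightarrow>\<^sub>M MO"
          using measurable_space[OF O] by (intro measurable_adjoin) (auto simp: sp)
        show "Z \<alpha> \<tau> \<in> ?K \<rightarrow>\<^sub>M MZ" by (rule measurable_subalgebra[OF Z_FZbar[OF \<alpha> \<tau>] sub])
      qed
    next
      fix \<alpha> A' assume *: "\<alpha> \<in> A" "A' \<subseteq> A - {\<alpha>}" "\<forall>k\<in>A'. col k = col \<alpha>"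
      then have "\<forall>\<alpha>'\<in>A'. (\<alpha>, \<alpha>') \<notin> parcs G" using col(2) by force
      with * show "cond_indep_var M (FZbar \<tau>) MO (Obs \<alpha> \<tau>) (\<Pi>\<^sub>M i\<in>A'. MO) (\<lambda>\<omega>. \<lambda>i\<in>A'. Obs i \<tau> \<omega>)"
        using \<tau> by (intro i_indep) auto
    qed
    then show ?thesis by (simp only: m_def avg_e[OF j \<tau>] q_def)
  qed

  have risk: "AE \<omega> in M. \<forall>j\<in>{1..J}. Rtilde j t \<omega> - Rtilde_at \<theta>0 t \<omega> = 1 / t * (\<Sum>\<tau>=1..t. m j \<tau> \<omega>)" for t :: nat
  proof (rule AE_finite_allI)
    fix j assume j: "j \<in> {1..J}"
    have diff: "AE \<omega> in M. m j \<tau> \<omega> = real_cond_exp M (FZbar \<tau>) (\<lambda>\<omega>'. lossbar (\<theta>alg j (\<tau> - 1) \<omega>') \<tau> \<omega>') \<omega>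
        - real_cond_exp M (FZbar \<tau>) (lossbar \<theta>0 \<tau>) \<omega>" if \<tau>: "\<tau> \<in> {1..t}" for \<tau>
    proof -
      have \<tau>1: "1 \<le> \<tau>" using \<tau> by simp
      interpret S: finite_measure_subalgebra M "FZbar \<tau>"
        by (rule finite_measure_subalgebraI[OF subFZbar[OF \<tau>1]])
      have "e j \<tau> = (\<lambda>\<omega>. lossbar (\<theta>alg j (\<tau> - 1) \<omega>) \<tau> \<omega> - lossbar \<theta>0 \<tau> \<omega>)"
        by (rule ext) (simp add: e_def \<Delta>_eq lossbar_eq sum_subtractf diff_divide_distrib)
      moreover have "integrable M (\<lambda>\<omega>. lossbar (\<theta>alg j (\<tau> - 1) \<omega>) \<tau> \<omega>)" "integrable M (lossbar \<theta>0 \<tau>)"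
        unfolding lossbar_eq
        by (intro integrable_mult_right Bochner_Integration.integrable_sum L_int L0_int
            measurable_subalgebra[OF \<theta>alg_F[OF j] subF] \<tau>1; assumption)+
      ultimately show ?thesis unfolding m_def by (simp only:) (rule S.real_cond_exp_diff)
    qed
    have "AE \<omega> in M. \<forall>\<tau>\<in>{1..t}. m j \<tau> \<omega> =
        real_cond_exp M (FZbar \<tau>) (\<lambda>\<omega>'. lossbar (\<theta>alg j (\<tau> - 1) \<omega>') \<tau> \<omega>') \<omega>
        - real_cond_exp M (FZbar \<tau>) (lossbar \<theta>0 \<tau>) \<omega>"
      by (intro AE_finite_allI diff) auto
    then show "AE \<omega> in M. Rtilde j t \<omega> - Rtilde_at \<theta>0 t \<omega> = 1 / t * (\<Sum>\<tau>=1..t. m j \<tau> \<omega>)"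
      by eventually_elim (simp add: Rtilde_eq Rtilde_at_eq sum_subtractf diff_divide_distrib)
  qed simp
  have jAE: "AE \<omega> in M. jhat t \<omega> \<in> {1..J} \<and> jtilde t \<omega> \<in> {1..J} \<and>
      (\<Sum>\<tau>=1..t. e (jhat t \<omega>) \<tau> \<omega>) \<le> (\<Sum>\<tau>=1..t. e (jtilde t \<omega>) \<tau> \<omega>)" if t: "1 \<le> t" for t :: nat
    using jhat[OF t] jtilde[OF t]
  proof eventually_elim
    case (elim \<omega>)
    then have mem: "jhat t \<omega> \<in> {1..J}" "jtilde t \<omega> \<in> {1..J}" by (auto simp: is_arg_min_def)
    have Rhat_e: "Rhat j t \<omega> = 1 / t * (\<Sum>\<tau>=1..t. e j \<tau> \<omega>) + 1 / t * (\<Sum>\<tau>=1..t. lossbar \<theta>0 \<tau> \<omega>)" for j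
    proof -
      have "e j \<tau> \<omega> = lossbar (\<theta>alg j (\<tau> - 1) \<omega>) \<tau> \<omega> - lossbar \<theta>0 \<tau> \<omega>" for \<tau>
        by (simp add: e_def \<Delta>_eq lossbar_eq sum_subtractf diff_divide_distrib)
      then show ?thesis by (simp add: Rhat_eq sum_subtractf diff_divide_distrib)
    qed
    have "Rhat (jhat t \<omega>) t \<omega> \<le> Rhat (jtilde t \<omega>) t \<omega>"
      using elim(1) mem(2) by (auto simp: is_arg_min_def not_less)
    then show ?case using mem t by (simp add: Rhat_e divide_le_cancel)
  qed

  define S where "S t x = {\<omega> \<in> space M. Rtilde (jhat t \<omega>) t \<omega> - Rtilde_at \<theta>0 t \<omega>
    \<ge> (1 + 2 * a) * (Rtilde (jtilde t \<omega>) t \<omega> - Rtilde_at \<theta>0 t \<omega>) + x}" for t :: nat and x :: real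
  \<comment> \<open>Both bounds follow from this one: without the graph the variance factor is \<open>K = 1\<close> and the
    range of \<open>\<mu>\<close> is \<open>3 / (2 * b2)\<close>, with the graph \<open>K\<close> is \<open>deg G / card A\<close> and the range is multiplied by
    half the inverse of \<open>K\<close>. The two exponentials answer to the two terms in the minimum that
    defines \<open>\<kappa>\<close>.\<close>
  have tail: "measure M (S t x) \<le> 2 * real J * (exp (- (t * x powr (2 - \<beta>) * a powr \<beta> / (16 * (1 + a)\<^sup>2 * \<gamma> * K))) +
      exp (- (\<Lambda> * t * x / (4 * (1 + a)))))"
    if t: "1 \<le> t" and x: "0 < x" and K: "0 < K" and \<Lambda>: "0 < \<Lambda>"
      and mom: "\<And>j \<tau> h \<mu>. j \<in> {1..J} \<Longrightarrow> 1 \<le> \<tau> \<Longrightarrow> 0 < h \<Longrightarrow> \<bar>\<mu>\<bar> \<le> \<Lambda> \<Longrightarrow>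
        AE \<omega> in M. real_cond_exp M (FZbar \<tau>) (\<lambda>\<omega>. exp (\<mu> * (e j \<tau> \<omega> - m j \<tau> \<omega>)
          - \<mu>\<^sup>2 * (K * (\<gamma> * h powr (\<beta> - 1)) * (h + m j \<tau> \<omega>)))) \<omega> \<le> 1"
    for t :: nat and x K \<Lambda> :: real
  proof -
    \<comment> \<open>With this choice the affine bound \<open>h + m\<close> on the variance is proportional to \<open>x + a * m\<close>, the
      combination that a deviation has to exceed.\<close>
    define h where "h = x / a"
    define V where "V = K * (\<gamma> * h powr (\<beta> - 1)) / a"
    define \<kappa> where "\<kappa> = min \<Lambda> (1 / (4 * (1 + a) * V))"
    have h: "0 < h" using x a by (simp add: h_def)
    have V: "0 < V" using K iv(2) h a by (simp add: V_def)
    have \<kappa>: "0 < \<kappa>" using \<Lambda> V a by (simp add: \<kappa>_def)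
    have \<kappa>V: "\<kappa> * V \<le> 1 / (4 * (1 + a))"
    proof -
      have "\<kappa> * V \<le> 1 / (4 * (1 + a) * V) * V"
        using V by (intro mult_right_mono) (auto simp: \<kappa>_def)
      also have "\<dots> = 1 / (4 * (1 + a))" using V by simp
      finally show ?thesis .
    qed
    have "measure M (S t x) \<le> 2 * real J * exp (- (\<kappa> * t * x / (4 * (1 + a))))"
    proof (rule oracle_deviation[where G = FZbar and e = e and m = m and b = b2 and V = V
          and jhat = "jhat t" and jtilde = "jtilde t"])
      fix j \<tau> :: nat and \<mu> :: real assume j: "j \<in> {1..J}" and \<tau>: "1 \<le> \<tau>" and \<mu>: "\<bar>\<mu>\<bar> = \<kappa>"
      have "\<bar>\<mu>\<bar> \<le> \<Lambda>" using \<mu> by (simp add: \<kappa>_def)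
      moreover have "\<mu>\<^sup>2 * (K * (\<gamma> * h powr (\<beta> - 1)) * (h + m j \<tau> \<omega>)) = \<mu>\<^sup>2 * V * (x + a * m j \<tau> \<omega>)" for \<omega>
        using a by (simp add: V_def h_def field_simps)
      ultimately show "AE \<omega> in M. real_cond_exp M (FZbar \<tau>) (\<lambda>\<omega>. exp (\<mu> * (e j \<tau> \<omega> - m j \<tau> \<omega>)
          - \<mu>\<^sup>2 * V * (x + a * m j \<tau> \<omega>))) \<omega> \<le> 1"
        using mom[OF j \<tau> h, of \<mu>] by (simp only:)
    next
      show "AE \<omega> in M. \<omega> \<in> S t x \<longrightarrow> (\<Sum>\<tau>=1..t. m (jhat t \<omega>) \<tau> \<omega>) \<ge>
          (1 + 2 * a) * (\<Sum>\<tau>=1..t. m (jtilde t \<omega>) \<tau> \<omega>) + t * x"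
        using risk[of t] jAE[OF t]
      proof eventually_elim
        case (elim \<omega>)
        show ?case
        proof
          assume "\<omega> \<in> S t x"
          then have "(1 + 2 * a) * (1 / t * (\<Sum>\<tau>=1..t. m (jtilde t \<omega>) \<tau> \<omega>)) + x
              \<le> 1 / t * (\<Sum>\<tau>=1..t. m (jhat t \<omega>) \<tau> \<omega>)"
            using elim by (simp add: S_def)
          then have "t * ((1 + 2 * a) * (1 / t * (\<Sum>\<tau>=1..t. m (jtilde t \<omega>) \<tau> \<omega>)) + x)
              \<le> t * (1 / t * (\<Sum>\<tau>=1..t. m (jhat t \<omega>) \<tau> \<omega>))"
            by (rule mult_left_mono) simp
          moreover have "t * (1 / t * y) = y" for y :: real using t by simp
          moreover have "t * ((1 + 2 * a) * (1 / t * y) + x) = (1 + 2 * a) * (t * (1 / t * y)) + t * x" for y :: real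
            by (simp only: distrib_left mult.left_commute)
          ultimately show "(\<Sum>\<tau>=1..t. m (jhat t \<omega>) \<tau> \<omega>) \<ge>
              (1 + 2 * a) * (\<Sum>\<tau>=1..t. m (jtilde t \<omega>) \<tau> \<omega>) + t * x"
            by (simp only:)
        qed
      qed
      show "S t x \<subseteq> space M" by (auto simp: S_def)
    qed (use subFZbar e_M e_past m_past m_nonneg e_bound jAE[OF t] a x \<kappa> V \<kappa>V in auto)
    also have "\<dots> \<le> 2 * real J * (exp (- (t * x powr (2 - \<beta>) * a powr \<beta> / (16 * (1 + a)\<^sup>2 * \<gamma> * K))) +
        exp (- (\<Lambda> * t * x / (4 * (1 + a)))))"
    proof (cases "\<kappa> = \<Lambda>")
      case True
      then show ?thesis by (intro mult_left_mono) auto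
    next
      case False
      then have \<kappa>_eq: "\<kappa> = 1 / (4 * (1 + a) * V)" by (auto simp: \<kappa>_def min_def)
      have "x powr (2 - \<beta>) * a powr \<beta> = x * a / h powr (\<beta> - 1)"
      proof -
        have "h powr (\<beta> - 1) = x powr (\<beta> - 1) / a powr (\<beta> - 1)"
          using x a by (simp add: h_def powr_divide)
        also have "x powr (\<beta> - 1) = x / x powr (2 - \<beta>)"
          using x powr_diff[of x 1 "2 - \<beta>"] by simp
        also have "a powr (\<beta> - 1) = a powr \<beta> / a"
          using a powr_diff[of a \<beta> 1] by simp
        finally show ?thesis using x a by simp
      qed
      then have "\<kappa> * t * x / (4 * (1 + a)) = t * x powr (2 - \<beta>) * a powr \<beta> / (16 * (1 + a)\<^sup>2 * \<gamma> * K)"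
      proof -
        have "1 / (4 * w * (K * (\<gamma> * p) / a)) * t * x / (4 * w) = t * (x * a / p) / (16 * w\<^sup>2 * \<gamma> * K)"
          if "0 < w" "0 < p" for w p :: real
          using that a K iv(2) by (simp add: field_simps power2_eq_square)
        from this[of "1 + a" "h powr (\<beta> - 1)"] show ?thesis
          using a h \<open>x powr (2 - \<beta>) * a powr \<beta> = _\<close> by (simp add: \<kappa>_eq V_def mult.assoc)
      qed
      then show ?thesis by (intro mult_left_mono) auto
    qed
    finally show ?thesis .
  qed

  have v2_pos: "0 < v2"
    using v(1) card_A deg_pos by (auto simp: v2_eq intro!: mult_pos_pos add_nonneg_pos)
  have n1: "1 \<le> real N" "1 \<le> real N'" using N by auto
  have part1: "measure M (S t x) \<le> 2 * J * N *
      (exp (- (t * x powr (2 - \<beta>) / (2 powr (5 - \<beta>) * (1 + a)\<^sup>2 * \<gamma> / a powr \<beta>))) +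
       exp (- (t * x / (8 * (1 + a) * b2 / 3))))"
    if t: "1 \<le> t" and x: "x \<ge> a * (2 powr (- real N) * v2 / \<gamma>) powr (1 / \<beta>)" for t :: nat and x :: real
  proof -
    have x_pos: "0 < x"
      using v2_pos iv(2) a by (intro less_le_trans[OF _ x]) auto
    have "measure M (S t x) \<le> 2 * real J * (exp (- (t * x powr (2 - \<beta>) * a powr \<beta> / (16 * (1 + a)\<^sup>2 * \<gamma> * 1))) +
        exp (- (3 / (2 * b2) * t * x / (4 * (1 + a)))))"
    proof (rule tail[OF t x_pos])
      show "0 < 3 / (2 * b2)" using iii_b2(1) by simp
      fix j \<tau> :: nat and h \<mu> :: real assume j: "j \<in> {1..J}" "1 \<le> \<tau>" "0 < h" and \<mu>: "\<bar>\<mu>\<bar> \<le> 3 / (2 * b2)"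
      have "\<bar>\<mu>\<bar> * b2 \<le> 3 / 2" using \<mu> iii_b2(1) by (simp add: field_simps)
      from moment[OF j this] show "AE \<omega> in M. real_cond_exp M (FZbar \<tau>) (\<lambda>\<omega>. exp (\<mu> * (e j \<tau> \<omega> - m j \<tau> \<omega>)
          - \<mu>\<^sup>2 * (1 * (\<gamma> * h powr (\<beta> - 1)) * (h + m j \<tau> \<omega>)))) \<omega> \<le> 1" by simp
    qed simp
    also have "\<dots> \<le> 2 * real J * (exp (- (t * x powr (2 - \<beta>) / (2 powr (5 - \<beta>) * (1 + a)\<^sup>2 * \<gamma> / a powr \<beta>))) +
        exp (- (t * x / (8 * (1 + a) * b2 / 3))))"
    proof -
      have "(2::real) powr 4 \<le> 2 powr (5 - \<beta>)" using iv(1) by (intro powr_mono) auto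
      then have "16 \<le> (2::real) powr (5 - \<beta>)" by simp
      then have "16 * (1 + a)\<^sup>2 * \<gamma> / a powr \<beta> \<le> 2 powr (5 - \<beta>) * (1 + a)\<^sup>2 * \<gamma> / a powr \<beta>"
        using a iv(2) by (intro divide_right_mono mult_right_mono) auto
      then have "t * x powr (2 - \<beta>) / (2 powr (5 - \<beta>) * (1 + a)\<^sup>2 * \<gamma> / a powr \<beta>) \<le>
          t * x powr (2 - \<beta>) / (16 * (1 + a)\<^sup>2 * \<gamma> / a powr \<beta>)"
        using a iv(2) by (intro divide_left_mono) auto
      then show ?thesis
        using a iii_b2(1) by (intro mult_left_mono add_mono) (auto simp: field_simps)
    qed
    also have "\<dots> \<le> N * (2 * real J * (exp (- (t * x powr (2 - \<beta>) / (2 powr (5 - \<beta>) * (1 + a)\<^sup>2 * \<gamma> / a powr \<beta>))) +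
        exp (- (t * x / (8 * (1 + a) * b2 / 3)))))"
      using mult_right_mono[OF n1(1)] by fastforce
    finally show ?thesis by (simp add: mult_ac)
  qed
  have part2: "measure M (S t x) \<le> 2 * (exp 1)\<^sup>2 * J * N' *
      (exp (- (card A / (t powr \<beta> * deg G) * x powr (2 - \<beta>) /
          (2 powr (6 + 2 * \<beta>) * (exp 1)\<^sup>2 * (1 + a)\<^sup>2 * \<gamma> / a powr \<beta>))) +
       exp (- (card A / deg G * x / (60 * exp 1 * (1 + a) * b2))))"
    if t: "1 \<le> t" and x: "x \<ge> a * b1 * 2 powr (- real N')" for t :: nat and x :: real
  proof -
    define r where "r = real (card A) / deg G"
    have r: "0 < r" using card_A deg_pos by (simp add: r_def)
    have x_pos: "0 < x" using iii_b1(1) a by (intro less_le_trans[OF _ x]) auto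
    have t1: "1 \<le> real t" using t by simp
    have time: "y \<le> t * y" if "0 \<le> y" for y :: real using mult_right_mono[OF t1 that] by simp
    have "1 \<le> exp (1::real)" by simp
    then have e1: "1 \<le> (exp (1::real))\<^sup>2" by (rule one_le_power)
    let ?P = "t * x powr (2 - \<beta>) * a powr \<beta> / (16 * (1 + a)\<^sup>2 * \<gamma> * (1 / r))"
    let ?Q = "3 * r / (4 * b2) * t * x / (4 * (1 + a))"
    let ?P' = "card A / (t powr \<beta> * deg G) * x powr (2 - \<beta>) /
      (2 powr (6 + 2 * \<beta>) * (exp 1)\<^sup>2 * (1 + a)\<^sup>2 * \<gamma> / a powr \<beta>)"
    let ?Q' = "card A / deg G * x / (60 * exp 1 * (1 + a) * b2)"
    have "measure M (S t x) \<le> 2 * real J * (exp (- ?P) + exp (- ?Q))"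
    proof (rule tail[OF t x_pos])
      show "0 < 1 / r" "0 < 3 * r / (4 * b2)" using r iii_b2(1) by auto
      fix j \<tau> :: nat and h \<mu> :: real assume j: "j \<in> {1..J}" "1 \<le> \<tau>" "0 < h" and \<mu>: "\<bar>\<mu>\<bar> \<le> 3 * r / (4 * b2)"
      have "\<bar>\<mu>\<bar> * (2 * b2) * (1 / r) \<le> 3 / 2" using \<mu> r iii_b2(1) by (simp add: field_simps)
      then have "\<bar>\<mu>\<bar> * (2 * b2) * (deg G / card A) \<le> 3 / 2" by (simp add: r_def)
      from moment_graph[OF j this] show "AE \<omega> in M. real_cond_exp M (FZbar \<tau>) (\<lambda>\<omega>. exp (\<mu> * (e j \<tau> \<omega> - m j \<tau> \<omega>)
          - \<mu>\<^sup>2 * (1 / r * (\<gamma> * h powr (\<beta> - 1)) * (h + m j \<tau> \<omega>)))) \<omega> \<le> 1" by (simp add: r_def)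
    qed
    also have "\<dots> \<le> 2 * real J * (exp (- ?P') + exp (- ?Q'))"
    proof -
      have "?P' \<le> ?P"
      proof -
        let ?c = "r * x powr (2 - \<beta>) * a powr \<beta> / ((1 + a)\<^sup>2 * \<gamma>)"
        have c: "0 \<le> ?c" using r a iv(2) by simp
        have "(2::real) powr 4 \<le> 2 powr (6 + 2 * \<beta>)" using iv(1) by (intro powr_mono) auto
        then have "16 \<le> (2::real) powr (6 + 2 * \<beta>)" by simp
        then have "16 * 1 \<le> (2::real) powr (6 + 2 * \<beta>) * (exp 1)\<^sup>2"
          using e1 by (intro mult_mono) auto
        moreover have "1 \<le> real t powr \<beta>" using t1 iv(1) by (intro ge_one_powr_ge_zero) auto
        ultimately have "1 * 16 \<le> real t powr \<beta> * (2 powr (6 + 2 * \<beta>) * (exp 1)\<^sup>2)"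
          by (intro mult_mono) auto
        then have "?c / (real t powr \<beta> * (2 powr (6 + 2 * \<beta>) * (exp 1)\<^sup>2)) \<le> ?c / 16"
          using c by (intro divide_left_mono) auto
        also have "\<dots> \<le> t * (?c / 16)" by (rule time, rule divide_nonneg_pos[OF c]) simp
        also have "\<dots> = ?P" using r by (simp add: mult_ac)
        finally show ?thesis by (simp add: r_def mult_ac)
      qed
      moreover have "?Q' \<le> ?Q"
      proof -
        let ?c = "r * x / ((1 + a) * b2)"
        have c: "0 \<le> ?c" using r a x_pos iii_b2(1) by simp
        have "16 / 3 \<le> 60 * exp (1::real)" using \<open>1 \<le> exp (1::real)\<close> by linarith
        then have le: "?c / (60 * exp 1) \<le> ?c / (16 / 3)" using c by (intro divide_left_mono) auto
        have "?Q' = ?c / (60 * exp 1)"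
          using a iii_b2(1) by (simp add: r_def field_simps)
        also note le
        also have "?c / (16 / 3) \<le> t * (?c / (16 / 3))" by (rule time, rule divide_nonneg_pos[OF c]) simp
        also have "\<dots> = ?Q" using a iii_b2(1) by (simp add: field_simps)
        finally show ?thesis .
      qed
      ultimately show ?thesis by (intro mult_left_mono add_mono) auto
    qed
    also have "\<dots> \<le> ((exp 1)\<^sup>2 * N') * (2 * real J * (exp (- ?P') + exp (- ?Q')))"
    proof -
      have "1 * 1 \<le> (exp (1::real))\<^sup>2 * N'" using e1 n1(2) by (intro mult_mono) auto
      from mult_right_mono[OF this, of "2 * real J * (exp (- ?P') + exp (- ?Q'))"] show ?thesis by simp
    qed
    finally show ?thesis by (simp only: mult_ac of_nat_mult of_nat_numeral)
  qed
  show ?thesis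
    using part1 part2 unfolding S_def by blast
qed

end
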